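(* The set $\{\pi_1/\pi_2 : \pi_1, \pi_2 \text{ are Gaussian primes}\}$ is dense in $\mathbb{C}$.
   Context: The Gaussian integers are $\mathbb{Z}[i]=\{a+bi : a,b\in\mathbb{Z}\}$. A Gaussian prime is a prime element of $\mathbb{Z}[i]$, i.e. a nonzero nonunit $\pi\in\mathbb{Z}[i]$ such that $\pi\mid\alpha\beta$ with $\alpha,\beta\in\mathbb{Z}[i]$ implies $\pi\mid\alpha$ or $\pi\mid\beta$. Equivalently, $\pi$ is an associate ($\pm p$, $\pm pi$) of a rational prime $p\equiv 3 \pmod 4$, or $\pi=a+bi$ with $a^2+b^2$ a rational prime. *)

theory Defs
  imports "HOL-Analysis.Analysis"
begin

definition gaussian_integers :: "complex set" where
  "gaussian_integers = {Complex (of_int a) (of_int b) | a b :: int. True}"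

text \<open>Divisibility inside the subring. The relation \<^term>\<open>(dvd)\<close> on type \<^typ>\<open>complex\<close>
  is divisibility in a field, hence trivial, so the cofactor is required to be a Gaussian integer.\<close>

definition gaussian_dvd :: "complex \<Rightarrow> complex \<Rightarrow> bool" where
  "gaussian_dvd x y \<longleftrightarrow> (\<exists>z \<in> gaussian_integers. y = x * z)"

text \<open>The condition \<^term>\<open>\<not> gaussian_dvd p 1\<close> says that \<^term>\<open>p\<close> is not a unit.\<close>

definition gaussian_prime :: "complex \<Rightarrow> bool" where
  "gaussian_prime p \<longleftrightarrow>
     p \<in> gaussian_integers \<and> p \<noteq> 0 \<and> \<not> gaussian_dvd p 1 \<and>
     (\<forall>x \<in> gaussian_integers. \<forall>y \<in> gaussian_integers.
        gaussian_dvd p (x * y) \<longrightarrow> gaussian_dvd p x \<or> gaussian_dvd p y)"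

end

theory Submission
  imports Defs "HOL-Complex_Analysis.Cauchy_Integral_Formula"
begin

text \<open>
  Let $D_k(w) = \sum_p \ln |p|\, (p/|p|)^k |p|^{-2-w}$, summed over all Gaussian primes. If no quotient
  $p/q$ is near $z$, choose a test function $\Phi$ on $\mathbb{C}^\times \cong \mathbb{R} \times S^1$ that is
  nonpositive away from the identity, and whose Fourier transform $\hat\Phi$ has compact support and is positive
  at the trivial character. Then
  $\sum_{p,q} \ln |p| \ln |q|\, |pq|^{-2-s}\, \Phi(p/(qz)) \le 0$ for all $s > 0$, while by Fourier expansion this sum
  is $\sum_k \int \hat\Phi(k,t)\, \chi_{k,t}(z)^{-1}\, |D_k(s+it)|^2\, dt$ (up to normalisation). As $s \to 0^+$ the pole of $D_0$
  at $0$ contributes a positive multiple of $1/s$ and everything else stays bounded, a contradiction.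

  The boundedness needs only that the Hecke $L$-series continue slightly past the edge of convergence and
  do not vanish there. The continuation is obtained by comparing the sum over $\mathbb{Z}[i]$ with the sum
  over the multiples of $a + i$, the nonvanishing from the 3-4-1 inequality.
\<close>

section \<open>Gaussian integers\<close>

text \<open>The obstacle is uniformity: the prime sums are controlled only locally, near one point
  of the edge and for one frequency k at a time. Hence the test function must have finitely many
  angular frequencies and a compactly supported radial transform, so that compactness turns local
  bounds into a single one. Such a band-limited function cannot vanish outside a small neighbourhood
  of the identity; being nonpositive there is the attainable substitute, and it suffices because all
  pairs of primes carry nonnegative weights. Squaring D_k is what brings in quotients, since
  conjugation inverts the phase at the second prime. It also creates the contradiction: near t = 0
  the simple pole makes |D_0(s+it)|^2 about 16/(s^2+t^2), whose integral over a fixed interval grows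
  like 1/s. Frequencies not divisible by 4 drop out because multiplication by i permutes the primes.
  Among the remaining nontrivial characters none is quadratic, since doubling (k,t) never gives the
  trivial one; so 3-4-1 covers all of them without an exceptional case.\<close>

lemma gaussian_integers_iff: "z \<in> gaussian_integers \<longleftrightarrow> Re z \<in> \<int> \<and> Im z \<in> \<int>"
proof
  assume "Re z \<in> \<int> \<and> Im z \<in> \<int>"
  then obtain a b where "Re z = of_int a" "Im z = of_int b"
    by (auto elim!: Ints_cases)
  then have "z = Complex (of_int a) (of_int b)"
    by (simp add: complex_eq_iff)
  then show "z \<in> gaussian_integers"
    unfolding gaussian_integers_def by blast
qed (auto simp: gaussian_integers_def)

lemma gaussian_add [intro, simp]: "x \<in> gaussian_integers \<Longrightarrow> y \<in> gaussian_integers \<Longrightarrow> x + y \<in> gaussian_integers"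
  and gaussian_diff [intro, simp]: "x \<in> gaussian_integers \<Longrightarrow> y \<in> gaussian_integers \<Longrightarrow> x - y \<in> gaussian_integers"
  and gaussian_mult [intro, simp]: "x \<in> gaussian_integers \<Longrightarrow> y \<in> gaussian_integers \<Longrightarrow> x * y \<in> gaussian_integers"
  and gaussian_uminus [intro, simp]: "x \<in> gaussian_integers \<Longrightarrow> - x \<in> gaussian_integers"
  and gaussian_of_int [intro, simp]: "of_int n \<in> gaussian_integers"
  and gaussian_ii [intro, simp]: "\<i> \<in> gaussian_integers"
  and gaussian_0 [intro, simp]: "0 \<in> gaussian_integers"
  and gaussian_1 [intro, simp]: "1 \<in> gaussian_integers"
  by (auto simp: gaussian_integers_iff)

lemma gaussian_power [intro, simp]: "x \<in> gaussian_integers \<Longrightarrow> x ^ n \<in> gaussian_integers"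
  by (induction n) auto

lemma gaussian_norm_sq_nat:
  assumes "z \<in> gaussian_integers"
  obtains n :: nat where "(norm z)\<^sup>2 = of_nat n"
proof -
  obtain a b :: int where "z = Complex (of_int a) (of_int b)"
    using assms unfolding gaussian_integers_def by blast
  then have "(norm z)\<^sup>2 = of_int (a\<^sup>2 + b\<^sup>2)"
    by (simp add: cmod_power2)
  also have "\<dots> = of_nat (nat (a\<^sup>2 + b\<^sup>2))"
    by simp
  finally show ?thesis using that by blast
qed

lemma gaussian_norm_ge_1:
  assumes "z \<in> gaussian_integers" "z \<noteq> 0"
  shows "norm z \<ge> 1"
proof -
  obtain n :: nat where n: "(norm z)\<^sup>2 = of_nat n"
    using gaussian_norm_sq_nat assms by metis
  have "n \<noteq> 0"
    using n assms by (intro notI) simp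
  then have "1\<^sup>2 \<le> (norm z)\<^sup>2"
    using n by simp
  then show ?thesis
    using power2_le_imp_le norm_ge_zero by blast
qed

text \<open>The squared norm is a natural number, so it jumps from 1 to at least 2. This gap
  supplies the geometric factors for prime powers and for nonunits far to the right.\<close>

lemma gaussian_norm_ge_sqrt2:
  assumes "z \<in> gaussian_integers" "z \<noteq> 0" "norm z \<noteq> 1"
  shows "norm z \<ge> sqrt 2"
proof -
  obtain n :: nat where n: "(norm z)\<^sup>2 = of_nat n"
    using gaussian_norm_sq_nat assms by metis
  have "n \<noteq> 0"
    using n assms by (intro notI) simp
  moreover have "n \<noteq> 1"
    using n assms norm_ge_zero[of z] by (auto simp: power2_eq_1_iff simp del: norm_ge_zero)
  ultimately have "2 \<le> (norm z)\<^sup>2"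
    using n by simp
  then show ?thesis
    using real_le_lsqrt by (metis norm_ge_zero real_sqrt_le_iff real_sqrt_pow2 real_sqrt_unique)
qed

lemma gaussian_norm_1_inverse:
  assumes "z \<in> gaussian_integers" "norm z = 1"
  shows "inverse z \<in> gaussian_integers"
proof -
  have "inverse z = cnj z"
    using assms(2) by (metis complex_norm_square inverse_unique mult.commute of_real_1 one_power2)
  then show ?thesis
    using assms(1) by (simp add: gaussian_integers_iff)
qed

lemma gaussian_norm_1_cases:
  assumes "z \<in> gaussian_integers" "norm z = 1"
  shows "z \<in> {1, -1, \<i>, -\<i>}"
proof -
  obtain a b :: int where z: "z = Complex (of_int a) (of_int b)"
    using assms unfolding gaussian_integers_def by blast
  have "of_int (a\<^sup>2 + b\<^sup>2) = (norm z)\<^sup>2"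
    using z by (simp add: cmod_power2)
  then have ab: "a\<^sup>2 + b\<^sup>2 = 1"
    using assms(2) by (metis of_int_eq_1_iff one_power2)
  then have "a\<^sup>2 \<le> 1" "b\<^sup>2 \<le> 1"
    by (metis le_add_same_cancel1 zero_le_power2, metis le_add_same_cancel2 zero_le_power2)
  then have "\<bar>a\<bar> \<le> 1" "\<bar>b\<bar> \<le> 1"
    by (simp_all add: abs_square_le_1)
  then have "a \<in> {-1,0,1}" "b \<in> {-1,0,1}"
    by auto
  then show ?thesis
    using ab z by (auto simp: complex_eq_iff)
qed

section \<open>Divisibility and units\<close>

lemma gaussian_dvd_refl [simp]: "gaussian_dvd x x"
  unfolding gaussian_dvd_def by (rule bexI[of _ 1]) auto

lemma gaussian_dvd_triv [simp]: "y \<in> gaussian_integers \<Longrightarrow> gaussian_dvd x (x * y)"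
  unfolding gaussian_dvd_def by auto

lemma gaussian_dvd_trans: "gaussian_dvd x y \<Longrightarrow> gaussian_dvd y z \<Longrightarrow> gaussian_dvd x z"
  unfolding gaussian_dvd_def by (auto simp: mult.assoc)

lemma gaussian_dvd_mult: "gaussian_dvd x y \<Longrightarrow> z \<in> gaussian_integers \<Longrightarrow> gaussian_dvd x (y * z)"
  unfolding gaussian_dvd_def by (auto simp: mult.assoc)

lemma gaussian_dvd_add: "gaussian_dvd x y \<Longrightarrow> gaussian_dvd x z \<Longrightarrow> gaussian_dvd x (y + z)"
  unfolding gaussian_dvd_def by (auto simp: distrib_left[symmetric])

lemma gaussian_dvd_1_iff:
  assumes "z \<in> gaussian_integers"
  shows "gaussian_dvd z 1 \<longleftrightarrow> norm z = 1"
proof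
  assume "gaussian_dvd z 1"
  then obtain y where y: "y \<in> gaussian_integers" "1 = z * y"
    unfolding gaussian_dvd_def by auto
  then have "z \<noteq> 0" "y \<noteq> 0"
    by auto
  moreover have "norm z * norm y = 1"
    using y(2) by (metis norm_mult norm_one)
  ultimately show "norm z = 1"
    using gaussian_norm_ge_1[OF assms] gaussian_norm_ge_1[OF y(1)]
    using mult_left_mono[of 1 "norm y" "norm z"] by simp
next
  assume "norm z = 1"
  then have "inverse z \<in> gaussian_integers" "z \<noteq> 0"
    using gaussian_norm_1_inverse[OF assms] by auto
  then have "1 = z * inverse z" "inverse z \<in> gaussian_integers"
    by simp_all
  then show "gaussian_dvd z 1"
    unfolding gaussian_dvd_def by blast
qed

lemma gaussian_prime_norm_gt_1: "gaussian_prime p \<Longrightarrow> norm p > 1"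
  unfolding gaussian_prime_def using gaussian_norm_ge_1 gaussian_dvd_1_iff by force

section \<open>Euclidean division and existence of prime divisors\<close>

text \<open>Rounding both coordinates of \<open>x / y\<close> leaves an error in the square of
  half-side 1/2, whose squared modulus is at most 1/2.\<close>

lemma gaussian_division:
  assumes "x \<in> gaussian_integers" "y \<in> gaussian_integers" "y \<noteq> 0"
  obtains q where "q \<in> gaussian_integers" "norm (x - q * y) < norm y"
proof -
  define q where "q = Complex (of_int (round (Re (x / y)))) (of_int (round (Im (x / y))))"
  have q: "q \<in> gaussian_integers"
    unfolding q_def gaussian_integers_def by blast
  have r: "\<bar>Re (x / y - q)\<bar> \<le> 1/2" "\<bar>Im (x / y - q)\<bar> \<le> 1/2"
    unfolding q_def using of_int_round_abs_le[of "Re (x/y)"] of_int_round_abs_le[of "Im (x/y)"]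
    by (simp_all add: abs_minus_commute)
  have "(norm (x / y - q))\<^sup>2 = (Re (x / y - q))\<^sup>2 + (Im (x / y - q))\<^sup>2"
    by (rule cmod_power2)
  also have "\<dots> \<le> (1/2)\<^sup>2 + (1/2)\<^sup>2"
    using r by (intro add_mono) (metis abs_ge_zero power2_abs power_mono)+
  finally have "(norm (x / y - q))\<^sup>2 < 1\<^sup>2"
    by (simp add: power2_eq_square)
  then have "norm (x / y - q) < 1"
    using power2_less_imp_less zero_le_one by blast
  moreover have "x - q * y = (x / y - q) * y"
    using assms by (simp add: field_simps)
  ultimately have "norm (x - q * y) < norm y"
    using assms(3) by (simp add: norm_mult)
  then show ?thesis
    using q that by blast
qed

text \<open>Squared norms are natural numbers, so the least number principle applies to
  them.\<close>

lemma gaussian_min_norm: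
  assumes "z \<in> gaussian_integers" "P z"
  shows "\<exists>y\<in>gaussian_integers. P y \<and> (\<forall>x\<in>gaussian_integers. P x \<longrightarrow> norm y \<le> norm x)"
proof -
  let ?Q = "\<lambda>y. y \<in> gaussian_integers \<and> P y"
  let ?m = "\<lambda>y. nat \<lfloor>(norm y)\<^sup>2\<rfloor>"
  obtain y where y: "?Q y" "\<And>x. ?Q x \<Longrightarrow> ?m y \<le> ?m x"
    using ex_has_least_nat[of ?Q z ?m] assms by blast
  have "norm y \<le> norm x" if x: "x \<in> gaussian_integers" "P x" for x
  proof -
    obtain n where n: "(norm y)\<^sup>2 = of_nat n"
      using gaussian_norm_sq_nat[of y] y(1) by blast
    obtain k where k: "(norm x)\<^sup>2 = of_nat k"
      using gaussian_norm_sq_nat[of x] x by blast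
    have "(norm y)\<^sup>2 \<le> (norm x)\<^sup>2"
      using y(2)[of x] x n k by simp
    then show ?thesis
      using power2_le_imp_le norm_ge_zero by blast
  qed
  then show ?thesis
    using y(1) by blast
qed

text \<open>A nonzero element \<open>d\<close> of least norm in the ideal generated by
  \<open>p\<close> and \<open>x\<close> divides every \<open>u\<close> in it: the remainder of
  \<open>u\<close> on division by \<open>d\<close> lies in the ideal and is smaller than
  \<open>d\<close>, hence zero.\<close>

lemma gaussian_bezout:
  assumes p: "p \<in> gaussian_integers" "p \<noteq> 0" and x: "x \<in> gaussian_integers"
  obtains a b d where "a \<in> gaussian_integers" "b \<in> gaussian_integers" "d = a * p + b * x" "d \<noteq> 0"
    "gaussian_dvd d p" "gaussian_dvd d x"
proof -
  define I where "I = (\<lambda>(a, b). a * p + b * x) ` (gaussian_integers \<times> gaussian_integers)"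
  have I_gauss: "I \<subseteq> gaussian_integers"
    unfolding I_def using p x by auto
  have II: "a * p + b * x \<in> I" if "a \<in> gaussian_integers" "b \<in> gaussian_integers" for a b
    unfolding I_def using that by (intro image_eqI[of _ _ "(a, b)"]) auto
  have I_closed: "u - q * v \<in> I" if uv: "u \<in> I" "v \<in> I" "q \<in> gaussian_integers" for u v q
  proof -
    obtain a b where u: "a \<in> gaussian_integers" "b \<in> gaussian_integers" "u = a * p + b * x"
      using uv(1) unfolding I_def by auto
    obtain a' b' where v: "a' \<in> gaussian_integers" "b' \<in> gaussian_integers" "v = a' * p + b' * x"
      using uv(2) unfolding I_def by auto
    have "u - q * v = (a - q * a') * p + (b - q * b') * x"
      unfolding u v by (simp add: algebra_simps)
    moreover have "(a - q * a') * p + (b - q * b') * x \<in> I"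
      using u v uv(3) by (intro II) auto
    ultimately show ?thesis
      by simp
  qed
  have Ip: "p \<in> I" and Ix: "x \<in> I"
    using II[of 1 0] II[of 0 1] by simp_all
  have "p \<in> I - {0}"
    using Ip p by simp
  from gaussian_min_norm[of p "\<lambda>u. u \<in> I - {0}", OF p(1) this]
  obtain d where d': "d \<in> I - {0} \<and> (\<forall>u\<in>gaussian_integers. u \<in> I - {0} \<longrightarrow> norm d \<le> norm u)"
    by (rule bexE)
  then have d: "d \<in> I" "d \<noteq> 0"
    by auto
  have dmin: "norm d \<le> norm u" if "u \<in> I" "u \<noteq> 0" for u
    using d' that I_gauss by blast
  have d_dvd: "gaussian_dvd d u" if u: "u \<in> I" for u
  proof -
    obtain q where q: "q \<in> gaussian_integers" "norm (u - q * d) < norm d"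
      using gaussian_division[of u d] u d(1) d(2) I_gauss by (metis subsetD)
    have "u - q * d \<in> I"
      by (rule I_closed[OF u d(1) q(1)])
    then have "u - q * d = 0"
      using dmin q(2) by (meson not_le)
    then have "u = d * q"
      by (simp add: mult.commute)
    then show ?thesis
      using q(1) unfolding gaussian_dvd_def by blast
  qed
  obtain a b where "a \<in> gaussian_integers" "b \<in> gaussian_integers" "d = a * p + b * x"
    using d(1) unfolding I_def by auto
  then show ?thesis
    using that d(2) d_dvd[OF Ip] d_dvd[OF Ix] by blast
qed

text \<open>A nonunit divisor \<open>p\<close> of \<open>z\<close> of least norm is prime. If it
  does not divide \<open>x\<close>, the common divisor \<open>d\<close> of \<open>p\<close> and
  \<open>x\<close> from Bezout is a unit: otherwise minimality makes \<open>d\<close> an associate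
  of \<open>p\<close>, and \<open>p\<close> would divide \<open>x\<close>. Multiplying the Bezout
  identity by \<open>y\<close> then shows that \<open>p\<close> divides \<open>y\<close>.\<close>

lemma gaussian_prime_divisor_exists:
  assumes z: "z \<in> gaussian_integers" "z \<noteq> 0" "norm z \<noteq> 1"
  obtains p where "gaussian_prime p" "gaussian_dvd p z"
proof -
  define X where "X = {x \<in> gaussian_integers. x \<noteq> 0 \<and> norm x \<noteq> 1 \<and> gaussian_dvd x z}"
  have "z \<in> X"
    using z unfolding X_def by simp
  from gaussian_min_norm[of z "\<lambda>x. x \<in> X", OF z(1) this]
  obtain p where p': "p \<in> X \<and> (\<forall>x\<in>gaussian_integers. x \<in> X \<longrightarrow> norm p \<le> norm x)"
    by (rule bexE)
  have pmin: "norm p \<le> norm x" if "x \<in> X" for x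
    using p' that unfolding X_def by blast
  have p: "p \<in> gaussian_integers" "p \<noteq> 0" "norm p \<noteq> 1" "gaussian_dvd p z"
    using p' unfolding X_def by auto
  have "gaussian_dvd p y"
    if xy: "x \<in> gaussian_integers" "y \<in> gaussian_integers" "gaussian_dvd p (x * y)" "\<not> gaussian_dvd p x" for x y
  proof -
    obtain a b d where ab: "a \<in> gaussian_integers" "b \<in> gaussian_integers" "d = a * p + b * x"
      and d: "d \<noteq> 0" "gaussian_dvd d p" "gaussian_dvd d x"
      using gaussian_bezout[OF p(1,2) xy(1)] .
    have dG: "d \<in> gaussian_integers"
      using ab p xy by simp
    have "norm d = 1"
    proof (rule ccontr)
      assume "norm d \<noteq> 1"
      then have "d \<in> X"
        unfolding X_def using d dG gaussian_dvd_trans[OF d(2) p(4)] by simp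
      then have *: "norm p \<le> norm d"
        by (rule pmin)
      obtain e where e: "e \<in> gaussian_integers" "p = d * e"
        using d(2) unfolding gaussian_dvd_def by blast
      have "e \<noteq> 0"
        using e p by auto
      have "norm d * norm e \<le> norm d * 1"
        using e(2) * by (simp add: norm_mult)
      then have "norm e \<le> 1"
        using d(1) by (simp add: mult_le_cancel_left)
      then have "norm e = 1"
        using gaussian_norm_ge_1[OF e(1) \<open>e \<noteq> 0\<close>] by simp
      then have "inverse e \<in> gaussian_integers" "d = p * inverse e"
        using e gaussian_norm_1_inverse \<open>e \<noteq> 0\<close> by auto
      then have "gaussian_dvd p d"
        unfolding gaussian_dvd_def by blast
      then show False
        using d(3) xy(4) gaussian_dvd_trans by blast
    qed
    then have inv: "inverse d \<in> gaussian_integers"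
      using dG gaussian_norm_1_inverse by blast
    have "p * (a * (inverse d * y)) + (x * y) * (b * inverse d) = (a * p + b * x) * inverse d * y"
      by (simp add: algebra_simps)
    also have "\<dots> = y"
      using ab(3)[symmetric] d(1) by simp
    finally have y: "p * (a * (inverse d * y)) + (x * y) * (b * inverse d) = y" .
    have "gaussian_dvd p (p * (a * (inverse d * y)) + (x * y) * (b * inverse d))"
      by (rule gaussian_dvd_add[OF gaussian_dvd_triv gaussian_dvd_mult[OF xy(3)]]) (use ab inv xy in auto)
    then show ?thesis
      by (simp only: y)
  qed
  moreover have "\<not> gaussian_dvd p 1"
    using p gaussian_dvd_1_iff by simp
  ultimately have "gaussian_prime p"
    unfolding gaussian_prime_def using p(1,2) by blast
  then show ?thesis
    using p(4) that by blast
qed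

section \<open>Prime power divisors and the von Mangoldt identity\<close>

text \<open>Listing every exponent separately encodes multiplicity without a valuation: a prime of
  multiplicity m occurs in m pairs. Associates count as different primes.\<close>

definition prime_power_divisors :: "complex \<Rightarrow> (complex \<times> nat) set" where
  "prime_power_divisors z = {(p, j). gaussian_prime p \<and> j \<ge> 1 \<and> gaussian_dvd (p ^ j) z}"

lemma gaussian_prime_associate:
  assumes "gaussian_prime p" "norm u = 1" "u \<in> gaussian_integers"
  shows "gaussian_prime (u * p)"
proof -
  have u: "inverse u \<in> gaussian_integers" "u \<noteq> 0"
    using gaussian_norm_1_inverse assms by auto
  have dvd_iff: "gaussian_dvd (u * p) x \<longleftrightarrow> gaussian_dvd p x" for x
  proof
    show "gaussian_dvd (u * p) x \<Longrightarrow> gaussian_dvd p x"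
      unfolding gaussian_dvd_def using assms(3) by (metis gaussian_mult mult.assoc mult.commute)
    assume "gaussian_dvd p x"
    then obtain z where "z \<in> gaussian_integers" "x = p * z"
      unfolding gaussian_dvd_def by blast
    then show "gaussian_dvd (u * p) x"
      unfolding gaussian_dvd_def using u by (intro bexI[of _ "inverse u * z"]) auto
  qed
  show ?thesis
    using assms u unfolding gaussian_prime_def dvd_iff by auto
qed

lemma gaussian_dvd_mult_associate_iff:
  assumes "norm u = 1" "u \<in> gaussian_integers" "q \<noteq> 0"
  shows "gaussian_dvd ((u * q) ^ Suc j) (q * z) \<longleftrightarrow> gaussian_dvd ((u * q) ^ j) z"
proof
  have u: "inverse u \<in> gaussian_integers" "u \<noteq> 0"
    using gaussian_norm_1_inverse assms by auto
  {
    assume "gaussian_dvd ((u * q) ^ Suc j) (q * z)"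
    then obtain y where y: "y \<in> gaussian_integers" "q * z = (u * q) ^ Suc j * y"
      unfolding gaussian_dvd_def by blast
    then have "z = (u * q) ^ j * (u * y)"
      using assms(3) by simp
    then show "gaussian_dvd ((u * q) ^ j) z"
      unfolding gaussian_dvd_def using assms y by blast
  next
    assume "gaussian_dvd ((u * q) ^ j) z"
    then obtain y where y: "y \<in> gaussian_integers" "z = (u * q) ^ j * y"
      unfolding gaussian_dvd_def by blast
    then have "q * z = (u * q) ^ Suc j * (inverse u * y)"
      using u by simp
    then show "gaussian_dvd ((u * q) ^ Suc j) (q * z)"
      unfolding gaussian_dvd_def using u y by blast
  }
qed

text \<open>Induction on the exponent: once \<open>p ^ j\<close> has been cancelled, primality is
  applied to the remaining product \<open>q * x\<close>.\<close>

lemma gaussian_dvd_mult_nonassociate_iff: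
  assumes p: "gaussian_prime p" and q: "q \<in> gaussian_integers" "\<not> gaussian_dvd p q"
    and z: "z \<in> gaussian_integers"
  shows "gaussian_dvd (p ^ j) (q * z) \<longleftrightarrow> gaussian_dvd (p ^ j) z"
proof
  show "gaussian_dvd (p ^ j) z \<Longrightarrow> gaussian_dvd (p ^ j) (q * z)"
    using gaussian_dvd_mult q(1) by (metis mult.commute)
  show "gaussian_dvd (p ^ j) (q * z) \<Longrightarrow> gaussian_dvd (p ^ j) z"
  proof (induction j)
    case 0
    then show ?case
      using z unfolding gaussian_dvd_def by auto
  next
    case (Suc j)
    have p': "p \<in> gaussian_integers" "p \<noteq> 0"
      using p unfolding gaussian_prime_def by auto
    obtain y where y: "y \<in> gaussian_integers" "q * z = p ^ Suc j * y"
      using Suc.prems unfolding gaussian_dvd_def by blast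
    have "gaussian_dvd (p ^ j) (q * z)"
      using y p' unfolding gaussian_dvd_def by (auto intro!: bexI[of _ "p * y"])
    then obtain x where x: "x \<in> gaussian_integers" "z = p ^ j * x"
      using Suc.IH unfolding gaussian_dvd_def by blast
    have "q * x = p * y"
      using x(2) y(2) p' by (simp add: algebra_simps)
    then have "gaussian_dvd p (q * x)"
      using y unfolding gaussian_dvd_def by auto
    then have "gaussian_dvd p x"
      using p q x unfolding gaussian_prime_def by blast
    then show ?case
      using x unfolding gaussian_dvd_def by (auto simp: mult.assoc mult.left_commute)
  qed
qed

text \<open>Write q = p e. Primality of \<open>q\<close> makes it divide \<open>p\<close> or
  \<open>e\<close>, and the latter would turn \<open>p\<close> into a unit.\<close>

lemma gaussian_primes_dvd_associate:
  assumes p: "gaussian_prime p" and q: "gaussian_prime q" and "gaussian_dvd p q"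
  obtains u where "u \<in> gaussian_integers" "norm u = 1" "p = u * q"
proof -
  have p': "p \<in> gaussian_integers" "p \<noteq> 0" "norm p > 1"
    using p gaussian_prime_norm_gt_1 unfolding gaussian_prime_def by auto
  have q': "q \<in> gaussian_integers" "q \<noteq> 0" "norm q > 1"
    using q gaussian_prime_norm_gt_1 unfolding gaussian_prime_def by auto
  obtain e where e: "e \<in> gaussian_integers" "q = p * e"
    using assms(3) unfolding gaussian_dvd_def by blast
  have "gaussian_dvd q p \<or> gaussian_dvd q e"
    using q e p' unfolding gaussian_prime_def by (metis gaussian_dvd_refl)
  moreover have "\<not> gaussian_dvd q e"
  proof
    assume "gaussian_dvd q e"
    then obtain f where f: "f \<in> gaussian_integers" "e = q * f"
      unfolding gaussian_dvd_def by blast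
    then have "1 = p * f"
      using e q' by simp
    then show False
      using f p p' unfolding gaussian_prime_def gaussian_dvd_def by blast
  qed
  ultimately obtain u where u: "u \<in> gaussian_integers" "p = q * u"
    unfolding gaussian_dvd_def by blast
  have "q * (u * e) = p * e"
    unfolding u(2) by (simp only: mult_ac)
  also have "\<dots> = q * 1"
    using e(2) by simp
  finally have "1 = u * e"
    using q'(2) by simp
  then have "norm u = 1"
    using gaussian_dvd_1_iff[of u] u(1) e(1) gaussian_dvd_triv[of e u] by simp
  then show ?thesis
    using that u by (simp add: mult.commute)
qed

text \<open>\<open>A\<close> is the set of associates of \<open>q\<close>. Multiplication by
  \<open>q\<close> lengthens their chains of exponents from 1, ..., m to 1, ..., m + 1: the shift
  produces 2, ..., m + 1 and \<open>A \<times> {1}\<close> restores the exponent 1. All other primes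
  keep their chains.\<close>

lemma prime_power_divisors_mult:
  assumes q: "gaussian_prime q" and z: "z \<in> gaussian_integers"
  defines "A \<equiv> {q, - q, \<i> * q, - \<i> * q}"
  shows "prime_power_divisors (q * z) =
    (\<lambda>(p, j). (p, if p \<in> A then Suc j else j)) ` prime_power_divisors z \<union> A \<times> {1}"
proof -
  have q': "q \<in> gaussian_integers" "q \<noteq> 0"
    using q unfolding gaussian_prime_def by auto
  have A_iff: "p \<in> A \<longleftrightarrow> (\<exists>u\<in>gaussian_integers. norm u = 1 \<and> p = u * q)" for p
  proof
    assume "p \<in> A"
    then have "p = 1 * q \<or> p = -1 * q \<or> p = \<i> * q \<or> p = (-\<i>) * q"
      unfolding A_def by auto
    then show "\<exists>u\<in>gaussian_integers. norm u = 1 \<and> p = u * q"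
      by (metis gaussian_1 gaussian_ii gaussian_uminus norm_ii norm_minus_cancel norm_one)
  next
    assume "\<exists>u\<in>gaussian_integers. norm u = 1 \<and> p = u * q"
    then show "p \<in> A"
      using gaussian_norm_1_cases unfolding A_def by fastforce
  qed
  have A_prime: "gaussian_prime p" if "p \<in> A" for p
    using that A_iff gaussian_prime_associate[OF q] by auto
  have dvd_A: "gaussian_dvd (p ^ Suc j) (q * z) \<longleftrightarrow> gaussian_dvd (p ^ j) z" if "p \<in> A" for p j
    using that q' unfolding A_iff by (auto simp: gaussian_dvd_mult_associate_iff simp del: power_Suc)
  have dvd_nA: "gaussian_dvd (p ^ j) (q * z) \<longleftrightarrow> gaussian_dvd (p ^ j) z"
    if "p \<notin> A" "gaussian_prime p" for p j
  proof -
    have "\<not> gaussian_dvd p q"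
      using that q gaussian_primes_dvd_associate[of p q] A_iff by metis
    then show ?thesis
      using gaussian_dvd_mult_nonassociate_iff[of p q] that q' z by blast
  qed
  show ?thesis
  proof (intro set_eqI iffI)
    fix x assume x: "x \<in> prime_power_divisors (q * z)"
    obtain p j where pj: "x = (p, j)" by force
    have *: "gaussian_prime p" "j \<ge> 1" "gaussian_dvd (p ^ j) (q * z)"
      using x pj unfolding prime_power_divisors_def by auto
    show "x \<in> (\<lambda>(p, j). (p, if p \<in> A then Suc j else j)) ` prime_power_divisors z \<union> A \<times> {1}"
    proof (cases "p \<in> A")
      case True
      show ?thesis
      proof (cases "j = 1")
        case False
        then obtain i where i: "j = Suc i" "i \<ge> 1"
          using * by (cases j) auto
        have "(p, i) \<in> prime_power_divisors z"
          unfolding prime_power_divisors_def using * i True dvd_A by auto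
        then show ?thesis
          using i True pj by (auto intro!: image_eqI[of _ _ "(p, i)"])
      qed (use True pj in auto)
    next
      case False
      then have "(p, j) \<in> prime_power_divisors z"
        unfolding prime_power_divisors_def using * dvd_nA by auto
      then show ?thesis
        using False pj by (auto intro!: image_eqI[of _ _ "(p, j)"])
    qed
  next
    fix x assume "x \<in> (\<lambda>(p, j). (p, if p \<in> A then Suc j else j)) ` prime_power_divisors z \<union> A \<times> {1}"
    then consider p j where "(p, j) \<in> prime_power_divisors z" "x = (p, if p \<in> A then Suc j else j)"
      | p where "p \<in> A" "x = (p, Suc 0)"
      by auto
    then show "x \<in> prime_power_divisors (q * z)"
    proof cases
      case 1
      then show ?thesis
        unfolding prime_power_divisors_def using dvd_A dvd_nA by (auto simp del: power_Suc)
    next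
      case 2
      moreover have "gaussian_dvd (p ^ 0) z"
        using z by (auto simp: gaussian_dvd_def)
      ultimately show ?thesis
        unfolding prime_power_divisors_def using dvd_A[of p 0] A_prime by (auto simp del: power_Suc)
    qed
  qed
qed

lemma prime_power_divisors_unit:
  assumes "z \<in> gaussian_integers" "norm z = 1"
  shows "prime_power_divisors z = {}"
proof -
  have False if p: "gaussian_prime p" "j \<ge> 1" "gaussian_dvd (p ^ j) z" for p j
  proof -
    have "p \<in> gaussian_integers" "norm p > 1"
      using gaussian_prime_norm_gt_1 p unfolding gaussian_prime_def by auto
    moreover have "gaussian_dvd z 1"
      using gaussian_dvd_1_iff assms by blast
    then have "gaussian_dvd (p ^ j) 1"
      using p gaussian_dvd_trans by blast
    ultimately have "norm (p ^ j) = 1"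
      using gaussian_dvd_1_iff by blast
    then show False
      using \<open>norm p > 1\<close> p(2) one_less_power[of "norm p" j] by (simp add: norm_power)
  qed
  then show ?thesis
    unfolding prime_power_divisors_def by auto
qed

text \<open>Each prime ideal has four generators, hence the factor 4.\<close>

lemma sum_ln_prime_power_divisors:
  assumes "z \<in> gaussian_integers" "z \<noteq> 0"
  shows "finite (prime_power_divisors z) \<and>
    (\<Sum>(p, j)\<in>prime_power_divisors z. ln (norm p)) = 4 * ln (norm z)"
proof -
  obtain n where "(norm z)\<^sup>2 = of_nat n"
    using assms gaussian_norm_sq_nat by blast
  then show ?thesis
    using assms
  proof (induction n arbitrary: z rule: less_induct)
    case (less n)
    show ?case
    proof (cases "norm z = 1")
      case True
      then show ?thesis
        using prime_power_divisors_unit less.prems by simp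
    next
      case False
      then obtain q where q: "gaussian_prime q" "gaussian_dvd q z"
        using gaussian_prime_divisor_exists less.prems by blast
      then obtain y where y: "y \<in> gaussian_integers" "z = q * y"
        unfolding gaussian_dvd_def by blast
      have y0: "y \<noteq> 0" "q \<noteq> 0"
        using y less.prems by auto
      have q1: "norm q > 1"
        using q gaussian_prime_norm_gt_1 by blast
      obtain m where m: "(norm y)\<^sup>2 = of_nat m"
        using gaussian_norm_sq_nat y by blast
      have "norm y < norm z"
        using y q1 y0 by (simp add: norm_mult)
      then have "(norm y)\<^sup>2 < (norm z)\<^sup>2"
        by (simp add: power_strict_mono)
      then have "m < n"
        using less.prems m by simp
      then have IH: "finite (prime_power_divisors y)"
        "(\<Sum>(p, j)\<in>prime_power_divisors y. ln (norm p)) = 4 * ln (norm y)"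
        using less.IH[OF _ m] y y0 by auto
      define A where "A = {q, - q, \<i> * q, - \<i> * q}"
      define \<phi> :: "complex \<times> nat \<Rightarrow> complex \<times> nat"
        where "\<phi> = (\<lambda>(p, j). (p, if p \<in> A then Suc j else j))"
      have eq: "prime_power_divisors z = \<phi> ` prime_power_divisors y \<union> A \<times> {1}"
        unfolding y(2) \<phi>_def A_def by (rule prime_power_divisors_mult) (use q y in auto)
      have inj: "inj_on \<phi> (prime_power_divisors y)"
        unfolding \<phi>_def by (auto simp: inj_on_def split: if_splits)
      \<comment> \<open>On \<open>A\<close> the shifted exponents are at least 2, so they miss the
        new exponent 1.\<close>
      have disj: "\<phi> ` prime_power_divisors y \<inter> A \<times> {1} = {}"
        unfolding \<phi>_def prime_power_divisors_def by (auto split: if_splits)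
      have cardA: "card A = 4"
      proof -
        have "q \<noteq> - q" "q \<noteq> \<i> * q" "q \<noteq> - \<i> * q" "- q \<noteq> \<i> * q" "- q \<noteq> - \<i> * q" "\<i> * q \<noteq> - \<i> * q"
          using y0 by (auto simp: complex_eq_iff)
        then show ?thesis
          unfolding A_def by simp
      qed
      have finA: "finite A"
        unfolding A_def by simp
      have normA: "norm p = norm q" if "p \<in> A" for p
        using that unfolding A_def by (auto simp: norm_mult)
      have "(\<Sum>(p, j)\<in>prime_power_divisors z. ln (norm p)) =
          (\<Sum>(p, j)\<in>\<phi> ` prime_power_divisors y. ln (norm p)) + (\<Sum>(p, j)\<in>A \<times> {1::nat}. ln (norm p))"
        unfolding eq using IH(1) disj finA by (intro sum.union_disjoint) auto
      also have "(\<Sum>(p, j)\<in>\<phi> ` prime_power_divisors y. ln (norm p)) = 4 * ln (norm y)"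
        unfolding IH(2)[symmetric] sum.reindex[OF inj] by (intro sum.cong) (auto simp: \<phi>_def)
      also have "(\<Sum>(p, j)\<in>A \<times> {1::nat}. ln (norm p)) = (\<Sum>(p, j)\<in>A \<times> {1::nat}. ln (norm q))"
        using normA by (intro sum.cong) auto
      also have "\<dots> = 4 * ln (norm q)"
        using cardA by (simp add: card_cartesian_product)
      also have "4 * ln (norm y) + 4 * ln (norm q) = 4 * ln (norm z)"
        using y0 y(2) by (simp add: norm_mult ln_mult)
      finally show ?thesis
        using IH(1) finA eq by simp
    qed
  qed
qed

section \<open>Hecke characters and their $L$-series\<close>

text \<open>The remainder outside a finite set is dominated by the remainder of \<open>h\<close>,
  which does not depend on \<open>x\<close>.\<close>

lemma Weierstrass_m_test_infsum:
  fixes f :: "'i \<Rightarrow> 'a \<Rightarrow> 'b::banach" and h :: "'i \<Rightarrow> real"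
  assumes h: "h summable_on I" and le: "\<And>i x. i \<in> I \<Longrightarrow> x \<in> A \<Longrightarrow> norm (f i x) \<le> h i"
  shows "uniform_limit A (\<lambda>X x. \<Sum>i\<in>X. f i x) (\<lambda>x. \<Sum>\<^sub>\<infinity>i\<in>I. f i x) (finite_subsets_at_top I)"
proof (rule uniform_limitI)
  fix e :: real assume e: "e > 0"
  have "((\<lambda>X. sum h X) \<longlongrightarrow> infsum h I) (finite_subsets_at_top I)"
    using h by (rule infsum_tendsto)
  then have "\<forall>\<^sub>F X in finite_subsets_at_top I. dist (sum h X) (infsum h I) < e"
    using e tendstoD by blast
  moreover have "\<forall>\<^sub>F X in finite_subsets_at_top I. finite X \<and> X \<subseteq> I"
    by (rule eventually_finite_subsets_at_top_weakI) auto
  ultimately show "\<forall>\<^sub>F X in finite_subsets_at_top I. \<forall>x\<in>A. dist (\<Sum>i\<in>X. f i x) (\<Sum>\<^sub>\<infinity>i\<in>I. f i x) < e"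
  proof eventually_elim
    case (elim X)
    show ?case
    proof
      fix x assume x: "x \<in> A"
      have fs: "(\<lambda>i. norm (f i x)) summable_on I"
        by (rule Infinite_Sum.abs_summable_on_comparison_test'[OF h]) (use le x in auto)
      have fs': "(\<lambda>i. f i x) summable_on I - X" and fsn: "(\<lambda>i. norm (f i x)) summable_on I - X"
        and hs: "h summable_on I - X"
        using summable_on_subset_banach[OF Infinite_Sum.abs_summable_summable[OF fs], of "I - X"]
          summable_on_subset_banach[OF fs, of "I - X"] summable_on_subset_banach[OF h, of "I - X"] by auto
      have hsplit: "infsum h I = sum h X + infsum h (I - X)"
        using infsum_Un_disjoint[of h X "I - X"] hs elim by (simp add: Un_absorb1)
      have "(\<Sum>\<^sub>\<infinity>i\<in>I. f i x) = (\<Sum>i\<in>X. f i x) + (\<Sum>\<^sub>\<infinity>i\<in>I - X. f i x)"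
        using infsum_Un_disjoint[of "\<lambda>i. f i x" X "I - X"] fs' elim by (simp add: Un_absorb1)
      then have "dist (\<Sum>i\<in>X. f i x) (\<Sum>\<^sub>\<infinity>i\<in>I. f i x) = norm (\<Sum>\<^sub>\<infinity>i\<in>I - X. f i x)"
        by (simp add: dist_norm norm_minus_commute)
      also have "\<dots> \<le> (\<Sum>\<^sub>\<infinity>i\<in>I - X. norm (f i x))"
        by (rule norm_infsum_bound) (rule fsn)
      also have "\<dots> \<le> infsum h (I - X)"
        using fsn hs le x by (intro infsum_mono) auto
      also have "\<dots> < e"
        using elim hsplit by (simp add: dist_real_def)
      finally show "dist (\<Sum>i\<in>X. f i x) (\<Sum>\<^sub>\<infinity>i\<in>I. f i x) < e" .
    qed
  qed
qed

text \<open>Uniform limits of holomorphic functions are differentiated termwise, so a majorant of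
  the terms alone already yields convergence of the differentiated sum.\<close>

lemma has_field_derivative_infsum:
  fixes f :: "'i \<Rightarrow> complex \<Rightarrow> complex" and h :: "'i \<Rightarrow> real"
  assumes S: "open S" "z \<in> S" and h: "h summable_on I"
    and le: "\<And>i x. i \<in> I \<Longrightarrow> x \<in> S \<Longrightarrow> norm (f i x) \<le> h i"
    and der: "\<And>i x. i \<in> I \<Longrightarrow> x \<in> S \<Longrightarrow> (f i has_field_derivative f' i x) (at x)"
  obtains g' where "((\<lambda>x. \<Sum>\<^sub>\<infinity>i\<in>I. f i x) has_field_derivative g') (at z)"
    "((\<lambda>i. f' i z) has_sum g') I"
proof -
  obtain r where r: "r > 0" "cball z r \<subseteq> S"
    using S open_contains_cball by blast
  have ev: "\<forall>\<^sub>F X in finite_subsets_at_top I. finite X \<and> X \<subseteq> I"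
    by (rule eventually_finite_subsets_at_top_weakI) auto
  have "\<forall>\<^sub>F X in finite_subsets_at_top I. continuous_on (cball z r) (\<lambda>x. \<Sum>i\<in>X. f i x) \<and>
      (\<forall>w\<in>ball z r. ((\<lambda>x. \<Sum>i\<in>X. f i x) has_field_derivative (\<Sum>i\<in>X. f' i w)) (at w))"
    using ev
  proof eventually_elim
    case (elim X)
    have *: "((\<lambda>x. \<Sum>i\<in>X. f i x) has_field_derivative (\<Sum>i\<in>X. f' i w)) (at w)" if "w \<in> cball z r" for w
      using elim that r by (intro DERIV_sum der) auto
    then show ?case
      by (auto intro!: DERIV_continuous_on[where D = "\<lambda>w. \<Sum>i\<in>X. f' i w"] DERIV_subset[OF *])
  qed
  moreover have "uniform_limit (cball z r) (\<lambda>X x. \<Sum>i\<in>X. f i x) (\<lambda>x. \<Sum>\<^sub>\<infinity>i\<in>I. f i x) (finite_subsets_at_top I)"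
    by (rule Weierstrass_m_test_infsum[OF h]) (use r le in auto)
  ultimately obtain g' where g': "\<And>w. w \<in> ball z r \<Longrightarrow>
      ((\<lambda>x. \<Sum>\<^sub>\<infinity>i\<in>I. f i x) has_field_derivative (g' w)) (at w) \<and>
      ((\<lambda>X. \<Sum>i\<in>X. f' i w) \<longlongrightarrow> g' w) (finite_subsets_at_top I)"
    using r(1) by (elim has_complex_derivative_uniform_limit) auto
  show ?thesis
    using that[of "g' z"] g'[of z] r(1) unfolding has_sum_def by simp
qed

abbreviation gaussian_nz :: "complex set" where
  "gaussian_nz \<equiv> gaussian_integers - {0}"

section \<open>Absolute convergence of lattice sums\<close>

lemma summable_on_int_powr:
  assumes "p > 1"
  shows "(\<lambda>n::int. (1 + \<bar>real_of_int n\<bar>) powr - p) summable_on UNIV"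
proof -
  have "summable (\<lambda>n. real n powr - p)"
    using assms by (simp add: summable_real_powr_iff)
  then have "summable (\<lambda>n. real (Suc n) powr - p)"
    by (subst summable_Suc_iff)
  then have s: "(\<lambda>n. (1 + real n) powr - p) summable_on UNIV"
    by (intro summable_nonneg_imp_summable_on) (auto simp: add.commute)
  have eq: "(UNIV :: int set) = range int \<union> range (\<lambda>n. - int n)"
    by (metis (no_types, lifting) UNIV_eq_I UnCI int_cases2 rangeI)
  show ?thesis
    unfolding eq
  proof (rule summable_on_union)
    show "(\<lambda>n::int. (1 + \<bar>real_of_int n\<bar>) powr - p) summable_on range int"
      using s by (subst summable_on_reindex) (auto simp: o_def)
    show "(\<lambda>n::int. (1 + \<bar>real_of_int n\<bar>) powr - p) summable_on range (\<lambda>n. - int n)"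
      using s by (subst summable_on_reindex) (auto simp: o_def inj_on_def)
  qed
qed

text \<open>For nonzero z = a + bi one has (1 + |a|)(1 + |b|) \<le> 4 |z|^2. Raising this to the
  power -p with p = 1 + d/2 bounds the term by a product of two convergent one-dimensional
  series.\<close>

lemma summable_on_gaussian_powr:
  assumes "d > 0"
  shows "(\<lambda>z. norm z powr - (2 + d)) summable_on gaussian_nz"
proof -
  define p where "p = 1 + d / 2"
  define g where "g = (\<lambda>n::int. (1 + \<bar>real_of_int n\<bar>) powr - p)"
  have p: "p > 1"
    using assms p_def by simp
  have g: "g summable_on UNIV"
    unfolding g_def by (rule summable_on_int_powr[OF p])
  have "(\<lambda>(a, b). g a * g b) summable_on UNIV \<times> UNIV"
  proof (rule summable_on_SigmaI)
    show "((\<lambda>b. (\<lambda>(a, b). g a * g b) (a, b)) has_sum g a * infsum g UNIV) UNIV" for a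
      using g by (auto intro!: has_sum_cmult_right)
    show "(\<lambda>a. g a * infsum g UNIV) summable_on UNIV"
      using g by (rule summable_on_cmult_left)
    show "0 \<le> (\<lambda>(a, b). g a * g b) (a, b)" for a b
      by (simp add: g_def)
  qed
  then have "(\<lambda>ab. 4 powr p * (\<lambda>(a, b). g a * g b) ab) summable_on UNIV"
    by (intro summable_on_cmult_right) simp
  also have "?this \<longleftrightarrow> (\<lambda>z. 4 powr p * (g \<lfloor>Re z\<rfloor> * g \<lfloor>Im z\<rfloor>)) summable_on gaussian_integers"
    by (rule summable_on_reindex_bij_witness[of _ "\<lambda>z. (\<lfloor>Re z\<rfloor>, \<lfloor>Im z\<rfloor>)" "\<lambda>(a, b). Complex (of_int a) (of_int b)"])
      (auto simp: gaussian_integers_iff complex_eq_iff elim!: Ints_cases)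
  finally have "(\<lambda>z. 4 powr p * (g \<lfloor>Re z\<rfloor> * g \<lfloor>Im z\<rfloor>)) summable_on gaussian_nz"
    by (rule summable_on_subset_banach) auto
  then show ?thesis
  proof (rule summable_on_comparison_test)
    fix z assume z: "z \<in> gaussian_nz"
    then have n1: "norm z \<ge> 1"
      using gaussian_norm_ge_1 by auto
    have fl: "real_of_int \<lfloor>Re z\<rfloor> = Re z" "real_of_int \<lfloor>Im z\<rfloor> = Im z"
      using z by (auto simp: gaussian_integers_iff elim!: Ints_cases)
    have "1 + \<bar>Re z\<bar> \<le> 2 * norm z" "1 + \<bar>Im z\<bar> \<le> 2 * norm z"
      using n1 abs_Re_le_cmod[of z] abs_Im_le_cmod[of z] by linarith+
    then have "(1 + \<bar>Re z\<bar>) * (1 + \<bar>Im z\<bar>) \<le> (2 * norm z) * (2 * norm z)"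
      by (intro mult_mono) auto
    also have "\<dots> = 4 * (norm z)\<^sup>2"
      by (simp add: power2_eq_square)
    finally have le: "(1 + \<bar>Re z\<bar>) * (1 + \<bar>Im z\<bar>) \<le> 4 * (norm z)\<^sup>2" .
    have "((norm z)\<^sup>2) powr - p = (norm z powr 2) powr - p"
      by (simp add: powr_numeral)
    also have "\<dots> = norm z powr - (2 + d)"
      unfolding powr_powr by (rule arg_cong[where f = "\<lambda>x. norm z powr x"]) (simp add: p_def)
    finally have "norm z powr - (2 + d) = ((norm z)\<^sup>2) powr - p" ..
    also have "\<dots> = 4 powr p * (4 * (norm z)\<^sup>2) powr - p"
      by (simp add: powr_mult powr_minus field_simps)
    also have "\<dots> \<le> 4 powr p * ((1 + \<bar>Re z\<bar>) * (1 + \<bar>Im z\<bar>)) powr - p"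
      using le p by (intro mult_left_mono powr_mono2') (auto intro!: mult_pos_pos)
    also have "\<dots> = 4 powr p * (g \<lfloor>Re z\<rfloor> * g \<lfloor>Im z\<rfloor>)"
      by (simp add: g_def fl powr_mult)
    finally show "norm z powr - (2 + d) \<le> 4 powr p * (g \<lfloor>Re z\<rfloor> * g \<lfloor>Im z\<rfloor>)" .
  qed auto
qed

text \<open>The character $(z/|z|)^k |z|^{-2-w}$. The edge of convergence of its sum over \<^term>\<open>gaussian_nz\<close> is
  $\mathrm{Re}\, w = 0$; in the usual normalisation $N(z)^{-s}$ one has $s = 1 + w/2$.\<close>

definition hecke :: "int \<Rightarrow> complex \<Rightarrow> complex \<Rightarrow> complex" where
  "hecke k w z = sgn z powi k * exp (- (2 + w) * of_real (ln (norm z)))"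

lemma norm_hecke: "z \<noteq> 0 \<Longrightarrow> norm (hecke k w z) = norm z powr - (2 + Re w)"
  by (simp add: hecke_def norm_mult norm_power_int norm_sgn powr_def)

lemma hecke_mult: "x \<noteq> 0 \<Longrightarrow> y \<noteq> 0 \<Longrightarrow> hecke k w (x * y) = hecke k w x * hecke k w y"
  by (simp add: hecke_def sgn_mult power_int_mult_distrib norm_mult ln_mult ring_distribs exp_add exp_diff exp_minus field_simps)

lemma hecke_1 [simp]: "hecke k w 1 = 1"
  by (simp add: hecke_def)

lemma hecke_power: "z \<noteq> 0 \<Longrightarrow> hecke k w (z ^ n) = hecke k w z ^ n"
  by (induction n) (simp_all add: hecke_mult)

lemma hecke_has_field_derivative:
  "((\<lambda>w. hecke k w z) has_field_derivative (- ln (norm z) * hecke k w z)) (at w within A)"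
  unfolding hecke_def by (auto intro!: derivative_eq_intros)

text \<open>Summation runs over elements, not ideals. For Re w > 0 and 4 dividing k this is four
  times the Hecke L-function at 1 + w/2; for other k the four associates cancel and the sum is
  0.\<close>

definition hecke_L :: "int \<Rightarrow> complex \<Rightarrow> complex" where
  "hecke_L k w = (\<Sum>\<^sub>\<infinity>z\<in>gaussian_nz. hecke k w z)"

lemma hecke_abs_summable:
  assumes "Re w > 0"
  shows "(\<lambda>z. norm (hecke k w z)) summable_on gaussian_nz"
  using summable_on_gaussian_powr[OF assms] by (rule summable_on_cong[THEN iffD1, rotated]) (auto simp: norm_hecke)

lemma hecke_summable: "Re w > 0 \<Longrightarrow> hecke k w summable_on gaussian_nz"
  using Infinite_Sum.abs_summable_summable[OF hecke_abs_summable] .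

text \<open>The half-plane Re x > Re w / 2 is a neighbourhood of \<open>w\<close> on which one
  convergent majorant serves all terms.\<close>

lemma hecke_L_has_field_derivative_sum:
  assumes "Re w > 0"
  obtains L' where "(hecke_L k has_field_derivative L') (at w)"
    "((\<lambda>z. - ln (norm z) * hecke k w z) has_sum L') gaussian_nz"
proof (rule has_field_derivative_infsum[of "{x. Re x > Re w / 2}" w "\<lambda>z. norm z powr - (2 + Re w / 2)"
      gaussian_nz "\<lambda>z x. hecke k x z" "\<lambda>z x. - ln (norm z) * hecke k x z"])
  show "open {x. Re x > Re w / 2}"
    by (rule open_halfspace_Re_gt)
  show "w \<in> {x. Re x > Re w / 2}"
    using assms by simp
  show "(\<lambda>z. norm z powr - (2 + Re w / 2)) summable_on gaussian_nz"
    by (rule summable_on_gaussian_powr) (use assms in simp)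
  show "norm (hecke k x z) \<le> norm z powr - (2 + Re w / 2)"
    if "z \<in> gaussian_nz" "x \<in> {x. Re x > Re w / 2}" for z x
    using that gaussian_norm_ge_1[of z] by (auto simp: norm_hecke intro!: powr_mono)
  show "((\<lambda>x. hecke k x z) has_field_derivative - ln (norm z) * hecke k x z) (at x)" for z x
    by (rule hecke_has_field_derivative)
qed (use that in \<open>auto simp flip: hecke_L_def\<close>)

section \<open>The logarithmic derivative\<close>

abbreviation gaussian_prime_powers :: "(complex \<times> nat) set" where
  "gaussian_prime_powers \<equiv> {p. gaussian_prime p} \<times> {1..}"

text \<open>The von Mangoldt series over elements: for Re w > 0 it equals -4 times the logarithmic
  derivative of \<open>hecke_L k\<close> wherever \<open>hecke_L k\<close> is nonzero.\<close>

definition hecke_Lambda :: "int \<Rightarrow> complex \<Rightarrow> complex" where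
  "hecke_Lambda k w = (\<Sum>\<^sub>\<infinity>(p, j)\<in>gaussian_prime_powers. ln (norm p) * hecke k w p ^ j)"

text \<open>This is $4 \ln |z| = \sum_{p^j \mid z} \ln |p|$ summed against the character, with $z = p^j y$.\<close>

lemma
  assumes w: "Re w > 0"
  shows hecke_L_has_field_derivative: "(hecke_L k has_field_derivative - (hecke_Lambda k w * hecke_L k w / 4)) (at w)"
    and hecke_Lambda_summable: "(\<lambda>(p, j). ln (norm p) * hecke k w p ^ j) summable_on gaussian_prime_powers"
proof -
  obtain L' where L': "(hecke_L k has_field_derivative L') (at w)"
    "((\<lambda>z. - ln (norm z) * hecke k w z) has_sum L') gaussian_nz"
    using hecke_L_has_field_derivative_sum[OF w] .
  define f :: "complex \<times> complex \<times> nat \<Rightarrow> complex"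
    where "f = (\<lambda>(z, p, j). ln (norm p) * hecke k w z)"
  \<comment> \<open>One double sum with two indexings: \<open>T\<close> consists of a number with a
    prime power dividing it, \<open>U\<close> of a prime power with its cofactor;
    \<open>\<phi>\<close> below matches them.\<close>
  define T where "T = Sigma gaussian_nz prime_power_divisors"
  define U where "U = gaussian_prime_powers \<times> gaussian_nz"
  have fin: "finite (prime_power_divisors z)" if "z \<in> gaussian_nz" for z
    using sum_ln_prime_power_divisors that by auto
  have ln_sum: "(\<Sum>(p, j)\<in>prime_power_divisors z. ln (norm p)) = 4 * ln (norm z)" if "z \<in> gaussian_nz" for z
    using sum_ln_prime_power_divisors that by auto
  have inner: "(\<Sum>\<^sub>\<infinity>pj\<in>prime_power_divisors z. f (z, pj)) = 4 * (ln (norm z) * hecke k w z)"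
    if "z \<in> gaussian_nz" for z
  proof -
    have "(\<Sum>\<^sub>\<infinity>pj\<in>prime_power_divisors z. f (z, pj)) = (\<Sum>pj\<in>prime_power_divisors z. f (z, pj))"
      using fin[OF that] by simp
    also have "\<dots> = of_real (\<Sum>(p, j)\<in>prime_power_divisors z. ln (norm p)) * hecke k w z"
      by (simp add: f_def sum_distrib_right of_real_sum case_prod_unfold)
    finally show ?thesis
      using ln_sum[OF that] by simp
  qed
  have inner_norm: "(\<Sum>\<^sub>\<infinity>pj\<in>prime_power_divisors z. norm (f (z, pj))) = 4 * norm (- ln (norm z) * hecke k w z)"
    if "z \<in> gaussian_nz" for z
  proof -
    have "(\<Sum>\<^sub>\<infinity>pj\<in>prime_power_divisors z. norm (f (z, pj))) = (\<Sum>pj\<in>prime_power_divisors z. norm (f (z, pj)))"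
      using fin[OF that] by simp
    also have "\<dots> = (\<Sum>(p, j)\<in>prime_power_divisors z. ln (norm p)) * norm (hecke k w z)"
      unfolding sum_distrib_right
    proof (rule sum.cong)
      fix x assume "x \<in> prime_power_divisors z"
      then have "norm (fst x) > 1"
        using gaussian_prime_norm_gt_1 by (auto simp: prime_power_divisors_def)
      then show "norm (f (z, x)) = (case x of (p, j) \<Rightarrow> ln (norm p)) * norm (hecke k w z)"
        by (auto simp: f_def norm_mult case_prod_unfold)
    qed simp
    finally show ?thesis
      using ln_sum[OF that] that gaussian_norm_ge_1[of z] by (simp add: norm_mult)
  qed
  \<comment> \<open>Rearranging needs absolute convergence. The inner sums are finite, and the outer
    one is four times the differentiated L-series, which converges absolutely.\<close>
  have "(\<lambda>x. norm (f x)) summable_on T"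
    unfolding T_def Infinite_Sum.abs_summable_on_Sigma_iff
  proof (intro conjI ballI)
    show "(\<lambda>y. norm (f (z, y))) summable_on prime_power_divisors z" if "z \<in> gaussian_nz" for z
      using fin[OF that] by simp
    have "(\<lambda>z. norm (- ln (norm z) * hecke k w z)) summable_on gaussian_nz"
      using has_sum_imp_summable[OF L'(2)] by (simp only: Infinite_Sum.summable_on_iff_abs_summable_on_complex)
    then have "(\<lambda>z. 4 * norm (- ln (norm z) * hecke k w z)) summable_on gaussian_nz"
      by (rule summable_on_cmult_right)
    then show "(\<lambda>z. norm (\<Sum>\<^sub>\<infinity>pj\<in>prime_power_divisors z. norm (f (z, pj)))) summable_on gaussian_nz"
      by (rule summable_on_cong[THEN iffD1, rotated]) (simp add: inner_norm)
  qed
  then have fT: "f summable_on T"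
    by (rule Infinite_Sum.abs_summable_summable)
  define \<phi> :: "(complex \<times> nat) \<times> complex \<Rightarrow> complex \<times> complex \<times> nat"
    where "\<phi> = (\<lambda>((p, j), y). (p ^ j * y, p, j))"
  have pnz: "p \<noteq> 0" "p \<in> gaussian_integers" if "gaussian_prime p" for p
    using that by (auto simp: gaussian_prime_def)
  have \<phi>: "bij_betw \<phi> U T"
  proof (rule bij_betwI')
    fix x y assume "x \<in> U" "y \<in> U"
    then show "(\<phi> x = \<phi> y) = (x = y)"
      using pnz by (auto simp: \<phi>_def U_def)
  next
    fix x assume "x \<in> U"
    then show "\<phi> x \<in> T"
      using pnz by (auto simp: \<phi>_def U_def T_def prime_power_divisors_def)
  next
    fix x assume x: "x \<in> T"
    obtain z p j where zpj: "x = (z, p, j)"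
      by (cases x) auto
    then obtain y where y: "y \<in> gaussian_integers" "z = p ^ j * y"
      using x by (auto simp: T_def prime_power_divisors_def gaussian_dvd_def)
    show "\<exists>u\<in>U. x = \<phi> u"
      by (rule bexI[of _ "((p, j), y)"]) (use x y zpj in \<open>auto simp: \<phi>_def U_def T_def prime_power_divisors_def\<close>)
  qed
  define g :: "(complex \<times> nat) \<times> complex \<Rightarrow> complex"
    where "g = (\<lambda>((p, j), y). ln (norm p) * hecke k w p ^ j * hecke k w y)"
  have fg: "f (\<phi> u) = g u" if "u \<in> U" for u
  proof -
    obtain p j y where u: "u = ((p, j), y)"
      by (metis surj_pair)
    then have "gaussian_prime p" "y \<noteq> 0" "p \<noteq> 0"
      using that pnz by (auto simp: U_def)
    then show ?thesis
      using u by (simp add: f_def \<phi>_def g_def hecke_mult hecke_power)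
  qed
  have "(\<lambda>u. f (\<phi> u)) summable_on U"
    using summable_on_reindex_bij_betw[OF \<phi>, of f] fT by simp
  then have gU: "g summable_on U"
    using fg summable_on_cong by metis
  \<comment> \<open>Convergence of the von Mangoldt series is read off from the slice of
    \<open>U\<close> with cofactor 1.\<close>
  have "(\<lambda>pj. g (pj, 1)) summable_on gaussian_prime_powers"
  proof -
    have "g summable_on (\<lambda>pj. (pj, 1)) ` gaussian_prime_powers"
      using gU by (rule summable_on_subset_banach) (auto simp: U_def)
    then show ?thesis
      by (subst (asm) summable_on_reindex) (auto simp: inj_on_def o_def)
  qed
  then show "(\<lambda>(p, j). ln (norm p) * hecke k w p ^ j) summable_on gaussian_prime_powers"
    by (simp add: g_def case_prod_unfold)
  have "infsum f T = (\<Sum>\<^sub>\<infinity>z\<in>gaussian_nz. \<Sum>\<^sub>\<infinity>pj\<in>prime_power_divisors z. f (z, pj))"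
    using infsum_Sigma_banach[of f gaussian_nz prime_power_divisors] fT by (simp add: T_def)
  also have "\<dots> = (\<Sum>\<^sub>\<infinity>z\<in>gaussian_nz. (- 4) * (- ln (norm z) * hecke k w z))"
    by (rule infsum_cong) (simp add: inner)
  also have "\<dots> = (- 4) * L'"
    using has_sum_cmult_right[OF L'(2), of "- 4"] by (rule infsumI)
  finally have 1: "infsum f T = - 4 * L'" .
  have "infsum f T = infsum g U"
    using infsum_reindex_bij_betw[OF \<phi>, of f] fg infsum_cong by metis
  also have "\<dots> = (\<Sum>\<^sub>\<infinity>pj\<in>gaussian_prime_powers. \<Sum>\<^sub>\<infinity>y\<in>gaussian_nz. g (pj, y))"
    using infsum_Sigma_banach[of g gaussian_prime_powers "\<lambda>_. gaussian_nz"] gU by (simp add: U_def)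
  also have "\<dots> = (\<Sum>\<^sub>\<infinity>pj\<in>gaussian_prime_powers. (\<lambda>(p, j). ln (norm p) * hecke k w p ^ j) pj * hecke_L k w)"
    by (rule infsum_cong) (auto simp: g_def hecke_L_def infsum_cmult_right')
  also have "\<dots> = hecke_Lambda k w * hecke_L k w"
    unfolding hecke_Lambda_def by (rule infsum_cmult_left')
  finally have 2: "- 4 * L' = hecke_Lambda k w * hecke_L k w"
    using 1 by simp
  have "L' = - (- 4 * L' / 4)"
    by simp
  also have "\<dots> = - (hecke_Lambda k w * hecke_L k w / 4)"
    by (simp only: 2)
  finally have "L' = - (hecke_Lambda k w * hecke_L k w / 4)" .
  then show "(hecke_L k has_field_derivative - (hecke_Lambda k w * hecke_L k w / 4)) (at w)"
    using L'(1) by simp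
qed

section \<open>Continuation past the line $\mathrm{Re}\, w = 0$\<close>

lemma norm_exp_minus_1_le:
  fixes q :: complex
  shows "norm (exp q - 1) \<le> norm q * exp (norm q)"
proof -
  have "norm (exp q - exp 0) \<le> exp (norm q) * norm (q - 0)"
  proof (rule field_differentiable_bound[of "cball 0 (norm q)" exp exp])
    show "norm (exp x) \<le> exp (norm q)" if "x \<in> cball 0 (norm q)" for x :: complex
      using order_trans[OF norm_exp[of x], of "exp (norm q)"] that by simp
  qed (auto intro: DERIV_exp DERIV_subset)
  then show ?thesis
    by (simp add: mult.commute)
qed

text \<open>Inversion is an isometry of the unit circle, so negative exponents reduce to positive
  ones.\<close>

lemma norm_powi_diff_le:
  fixes x y :: complex
  assumes "norm x = 1" "norm y = 1"
  shows "norm (x powi k - y powi k) \<le> real_of_int \<bar>k\<bar> * norm (x - y)"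
proof -
  have xy: "x \<noteq> 0" "y \<noteq> 0"
    using assms by auto
  have *: "norm (inverse x - inverse y) = norm (x - y)"
    using xy assms by (simp add: inverse_diff_inverse norm_mult norm_inverse)
  show ?thesis
  proof (cases "k \<ge> 0")
    case True
    then show ?thesis
      using norm_power_diff[of x y "nat k"] assms by (simp add: power_int_def)
  next
    case False
    then show ?thesis
      using norm_power_diff[of "inverse x" "inverse y" "nat (- k)"] assms * by (simp add: power_int_def norm_inverse)
  qed
qed

lemma norm_sgn_diff_le:
  fixes x z :: complex
  assumes "x \<noteq> 0" "z \<noteq> 0"
  shows "norm (sgn x - sgn z) \<le> 2 * norm (x - z) / norm z"
proof -
  have "sgn x - sgn z = (x - z) / norm z + sgn x * ((norm z - norm x) / norm z)"
    using assms by (simp add: sgn_eq field_simps)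
  also have "norm \<dots> \<le> norm ((x - z) / norm z) + norm (sgn x * ((norm z - norm x) / norm z))"
    by (rule norm_triangle_ineq)
  also have "norm ((x - z) / norm z) = norm (x - z) / norm z"
    by (simp add: norm_divide)
  also have "norm (sgn x * ((norm z - norm x) / norm z)) = \<bar>norm z - norm x\<bar> / norm z"
    using assms by (simp add: norm_mult norm_divide norm_sgn flip: of_real_diff)
  also have "\<bar>norm z - norm x\<bar> / norm z \<le> norm (x - z) / norm z"
    using norm_triangle_ineq3[of z x] by (intro divide_right_mono) (auto simp: norm_minus_commute)
  finally show ?thesis
    by simp
qed

text \<open>Both directions use ln (1 + u) \<le> u. One of them produces M / |x| instead of M / |z|;
  the factor 1 + M comes from |z| \<le> (1 + M) |x|.\<close>

lemma abs_ln_norm_diff_le: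
  fixes x z :: complex
  assumes "norm x \<ge> 1" "norm z \<ge> 1" "norm (x - z) \<le> M"
  shows "\<bar>ln (norm x) - ln (norm z)\<bar> \<le> M * (1 + M) / norm z"
proof -
  have M: "M \<ge> 0"
    using assms(3) norm_ge_zero order_trans by blast
  have pos: "0 < norm x" "0 < norm z"
    using assms by linarith+
  have zx: "norm z \<le> norm x + M" and xz: "norm x \<le> norm z + M"
    using assms(3) norm_triangle_ineq2[of z x] norm_triangle_ineq2[of x z] by (simp_all add: norm_minus_commute)
  have "norm z \<le> (1 + M) * norm x"
    using zx assms(1) M mult_left_mono[of 1 "norm x" M] by (simp add: ring_distribs)
  then have "M * norm z \<le> M * ((1 + M) * norm x)"
    using M by (intro mult_left_mono)
  then have *: "M / norm x \<le> M * (1 + M) / norm z"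
    using pos by (simp add: divide_le_eq le_divide_eq mult_ac)
  have "ln (norm x) - ln (norm z) = ln (norm x / norm z)"
    using pos by (simp add: ln_divide_pos)
  also have "norm x / norm z = 1 + (norm x - norm z) / norm z"
    using pos by (simp add: field_simps)
  also have "ln (1 + (norm x - norm z) / norm z) \<le> (norm x - norm z) / norm z"
    using pos by (intro ln_add_one_self_le_self2) (simp add: field_simps)
  also have "\<dots> \<le> M / norm z"
    using xz assms by (intro divide_right_mono) auto
  also have "\<dots> \<le> M * (1 + M) / norm z"
    using M by (intro divide_right_mono) (auto simp: mult_le_cancel_left1)
  finally have 1: "ln (norm x) - ln (norm z) \<le> M * (1 + M) / norm z" .
  have "ln (norm z) - ln (norm x) = ln (norm z / norm x)"
    using pos by (simp add: ln_divide_pos)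
  also have "norm z / norm x = 1 + (norm z - norm x) / norm x"
    using pos by (simp add: field_simps)
  also have "ln (1 + (norm z - norm x) / norm x) \<le> (norm z - norm x) / norm x"
    using pos by (intro ln_add_one_self_le_self2) (simp add: field_simps)
  also have "\<dots> \<le> M / norm x"
    using zx assms by (intro divide_right_mono) auto
  finally show ?thesis
    using 1 * by linarith
qed

text \<open>Differencing over a bounded distance gains one power of |z|, which is exactly what moves
  the edge of convergence from Re w = 0 to Re w = -1. The bound \<open>W\<close> is separate from
  \<open>w\<close> so that the constant is uniform on a disc.\<close>

lemma hecke_diff_le:
  fixes M W :: real
  assumes x: "norm x \<ge> 1" and z: "norm z \<ge> 1" and M: "norm (x - z) \<le> M"
    and W: "norm (2 + w) \<le> W"
  defines "E \<equiv> W * (M * (1 + M))"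
  shows "norm (hecke k w x - hecke k w z) \<le> (E * exp E + 2 * real_of_int \<bar>k\<bar> * M) * norm z powr - (3 + Re w)"
proof -
  have xz0: "x \<noteq> 0" "z \<noteq> 0"
    using x z by auto
  have M0: "M \<ge> 0" and W0: "W \<ge> 0"
    using M W norm_ge_zero order_trans by blast+
  have E0: "E \<ge> 0"
    using M0 W0 by (simp add: E_def)
  define u where "u = (\<lambda>x::complex. sgn x powi k)"
  define v where "v = (\<lambda>x::complex. exp (- (2 + w) * of_real (ln (norm x))))"
  have nu: "norm (u x) = 1"
    using xz0 by (simp add: u_def norm_power_int norm_sgn)
  have nv: "norm (v z) = norm z powr - (2 + Re w)"
    using xz0 by (simp add: v_def powr_def)
  define q where "q = - (2 + w) * of_real (ln (norm x) - ln (norm z))"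
  have "norm q = norm (2 + w) * \<bar>ln (norm x) - ln (norm z)\<bar>"
    unfolding q_def norm_mult norm_minus_cancel norm_of_real ..
  also have "\<dots> \<le> W * (M * (1 + M) / norm z)"
    using abs_ln_norm_diff_le[OF x z M] W W0 by (intro mult_mono) auto
  finally have q1: "norm q \<le> E / norm z"
    by (simp add: E_def)
  also have "\<dots> \<le> E / 1"
    using E0 z by (intro divide_left_mono) auto
  finally have q2: "norm q \<le> E"
    by simp
  have "v x = v z * exp q"
    unfolding v_def q_def by (simp add: exp_add[symmetric] algebra_simps)
  then have "norm (v x - v z) = norm (v z) * norm (exp q - 1)"
    by (simp add: algebra_simps flip: norm_mult)
  also have "norm (exp q - 1) \<le> norm q * exp (norm q)"
    by (rule norm_exp_minus_1_le)
  also have "\<dots> \<le> E / norm z * exp E"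
    using q1 q2 E0 by (intro mult_mono) auto
  finally have v: "norm (v x - v z) \<le> norm (v z) * (E / norm z * exp E)"
    by (simp add: mult_left_mono)
  have "norm (u x - u z) \<le> real_of_int \<bar>k\<bar> * norm (sgn x - sgn z)"
    unfolding u_def using xz0 by (intro norm_powi_diff_le) (auto simp: norm_sgn)
  also have "\<dots> \<le> real_of_int \<bar>k\<bar> * (2 * M / norm z)"
  proof (rule mult_left_mono)
    have "norm (sgn x - sgn z) \<le> 2 * norm (x - z) / norm z"
      by (rule norm_sgn_diff_le[OF xz0])
    also have "\<dots> \<le> 2 * M / norm z"
      using M by (intro divide_right_mono) auto
    finally show "norm (sgn x - sgn z) \<le> 2 * M / norm z" .
  qed simp
  finally have u: "norm (u x - u z) \<le> real_of_int \<bar>k\<bar> * (2 * M / norm z)" .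
  have "hecke k w x - hecke k w z = u x * (v x - v z) + (u x - u z) * v z"
    by (simp add: hecke_def u_def v_def algebra_simps)
  also have "norm \<dots> \<le> norm (v x - v z) + norm (u x - u z) * norm (v z)"
    using norm_triangle_ineq[of "u x * (v x - v z)" "(u x - u z) * v z"] nu by (simp add: norm_mult)
  also have "\<dots> \<le> norm (v z) * (E / norm z * exp E) + real_of_int \<bar>k\<bar> * (2 * M / norm z) * norm (v z)"
    using u v by (intro add_mono mult_right_mono) auto
  also have "\<dots> = (E * exp E + 2 * real_of_int \<bar>k\<bar> * M) * (norm (v z) / norm z)"
    by (simp add: algebra_simps add_divide_distrib)
  also have "norm (v z) / norm z = norm z powr - (3 + Re w)"
  proof -
    have "norm z powr - (3 + Re w) = norm z powr (- (2 + Re w) - 1)"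
      by (rule arg_cong[where f = "\<lambda>x. norm z powr x"]) simp
    also have "\<dots> = norm z powr - (2 + Re w) / norm z"
      using z by (subst powr_diff) simp
    finally show ?thesis
      using nv by simp
  qed
  finally show ?thesis .
qed

section \<open>Residue classes modulo a + i\<close>

text \<open>Modulo a + i the unit i is congruent to -a, so every class contains a rational integer,
  determined modulo the norm a^2 + 1: a multiple of a + i that is real must be divisible by that
  norm.\<close>

lemma gaussian_division_bij:
  fixes a :: int
  defines "\<alpha> \<equiv> of_int a + \<i>"
  shows "bij_betw (\<lambda>(y, r). \<alpha> * y + of_int r) (gaussian_integers \<times> {0..<a\<^sup>2 + 1}) gaussian_integers"
proof (rule bij_betwI')
  have N: "0 < a\<^sup>2 + 1"
    by (simp add: add_nonneg_pos)
  have inj: "y = y' \<and> r = r'"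
    if y: "y \<in> gaussian_integers" "y' \<in> gaussian_integers" "r \<in> {0..<a\<^sup>2+1}" "r' \<in> {0..<a\<^sup>2+1}"
      "\<alpha> * y + of_int r = \<alpha> * y' + of_int r'" for y y' r r'
  proof -
    obtain p q where pq: "y - y' = Complex (of_int p) (of_int q)"
      using gaussian_diff[OF y(1,2)] unfolding gaussian_integers_def by blast
    have "\<alpha> * (y - y') = of_int (r' - r)"
      using y(5) by (simp add: algebra_simps)
    then have eq: "of_int (a * p - q) = (of_int (r' - r) :: real)" "of_int (a * q + p) = (of_int 0 :: real)"
      unfolding pq by (auto simp: complex_eq_iff \<alpha>_def)
    then have eq': "a * p - q = r' - r" "a * q + p = 0"
      by (simp_all only: of_int_eq_iff)
    have p: "p = - (a * q)"
      using eq'(2) by simp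
    have "r' - r = - ((a\<^sup>2 + 1) * q)"
      using eq'(1) unfolding p by (simp add: power2_eq_square algebra_simps)
    then have "(a\<^sup>2 + 1) dvd (r' - r)"
      by simp
    moreover have "\<bar>r' - r\<bar> < a\<^sup>2 + 1"
      using y(3,4) by auto
    ultimately have "r' - r = 0"
      using dvd_imp_le_int[of "r' - r" "a\<^sup>2 + 1"] N by linarith
    then have "r = r'" "(a\<^sup>2 + 1) * q = 0"
      using \<open>r' - r = - ((a\<^sup>2 + 1) * q)\<close> by linarith+
    then have "q = 0" "p = 0"
      using N p by auto
    then have "y - y' = 0"
      unfolding pq by (simp add: complex_eq_iff)
    then show ?thesis
      using \<open>r = r'\<close> by simp
  qed
  show "((\<lambda>(y, r). \<alpha> * y + of_int r) u = (\<lambda>(y, r). \<alpha> * y + of_int r) v) = (u = v)"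
    if "u \<in> gaussian_integers \<times> {0..<a\<^sup>2+1}" "v \<in> gaussian_integers \<times> {0..<a\<^sup>2+1}" for u v
    using that inj by (auto simp: case_prod_unfold intro: prod_eqI)
  have \<alpha>: "\<alpha> \<in> gaussian_integers"
    unfolding \<alpha>_def by auto
  show "(\<lambda>(y, r). \<alpha> * y + of_int r) u \<in> gaussian_integers" if "u \<in> gaussian_integers \<times> {0..<a\<^sup>2+1}" for u
    using that \<alpha> by auto
  show "\<exists>u\<in>gaussian_integers \<times> {0..<a\<^sup>2+1}. z = (\<lambda>(y, r). \<alpha> * y + of_int r) u" if zG: "z \<in> gaussian_integers" for z
  proof -
    obtain p q where z: "z = Complex (of_int p) (of_int q)"
      using zG unfolding gaussian_integers_def by blast
    define r where "r = (p - a * q) mod (a\<^sup>2 + 1)"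
    define t where "t = (p - a * q) div (a\<^sup>2 + 1)"
    have r: "r \<in> {0..<a\<^sup>2+1}"
      unfolding r_def atLeastLessThan_iff using N by (intro conjI pos_mod_sign pos_mod_bound)
    have "p - a * q = (a\<^sup>2 + 1) * t + r"
      unfolding r_def t_def by simp
    then have p: "p = (a\<^sup>2 + 1) * t + r + a * q"
      by simp
    \<comment> \<open>From z = (p - a q) + q (a + i) and a^2 + 1 = (a + i)(a - i), the quotient is
      (a - i) t + q.\<close>
    define y where "y = Complex (of_int (a * t + q)) (of_int (- t))"
    have "z = \<alpha> * y + of_int r"
      unfolding z y_def \<alpha>_def p by (simp add: complex_eq_iff power2_eq_square algebra_simps)
    moreover have "y \<in> gaussian_integers"
      unfolding y_def gaussian_integers_def by blast
    ultimately show ?thesis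
      using r by (intro bexI[of _ "(y, r)"]) auto
  qed
qed

text \<open>Comparing the sum over all Gaussian integers with the sum over the multiples of
  $\alpha = a + i$ cancels the main term, leaving a series of differences that converges
  for $\mathrm{Re}\, w > -1$. This replaces comparison with an integral.\<close>

lemma hecke_L_twisted_continuation:
  fixes a :: int
  defines "\<alpha> \<equiv> of_int a + \<i>"
  obtains A where "A holomorphic_on {w. Re w > -1}"
    "\<And>w. Re w > 0 \<Longrightarrow> hecke_L k w * (1 - of_int (a\<^sup>2 + 1) * hecke k w \<alpha>) = A w"
proof -
  define R where "R = {0..<a\<^sup>2 + 1}"
  have finR: "finite R" and cardR: "int (card R) = a\<^sup>2 + 1"
    unfolding R_def by auto
  have cardR': "real (card R) = of_int (a\<^sup>2 + 1)" "(of_nat (card R) :: complex) = of_int (a\<^sup>2 + 1)"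
    unfolding cardR[symmetric] by simp_all
  have \<alpha>G: "\<alpha> \<in> gaussian_integers"
    unfolding \<alpha>_def by auto
  have \<alpha>0: "\<alpha> \<noteq> 0"
    unfolding \<alpha>_def by (auto simp: complex_eq_iff)
  have \<alpha>1: "norm \<alpha> \<ge> 1"
    using gaussian_norm_ge_1 \<alpha>G \<alpha>0 by blast
  \<comment> \<open>For k = 0 the formula for \<open>hecke\<close> is nonzero at 0. Forcing the
    value 0 lets all of the Gaussian integers be indexed by one bijection.\<close>
  define F where "F = (\<lambda>w z. if z = 0 then 0 else hecke k w z)"
  define G where "G = (\<lambda>y w. \<Sum>r\<in>R. F w (\<alpha> * y + of_int r) - F w (\<alpha> * y))"
  define G' where "G' = (\<lambda>y w. \<Sum>r\<in>R. - ln (norm (\<alpha> * y + of_int r)) * F w (\<alpha> * y + of_int r)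
    - (- ln (norm (\<alpha> * y)) * F w (\<alpha> * y)))"
  define A where "A = (\<lambda>w. \<Sum>\<^sub>\<infinity>y\<in>gaussian_integers. G y w)"
  have Fder: "((\<lambda>w. F w z) has_field_derivative (- ln (norm z) * F w z)) (at w)" for z w
    using hecke_has_field_derivative[of k z w UNIV] by (auto simp: F_def)
  have Gder: "(G y has_field_derivative G' y w) (at w)" for y w
    unfolding G_def G'_def by (intro DERIV_sum DERIV_diff Fder)
  have "A holomorphic_on {w. Re w > -1}"
  proof -
    have "\<exists>g. (A has_field_derivative g) (at w)" if "Re w > -1" for w
    proof -
      \<comment> \<open>Half the distance from \<open>w\<close> to the line Re = -1: on
        \<open>S\<close> the exponent 3 + Re x exceeds 2 + d, which in turn exceeds 2.\<close>
      define d where "d = (1 + Re w) / 2"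
      have d: "d > 0"
        using that d_def by simp
      define S where "S = {x. Re x > d - 1} \<inter> ball w 1"
      define W where "W = norm w + 3"
      define M where "M = (a\<^sup>2 + 1 :: real)"
      define E where "E = W * (M * (1 + M))"
      define C where "C = of_int (a\<^sup>2 + 1) * (E * exp E + 2 * real_of_int \<bar>k\<bar> * M)"
      \<comment> \<open>At y = 0 there is no cancellation to exploit; each of the a^2 + 1
        differences is at most 1 in modulus. Elsewhere \<open>C\<close> is the difference bound
        times the number of residues.\<close>
      define h where "h = (\<lambda>y. if y = 0 then of_int (a\<^sup>2 + 1) else C * norm (y::complex) powr - (2 + d))"
      have M1: "M \<ge> 1"
        unfolding M_def by simp
      have W1: "W \<ge> 0"
        unfolding W_def by simp
      have E0: "E \<ge> 0"
        using M1 W1 by (simp add: E_def)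
      have "(\<lambda>y. C * norm y powr - (2 + d)) summable_on gaussian_nz"
        by (intro summable_on_cmult_right summable_on_gaussian_powr d)
      then have "h summable_on gaussian_nz"
        by (rule summable_on_cong[THEN iffD1, rotated]) (auto simp: h_def)
      then have "h summable_on insert 0 gaussian_nz"
        by (simp only: summable_on_insert_iff)
      then have hs: "h summable_on gaussian_integers"
        by (simp add: insert_absorb)
      have Gle: "norm (G y x) \<le> h y" if y: "y \<in> gaussian_integers" and x: "x \<in> S" for y x
      proof (cases "y = 0")
        case True
        have "norm (F x (of_int r) - F x 0) \<le> 1" if "r \<in> R" for r
        proof (cases "r = 0")
          case False
          then have "norm (F x (of_int r)) = \<bar>real_of_int r\<bar> powr - (2 + Re x)"
            by (simp add: F_def norm_hecke)
          also have "\<dots> \<le> \<bar>real_of_int r\<bar> powr 0"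
            using False x d by (intro powr_mono) (auto simp: S_def)
          finally show ?thesis
            using False by (simp add: F_def)
        qed (simp add: F_def)
        then have "norm (G y x) \<le> (\<Sum>r\<in>R. 1)"
          unfolding G_def True by (intro sum_norm_le) auto
        also have "\<dots> = h y"
          using cardR'(1) by (simp add: h_def True)
        finally show ?thesis .
      next
        case False
        have y1: "norm y \<ge> 1"
          using gaussian_norm_ge_1 y False by blast
        have ay: "\<alpha> * y \<noteq> 0" "\<alpha> * y \<in> gaussian_integers"
          using False \<alpha>0 \<alpha>G y by auto
        have ay1: "norm (\<alpha> * y) \<ge> 1"
          using gaussian_norm_ge_1 ay by blast
        have ayy: "norm (\<alpha> * y) \<ge> norm y"
          using \<alpha>1 y1 mult_right_mono[of 1 "norm \<alpha>" "norm y"] by (simp add: norm_mult)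
        have "norm (2 + x) \<le> W"
        proof -
          have "norm (2 + x) \<le> norm (2::complex) + norm x"
            by (rule norm_triangle_ineq)
          also have "norm x \<le> norm w + 1"
            using x norm_triangle_ineq2[of x w] by (simp add: S_def dist_norm norm_minus_commute)
          finally show ?thesis
            by (simp add: W_def)
        qed
        note W = this
        have "norm (F x (\<alpha> * y + of_int r) - F x (\<alpha> * y)) \<le> (E * exp E + 2 * real_of_int \<bar>k\<bar> * M) * norm y powr - (2 + d)"
          if r: "r \<in> R" for r
        proof -
          have ne: "\<alpha> * y + of_int r \<noteq> 0"
          proof
            assume *: "\<alpha> * y + of_int r = 0"
            have "(y, r) = (0, 0)"
              by (rule inj_onD[OF bij_betw_imp_inj_on[OF gaussian_division_bij[of a]]])
                (use * y r in \<open>auto simp: R_def \<alpha>_def\<close>)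
            then show False
              using False by simp
          qed
          have "norm (\<alpha> * y + of_int r) \<ge> 1"
            using ne ay by (intro gaussian_norm_ge_1) auto
          moreover have "norm ((\<alpha> * y + of_int r) - \<alpha> * y) \<le> M"
          proof -
            have "real_of_int r \<le> real_of_int (a\<^sup>2 + 1)" "0 \<le> r"
              using r unfolding R_def by (auto simp del: of_int_add)
            then show ?thesis
              by (simp add: M_def)
          qed
          ultimately have "norm (hecke k x (\<alpha> * y + of_int r) - hecke k x (\<alpha> * y))
              \<le> (E * exp E + 2 * real_of_int \<bar>k\<bar> * M) * norm (\<alpha> * y) powr - (3 + Re x)"
            unfolding E_def using ay1 W by (intro hecke_diff_le) auto
          also have "norm (\<alpha> * y) powr - (3 + Re x) \<le> norm (\<alpha> * y) powr - (2 + d)"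
            using x ay1 by (intro powr_mono) (auto simp: S_def)
          also have "\<dots> \<le> norm y powr - (2 + d)"
            using ayy y1 d by (intro powr_mono2') auto
          finally show ?thesis
            using ne ay E0 M1 by (simp add: F_def mult_left_mono)
        qed
        then have "norm (G y x) \<le> (\<Sum>r\<in>R. (E * exp E + 2 * real_of_int \<bar>k\<bar> * M) * norm y powr - (2 + d))"
          unfolding G_def by (intro sum_norm_le) auto
        also have "\<dots> = h y"
          using cardR'(1) False by (simp add: h_def C_def del: of_int_add)
        finally show ?thesis .
      qed
      have "open S"
        unfolding S_def by (intro open_Int open_halfspace_Re_gt open_ball)
      moreover have "w \<in> S"
        unfolding S_def using that by (simp add: d_def field_simps)
      ultimately show ?thesis
        unfolding A_def using has_field_derivative_infsum[OF _ _ hs Gle Gder] by metis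
    qed
    then show ?thesis
      by (auto simp: holomorphic_on_open open_halfspace_Re_gt)
  qed
  moreover have "hecke_L k w * (1 - of_int (a\<^sup>2 + 1) * hecke k w \<alpha>) = A w" if w: "Re w > 0" for w
  proof -
    have Fs: "F w summable_on gaussian_integers"
    proof -
      have "F w summable_on gaussian_nz"
        using hecke_summable[OF w, of k] by (rule summable_on_cong[THEN iffD1, rotated]) (auto simp: F_def)
      then have "F w summable_on insert 0 gaussian_nz"
        by (simp only: summable_on_insert_iff)
      then show ?thesis
        by (simp add: insert_absorb)
    qed
    have FL: "infsum (F w) gaussian_integers = hecke_L k w"
      unfolding hecke_L_def by (rule infsum_cong_neutral) (auto simp: F_def)
    define \<phi> where "\<phi> = (\<lambda>(y, r). \<alpha> * y + of_int r)"
    have \<phi>: "bij_betw \<phi> (gaussian_integers \<times> R) gaussian_integers"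
      unfolding \<phi>_def R_def \<alpha>_def by (rule gaussian_division_bij)
    have s1: "(\<lambda>u. F w (\<phi> u)) summable_on gaussian_integers \<times> R"
      using summable_on_reindex_bij_betw[OF \<phi>, of "F w"] Fs by simp
    have "(\<Sum>\<^sub>\<infinity>y\<in>gaussian_integers. \<Sum>\<^sub>\<infinity>r\<in>R. F w (\<phi> (y, r))) = hecke_L k w"
      using infsum_Sigma_banach[OF s1] infsum_reindex_bij_betw[OF \<phi>, of "F w"] FL by simp
    then have S1: "(\<Sum>\<^sub>\<infinity>y\<in>gaussian_integers. \<Sum>r\<in>R. F w (\<alpha> * y + of_int r)) = hecke_L k w"
      using finR by (simp add: \<phi>_def)
    have s1': "(\<lambda>y. \<Sum>r\<in>R. F w (\<alpha> * y + of_int r)) summable_on gaussian_integers"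
      using summable_on_Sigma_banach[of "\<lambda>y r. F w (\<phi> (y, r))" gaussian_integers "\<lambda>_. R"] s1 finR
      by (simp add: \<phi>_def case_prod_unfold)
    have Fa: "F w (\<alpha> * y) = hecke k w \<alpha> * F w y" for y
      using \<alpha>0 by (simp add: F_def hecke_mult)
    have s2: "(\<lambda>y. of_int (a\<^sup>2 + 1) * (hecke k w \<alpha> * F w y)) summable_on gaussian_integers"
      by (intro summable_on_cmult_right Fs)
    have S2: "(\<Sum>\<^sub>\<infinity>y\<in>gaussian_integers. of_int (a\<^sup>2 + 1) * (hecke k w \<alpha> * F w y)) = of_int (a\<^sup>2 + 1) * (hecke k w \<alpha> * hecke_L k w)"
      by (simp add: infsum_cmult_right' FL del: of_int_add)
    have "G y w = (\<Sum>r\<in>R. F w (\<alpha> * y + of_int r)) + - (of_int (a\<^sup>2 + 1) * (hecke k w \<alpha> * F w y))" for y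
      unfolding G_def using cardR'(2) by (simp add: sum_subtractf Fa del: of_int_add)
    then have "A w = (\<Sum>\<^sub>\<infinity>y\<in>gaussian_integers. (\<Sum>r\<in>R. F w (\<alpha> * y + of_int r)) + - (of_int (a\<^sup>2 + 1) * (hecke k w \<alpha> * F w y)))"
      unfolding A_def by simp
    also have "\<dots> = hecke_L k w + - (of_int (a\<^sup>2 + 1) * (hecke k w \<alpha> * hecke_L k w))"
      using s2 by (subst infsum_add[OF s1']) (simp_all add: S1 S2 infsum_uminus summable_on_uminus del: of_int_add)
    finally show ?thesis
      by (simp add: algebra_simps del: of_int_add)
  qed
  ultimately show ?thesis
    using that by blast
qed

section \<open>The 3-4-1 inequality\<close>

definition hecke_D :: "int \<Rightarrow> complex \<Rightarrow> complex" where
  "hecke_D k w = (\<Sum>\<^sub>\<infinity>p\<in>{p. gaussian_prime p}. ln (norm p) * hecke k w p)"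

lemma hecke_D_summable:
  assumes "Re w > 0"
  shows "(\<lambda>p. ln (norm p) * hecke k w p) summable_on {p. gaussian_prime p}"
proof -
  have "(\<lambda>(p, j). ln (norm p) * hecke k w p ^ j) summable_on (\<lambda>p. (p, 1::nat)) ` {p. gaussian_prime p}"
    using hecke_Lambda_summable[OF assms] by (rule summable_on_subset_banach) auto
  then show ?thesis
    by (subst (asm) summable_on_reindex) (auto simp: inj_on_def o_def)
qed

text \<open>Since |p|^2 \<ge> 2 and ln |p| \<le> |p|, the terms with j \<ge> 2 are at most |p|^(-3)
  2^(-(j-2)) throughout Re w > 0. So \<open>hecke_D\<close> inherits boundedness and poles from the
  logarithmic derivative.\<close>

lemma hecke_Lambda_minus_D_bounded:
  obtains C where "\<And>k w. Re w > 0 \<Longrightarrow> norm (hecke_Lambda k w - hecke_D k w) \<le> C"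
proof -
  define P where "P = {p. gaussian_prime p}"
  define h where "h = (\<lambda>(p, j::nat). norm (p::complex) powr - (2 + 1) * (1/2) ^ (j - 2))"
  have Pnz: "P \<subseteq> gaussian_nz"
    unfolding P_def gaussian_prime_def by auto
  have hs: "h summable_on P \<times> {2..}"
  proof (rule summable_on_SigmaI)
    have "((\<lambda>j. (1/2::real) ^ j) has_sum 2) UNIV"
      using geometric_sums[of "1/2::real"] by (intro sums_nonneg_imp_has_sum) auto
    also have "?this \<longleftrightarrow> ((\<lambda>j. (1/2::real) ^ (j - 2)) has_sum 2) {2..}"
      by (rule has_sum_reindex_bij_witness[of _ "\<lambda>j. j - 2" "\<lambda>j. j + 2"]) auto
    finally show "((\<lambda>j. h (p, j)) has_sum norm p powr - (2 + 1) * 2) {2..}" for p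
      unfolding h_def by (auto intro: has_sum_cmult_right)
    have "(\<lambda>p. norm p powr - (2 + 1)) summable_on P"
      using summable_on_gaussian_powr[of 1] Pnz by (rule summable_on_subset_banach) auto
    then show "(\<lambda>p. norm p powr - (2 + 1) * 2) summable_on P"
      by (rule summable_on_cmult_left)
  qed (auto simp: h_def)
  have "norm (hecke_Lambda k w - hecke_D k w) \<le> infsum h (P \<times> {2..})" if w: "Re w > 0" for k w
  proof -
    define g where "g = (\<lambda>(p, j). ln (norm p) * hecke k w p ^ j)"
    have gs: "g summable_on P \<times> {1..}"
      unfolding g_def P_def using hecke_Lambda_summable[OF w] .
    have eq: "P \<times> {1..} = P \<times> {1} \<union> P \<times> {2::nat..}"
      by auto
    have g1: "g summable_on P \<times> {1}" and g2: "g summable_on P \<times> {2..}"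
      using gs by (auto intro: summable_on_subset_banach)
    have "hecke_Lambda k w = infsum g (P \<times> {1}) + infsum g (P \<times> {2..})"
      unfolding hecke_Lambda_def g_def[symmetric] P_def[symmetric] eq
      by (rule infsum_Un_disjoint[OF g1 g2]) auto
    also have "infsum g (P \<times> {1}) = hecke_D k w"
      unfolding hecke_D_def P_def[symmetric]
      by (rule infsum_reindex_bij_witness[of _ "\<lambda>p. (p, 1)" fst]) (auto simp: g_def)
    finally have "hecke_Lambda k w - hecke_D k w = infsum g (P \<times> {2..})"
      by simp
    also have "norm \<dots> \<le> infsum h (P \<times> {2..})"
    proof (rule norm_infsum_le)
      show "(g has_sum infsum g (P \<times> {2..})) (P \<times> {2..})" "(h has_sum infsum h (P \<times> {2..})) (P \<times> {2..})"
        using g2 hs by auto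
      fix x assume "x \<in> P \<times> {2::nat..}"
      then obtain p i where x: "x = (p, i + 2)" and p: "gaussian_prime p"
        unfolding P_def by (auto simp: le_iff_add add.commute)
      have p1: "norm p > 1" and p0: "p \<noteq> 0" "p \<in> gaussian_integers"
        using p gaussian_prime_norm_gt_1 unfolding gaussian_prime_def by auto
      have "norm p \<ge> sqrt 2"
        using p0 p1 by (intro gaussian_norm_ge_sqrt2) auto
      then have p2: "(norm p)\<^sup>2 \<ge> 2"
        using real_sqrt_le_iff sqrt_le_D by blast
      have "norm (hecke k w p) \<le> norm p powr - 2"
        using p0 p1 w by (auto simp: norm_hecke intro!: powr_mono)
      also have "\<dots> = 1 / (norm p)\<^sup>2"
        using p1 by (simp add: powr_minus powr_numeral field_simps)
      finally have n: "norm (hecke k w p) \<le> 1 / (norm p)\<^sup>2" .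
      have "norm (g x) = ln (norm p) * (norm (hecke k w p) ^ 2 * norm (hecke k w p) ^ i)"
        using p1 by (simp add: x g_def norm_mult norm_power power2_eq_square mult_ac)
      also have "\<dots> \<le> norm p * ((1 / (norm p)\<^sup>2) ^ 2 * (1 / (norm p)\<^sup>2) ^ i)"
        using n p1 ln_bound[of "norm p"] p0 by (intro mult_mono power_mono) auto
      also have "(1 / (norm p)\<^sup>2) ^ i \<le> (1 / 2) ^ i"
        using p2 by (intro power_mono divide_left_mono) auto
      also have "norm p * ((1 / (norm p)\<^sup>2) ^ 2 * (1 / 2) ^ i) = h x"
      proof -
        have "norm p powr - 3 = 1 / norm p ^ 3"
          using p1 by (simp add: powr_minus powr_numeral field_simps)
        moreover have "norm p * (1 / (norm p)\<^sup>2) ^ 2 = 1 / norm p ^ 3"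
          using p0(1) by (simp add: power2_eq_square power3_eq_cube field_simps)
        ultimately show ?thesis
          by (simp add: h_def x mult.assoc[symmetric])
      qed
      finally show "norm (g x) \<le> h x"
        using p1 by (simp add: mult_left_mono)
    qed
    finally show ?thesis .
  qed
  then show ?thesis
    using that by blast
qed

lemma hecke_unit:
  assumes "u \<in> gaussian_integers" "norm u = 1" "4 dvd k"
  shows "hecke k w u = 1"
proof -
  have "u \<in> {1, -1, \<i>, -\<i>}"
    using assms gaussian_norm_1_cases by blast
  then have "u ^ 4 = 1"
    by (auto simp: power_minus[of \<i>])
  then have "u powi k = 1"
    using assms(3) by (auto simp: dvd_def power_int_mult)
  then show ?thesis
    using assms(2) by (simp add: hecke_def sgn_eq)
qed

lemma ii_powi_eq_1_iff: "\<i> powi k = 1 \<longleftrightarrow> 4 dvd k"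
proof -
  have eq: "\<i> powi k = \<i> ^ nat (k mod 4)"
  proof -
    have "\<i> powi k = \<i> powi (4 * (k div 4) + k mod 4)"
      by simp
    also have "\<dots> = (\<i> powi 4) powi (k div 4) * \<i> powi (k mod 4)"
      by (subst power_int_add) (auto simp: power_int_mult)
    also have "\<i> powi 4 = 1"
      by simp
    finally show ?thesis
      by (simp add: power_int_def)
  qed
  have "k mod 4 \<in> {0, 1, 2, 3}"
    by auto
  then show ?thesis
    unfolding eq by (auto simp: dvd_eq_mod_eq_0 numeral_eq_Suc complex_eq_iff)
qed

text \<open>Multiplication by i permutes the Gaussian primes and multiplies the sum by i^k, which
  differs from 1. These are the frequencies at which the L-series vanishes and offers no logarithmic
  derivative.\<close>

lemma hecke_D_eq_0:
  assumes "\<not> 4 dvd k"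
  shows "hecke_D k w = 0"
proof -
  have ass: "gaussian_prime (u * p)" if "gaussian_prime p" "u \<in> {\<i>, -\<i>}" for u p
    using that by (auto intro!: gaussian_prime_associate[of _ _ , of p \<i>] gaussian_prime_associate[of p "-\<i>"])
  have "hecke_D k w = (\<Sum>\<^sub>\<infinity>p\<in>{p. gaussian_prime p}. \<i> powi k * (ln (norm p) * hecke k w p))"
    unfolding hecke_D_def
  proof (rule infsum_reindex_bij_witness[of _ "\<lambda>p. \<i> * p" "\<lambda>p. - \<i> * p"])
    fix p assume "p \<in> {p. gaussian_prime p}"
    then have "p \<noteq> 0"
      by (simp add: gaussian_prime_def)
    have "hecke k w p = hecke k w (\<i> * (- \<i> * p))"
      by simp
    also have "\<dots> = hecke k w \<i> * hecke k w (- \<i> * p)"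
      using \<open>p \<noteq> 0\<close> by (subst hecke_mult) auto
    also have "hecke k w \<i> = \<i> powi k"
      by (simp add: hecke_def sgn_eq)
    finally show "\<i> powi k * (ln (norm (- \<i> * p)) * hecke k w (- \<i> * p)) = ln (norm p) * hecke k w p"
      by (simp add: norm_mult)
    show "- \<i> * p \<in> {p. gaussian_prime p}"
      using ass[of p "- \<i>"] \<open>p \<in> _\<close> by simp
  qed (use ass in auto)
  also have "\<dots> = \<i> powi k * hecke_D k w"
    unfolding hecke_D_def by (rule infsum_cmult_right')
  finally have "(\<i> powi k - 1) * hecke_D k w = 0"
    by (simp add: algebra_simps)
  then show ?thesis
    using assms ii_powi_eq_1_iff by simp
qed

text \<open>The four units contribute exactly 4. All other elements have norm at least sqrt 2, so
  moving n units to the right of Re w = 1 shrinks the rest by (sqrt 2)^(-n); it ends up below 1,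
  uniformly in k and t.\<close>

lemma hecke_L_nonzero_far_right:
  obtains S where "S > 0" "\<And>k t. 4 dvd k \<Longrightarrow> hecke_L k (Complex S t) \<noteq> 0"
proof -
  define T where "T = (\<Sum>\<^sub>\<infinity>z\<in>gaussian_nz. norm z powr - (2 + 1))"
  have sT: "(\<lambda>z. norm z powr - (2 + 1)) summable_on gaussian_nz"
    by (rule summable_on_gaussian_powr) simp
  obtain n where n: "T < sqrt 2 ^ n"
    using real_arch_pow[of "sqrt 2" T] by auto
  define S where "S = real n + 1"
  have "hecke_L k (Complex S t) \<noteq> 0" if k: "4 dvd k" for k t
  proof -
    define w where "w = Complex S t"
    have w: "Re w = S" "Re w > 0"
      by (simp_all add: w_def S_def)
    define U where "U = {1, -1, \<i>, -\<i>}"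
    have U: "U \<subseteq> gaussian_nz" "card U = 4" "finite U"
      unfolding U_def by (auto simp: complex_eq_iff)
    have hs: "hecke k w summable_on gaussian_nz - U"
      using hecke_summable[OF w(2)] by (rule summable_on_subset_banach) auto
    have "hecke_L k w = infsum (hecke k w) U + infsum (hecke k w) (gaussian_nz - U)"
      unfolding hecke_L_def using U hs infsum_Un_disjoint[of "hecke k w" U "gaussian_nz - U"]
      by (auto simp: Un_absorb1)
    also have "infsum (hecke k w) U = sum (hecke k w) U"
      using U(3) by simp
    also have "\<dots> = (\<Sum>u\<in>U. 1)"
      by (rule sum.cong) (auto simp: U_def intro!: hecke_unit k)
    also have "\<dots> = 4"
      using U by simp
    finally have eq: "hecke_L k w = 4 + infsum (hecke k w) (gaussian_nz - U)" .
    have "norm (infsum (hecke k w) (gaussian_nz - U)) \<le> (\<Sum>\<^sub>\<infinity>z\<in>gaussian_nz - U. norm z powr - (2 + 1) * (1 / sqrt 2 ^ n))"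
    proof (rule norm_infsum_le)
      have "(\<lambda>z. norm z powr - (2 + 1)) summable_on gaussian_nz - U"
        using sT by (rule summable_on_subset_banach) auto
      then show "((\<lambda>z. norm z powr - (2 + 1) * (1 / sqrt 2 ^ n)) has_sum (\<Sum>\<^sub>\<infinity>z\<in>gaussian_nz - U. norm z powr - (2 + 1) * (1 / sqrt 2 ^ n))) (gaussian_nz - U)"
        by (intro has_sum_infsum summable_on_cmult_left)
      show "(hecke k w has_sum infsum (hecke k w) (gaussian_nz - U)) (gaussian_nz - U)"
        using hs by simp
      fix z assume z: "z \<in> gaussian_nz - U"
      then have "norm z \<noteq> 1"
        using gaussian_norm_1_cases unfolding U_def by blast
      then have z2: "norm z \<ge> sqrt 2" "z \<noteq> 0"
        using z gaussian_norm_ge_sqrt2 by auto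
      have "norm (hecke k w z) = norm z powr (- (2 + 1) - real n)"
        using z2 w by (simp add: norm_hecke S_def)
      also have "\<dots> = norm z powr - (2 + 1) * (1 / norm z ^ n)"
        using z2 by (subst powr_diff) (simp add: powr_realpow)
      also have "\<dots> \<le> norm z powr - (2 + 1) * (1 / sqrt 2 ^ n)"
        using z2 by (intro mult_left_mono divide_left_mono power_mono) auto
      finally show "norm (hecke k w z) \<le> norm z powr - (2 + 1) * (1 / sqrt 2 ^ n)" .
    qed
    also have "\<dots> = (\<Sum>\<^sub>\<infinity>z\<in>gaussian_nz - U. norm z powr - (2 + 1)) * (1 / sqrt 2 ^ n)"
      by (rule infsum_cmult_left')
    also have "\<dots> \<le> T * (1 / sqrt 2 ^ n)"
      unfolding T_def
      by (intro mult_right_mono infsum_mono_neutral summable_on_subset_banach[OF sT] sT) auto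
    also have "\<dots> < 1"
      using n by simp
    finally have small: "norm (infsum (hecke k w) (gaussian_nz - U)) < 1" .
    have "hecke_L k w \<noteq> 0"
    proof
      assume "hecke_L k w = 0"
      then have "infsum (hecke k w) (gaussian_nz - U) = - 4"
        using eq by (simp add: eq_neg_iff_add_eq_0 add.commute)
      then show False
        using small by simp
    qed
    then show ?thesis
      by (simp add: w_def)
  qed
  moreover have "S > 0"
    by (simp add: S_def)
  ultimately show ?thesis
    using that by blast
qed

section \<open>Positivity and the resulting lower bound\<close>

lemma three_four_one:
  fixes u :: complex
  assumes "norm u = 1"
  shows "Re (3 + 4 * u + u\<^sup>2) \<ge> 0"
proof -
  have "(Re u)\<^sup>2 + (Im u)\<^sup>2 = 1"
    using assms by (metis cmod_power2 one_power2)
  then have "Re (3 + 4 * u + u\<^sup>2) = 2 * (1 + Re u)\<^sup>2"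
    by (simp add: power2_eq_square algebra_simps)
  then show ?thesis
    by simp
qed

text \<open>At a prime power the three characters take the values \<rho>^j, \<rho>^j v^j and
  \<rho>^j v^(2j), with \<rho> > 0 and |v| = 1, so the inequality holds term by term.\<close>

lemma hecke_Lambda_three_four_one:
  fixes s t :: real
  assumes s: "s > 0"
  shows "3 * Re (hecke_Lambda 0 s) + 4 * Re (hecke_Lambda k (Complex s t))
    + Re (hecke_Lambda (2 * k) (Complex s (2 * t))) \<ge> 0"
proof -
  define g where "g = (\<lambda>k w (p, j). ln (norm p) * hecke k w p ^ j)"
  have gs: "(g k w has_sum hecke_Lambda k w) gaussian_prime_powers" if "Re w > 0" for k w
    using hecke_Lambda_summable[OF that] unfolding g_def hecke_Lambda_def by simp
  have "((\<lambda>x. 3 * Re (g 0 s x) + 4 * Re (g k (Complex s t) x) + Re (g (2 * k) (Complex s (2 * t)) x)) has_sum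
    3 * Re (hecke_Lambda 0 s) + 4 * Re (hecke_Lambda k (Complex s t)) + Re (hecke_Lambda (2 * k) (Complex s (2 * t))))
     gaussian_prime_powers"
    by (intro has_sum_add has_sum_cmult_right has_sum_Re gs) (use s in auto)
  moreover have "3 * Re (g 0 s x) + 4 * Re (g k (Complex s t) x) + Re (g (2 * k) (Complex s (2 * t)) x) \<ge> 0"
    if x: "x \<in> gaussian_prime_powers" for x
  proof -
    obtain p j where pj: "x = (p, j)" "gaussian_prime p"
      using x by auto
    then have p: "p \<noteq> 0" "norm p > 1"
      using gaussian_prime_norm_gt_1 by (auto simp: gaussian_prime_def)
    define l where "l = ln (norm p)"
    have l: "l \<ge> 0"
      using p by (simp add: l_def)
    define \<rho> where "\<rho> = exp (- (2 + s) * l)"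
    define v where "v = sgn p powi k * exp (- (\<i> * t * l))"
    have nv: "norm v = 1"
      using p by (simp add: v_def norm_mult norm_power_int norm_sgn)
    have h0: "hecke 0 s p = of_real \<rho>"
      by (simp add: hecke_def \<rho>_def l_def exp_of_real[symmetric])
    have h1: "hecke k (Complex s t) p = of_real \<rho> * v"
      by (simp add: hecke_def \<rho>_def v_def l_def[symmetric] Complex_eq exp_of_real[symmetric] mult_exp_exp algebra_simps)
    have h2: "hecke (2 * k) (Complex s (2 * t)) p = of_real \<rho> * v\<^sup>2"
    proof -
      have "sgn p powi (2 * k) = (sgn p powi k)\<^sup>2"
        by (simp add: power_int_mult mult.commute[of 2])
      then show ?thesis
        by (simp add: hecke_def \<rho>_def v_def l_def[symmetric] Complex_eq exp_of_real[symmetric] power_mult_distrib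
          exp_double[symmetric] mult_exp_exp algebra_simps)
    qed
    have "3 * Re (g 0 s x) + 4 * Re (g k (Complex s t) x) + Re (g (2 * k) (Complex s (2 * t)) x)
        = Re (of_real (l * \<rho> ^ j) * (3 + 4 * v ^ j + (v ^ j)\<^sup>2))"
      unfolding g_def pj(1) prod.case h0 h1 h2 l_def[symmetric] power_mult_distrib
      by (simp add: power_mult[symmetric] mult.commute[of 2 j] distrib_left flip: of_real_power)
    also have "\<dots> = l * \<rho> ^ j * Re (3 + 4 * v ^ j + (v ^ j)\<^sup>2)"
      by (simp only: Re_complex_of_real Im_complex_of_real times_complex.sel)
    also have "\<dots> \<ge> 0"
      using l nv by (intro mult_nonneg_nonneg three_four_one) (auto simp: \<rho>_def norm_power)
    finally show ?thesis .
  qed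
  ultimately show ?thesis
    by (rule has_sum_nonneg)
qed

text \<open>The squared modulus stays differentiable at zeros of L, unlike log |L|, so nonvanishing
  inside Re w > 0 is not presupposed.\<close>

lemma has_real_derivative_norm_sq_hecke_L:
  assumes "s > 0"
  shows "((\<lambda>s. (norm (hecke_L k (Complex s t)))\<^sup>2) has_real_derivative
    (- Re (hecke_Lambda k (Complex s t)) / 2 * (norm (hecke_L k (Complex s t)))\<^sup>2)) (at s)"
proof -
  define L where "L = hecke_L k (Complex s t)"
  define L' where "L' = - (hecke_Lambda k (Complex s t) * L / 4)"
  have "((\<lambda>x. Complex x t) has_vector_derivative 1) (at s)"
    unfolding Complex_eq by (auto intro!: derivative_eq_intros)
  then have "((hecke_L k \<circ> (\<lambda>x. Complex x t)) has_vector_derivative 1 * L') (at s)"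
    unfolding L'_def L_def using assms by (intro field_vector_diff_chain_at hecke_L_has_field_derivative) auto
  then have "((\<lambda>x. hecke_L k (Complex x t)) has_derivative (\<lambda>h. h *\<^sub>R L')) (at s)"
    by (simp add: o_def has_vector_derivative_def)
  from has_derivative_inner[OF this this]
  have "((\<lambda>x. hecke_L k (Complex x t) \<bullet> hecke_L k (Complex x t)) has_derivative (\<lambda>h. L \<bullet> (h *\<^sub>R L') + (h *\<^sub>R L') \<bullet> L)) (at s)"
    by (simp add: L_def)
  then have "((\<lambda>x. (norm (hecke_L k (Complex x t)))\<^sup>2) has_real_derivative 2 * (L \<bullet> L')) (at s)"
    unfolding has_field_derivative_def power2_norm_eq_inner
    by (rule has_derivative_eq_rhs) (simp_all add: power2_norm_eq_inner inner_commute fun_eq_iff)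
  moreover have "2 * (L \<bullet> L') = - Re (hecke_Lambda k (Complex s t)) / 2 * (norm L)\<^sup>2"
    unfolding L'_def cmod_power2 by (simp add: inner_complex_def power2_eq_square field_simps)
  ultimately show ?thesis
    unfolding L_def by simp
qed

text \<open>Since $L' = -\Lambda L / 4$, positivity of $3 + 4u + u^2$ makes the product below nonincreasing in $s$,
  so no Euler product is needed; far to the right it is nonzero.\<close>

lemma hecke_L_three_four_one_lower_bound:
  assumes k: "4 dvd k"
  obtains c S :: real where "c > 0" "S > 0"
    "\<And>s. 0 < s \<Longrightarrow> s \<le> S \<Longrightarrow> c \<le> (norm (hecke_L 0 s)) ^ 6 * (norm (hecke_L k (Complex s t))) ^ 8
      * (norm (hecke_L (2 * k) (Complex s (2 * t)))) ^ 2"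
proof -
  obtain S where S: "S > 0" "\<And>k t. 4 dvd k \<Longrightarrow> hecke_L k (Complex S t) \<noteq> 0"
    using hecke_L_nonzero_far_right by blast
  define q0 where "q0 = (\<lambda>s. (norm (hecke_L 0 (Complex s 0)))\<^sup>2)"
  define q1 where "q1 = (\<lambda>s. (norm (hecke_L k (Complex s t)))\<^sup>2)"
  define q2 where "q2 = (\<lambda>s. (norm (hecke_L (2 * k) (Complex s (2 * t))))\<^sup>2)"
  \<comment> \<open>The exponents 3, 4, 1 sit on squared moduli, whence 6, 8, 2 in the statement;
    the derivative is -(3 l0 + 4 l1 + l2) / 2 times \<Psi> even where \<Psi> vanishes.\<close>
  define \<Psi> where "\<Psi> = (\<lambda>s. q0 s ^ 3 * q1 s ^ 4 * q2 s)"
  have "\<Psi> S \<le> \<Psi> s" if s: "0 < s" "s \<le> S" for s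
  proof (rule DERIV_nonpos_imp_nonincreasing[OF s(2)])
    fix x assume x: "s \<le> x" "x \<le> S"
    then have x0: "x > 0"
      using s by simp
    define l0 where "l0 = Re (hecke_Lambda 0 (Complex x 0))"
    define l1 where "l1 = Re (hecke_Lambda k (Complex x t))"
    define l2 where "l2 = Re (hecke_Lambda (2 * k) (Complex x (2 * t)))"
    have d: "(q0 has_real_derivative - l0 / 2 * q0 x) (at x)" "(q1 has_real_derivative - l1 / 2 * q1 x) (at x)"
        "(q2 has_real_derivative - l2 / 2 * q2 x) (at x)"
      unfolding q0_def q1_def q2_def l0_def l1_def l2_def
      using has_real_derivative_norm_sq_hecke_L[OF x0] by blast+
    have "(\<Psi> has_real_derivative - (3 * l0 + 4 * l1 + l2) / 2 * \<Psi> x) (at x)"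
      unfolding \<Psi>_def by (rule derivative_eq_intros d refl)+ (simp add: field_simps eval_nat_numeral)
    moreover have "3 * l0 + 4 * l1 + l2 \<ge> 0"
      unfolding l0_def l1_def l2_def using hecke_Lambda_three_four_one[OF x0] by (simp add: Complex_eq)
    moreover have "\<Psi> x \<ge> 0"
      by (simp add: \<Psi>_def q0_def q1_def q2_def)
    ultimately show "\<exists>y. (\<Psi> has_real_derivative y) (at x) \<and> y \<le> 0"
      by (metis (no_types, lifting) divide_nonpos_nonneg mult_nonpos_nonneg neg_le_0_iff_le zero_le_numeral)
  qed
  moreover have "\<Psi> S > 0"
    using S k by (simp add: \<Psi>_def q0_def q1_def q2_def)
  ultimately show ?thesis
    using S(1) that[of "\<Psi> S" S]
    by (simp add: \<Psi>_def q0_def q1_def q2_def Complex_eq flip: power_mult)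
qed

section \<open>Behaviour on the line $\mathrm{Re}\, w = 0$\<close>

text \<open>Modulo 5 the powers of 2 + i alternate between 2 + i and 3 + 4i, so the imaginary part
  is congruent to 1 or 4. Thus the argument of 2 + i is not a rational multiple of pi.\<close>

lemma Im_two_plus_ii_power_nonzero:
  assumes "n \<ge> 1"
  shows "Im ((2 + \<i>) ^ n) \<noteq> 0"
proof -
  have "\<exists>x y :: int. (2 + \<i>) ^ n = Complex (of_int (5 * x + 2)) (of_int (5 * y + 1)) \<or>
      (2 + \<i>) ^ n = Complex (of_int (5 * x + 3)) (of_int (5 * y + 4))"
    using assms
  proof (induction n rule: dec_induct)
    case base
    have "(2 + \<i>) ^ 1 = Complex (of_int (5 * 0 + 2)) (of_int (5 * 0 + 1))"
      by (simp add: complex_eq_iff)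
    then show ?case
      by blast
  next
    case (step n)
    then obtain x y :: int where "(2 + \<i>) ^ n = Complex (of_int (5 * x + 2)) (of_int (5 * y + 1)) \<or>
        (2 + \<i>) ^ n = Complex (of_int (5 * x + 3)) (of_int (5 * y + 4))"
      by blast
    then show ?case
    proof
      assume "(2 + \<i>) ^ n = Complex (of_int (5 * x + 2)) (of_int (5 * y + 1))"
      then have "(2 + \<i>) ^ Suc n = Complex (of_int (5 * (2 * x - y) + 3)) (of_int (5 * (x + 2 * y) + 4))"
        by (simp add: complex_eq_iff)
      then show ?thesis
        by blast
    next
      assume "(2 + \<i>) ^ n = Complex (of_int (5 * x + 3)) (of_int (5 * y + 4))"
      then have "(2 + \<i>) ^ Suc n = Complex (of_int (5 * (2 * x - y) + 2)) (of_int (5 * (x + 2 * y + 2) + 1))"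
        by (simp add: complex_eq_iff)
      then show ?thesis
        by blast
    qed
  qed
  then obtain y :: int where "Im ((2 + \<i>) ^ n) = of_int (5 * y + 1) \<or> Im ((2 + \<i>) ^ n) = of_int (5 * y + 4)"
    by (metis complex.sel(2))
  moreover have "5 * y + 1 \<noteq> 0" "5 * y + 4 \<noteq> 0"
    by presburger+
  ultimately show ?thesis
    by (metis of_int_eq_0_iff)
qed

lemma power_eq_power_2_5:
  fixes m n :: nat
  assumes "2 ^ m = (5 ^ n :: nat)"
  shows "m = 0"
proof (rule ccontr)
  assume "m \<noteq> 0"
  then have "even (2 ^ m :: nat)"
    by simp
  then show False
    using assms by simp
qed

text \<open>The factor by which $N(\alpha)$ times the sum over multiples of $\alpha = a + i$ differs from the full sum.\<close>

definition twist :: "int \<Rightarrow> int \<Rightarrow> complex \<Rightarrow> complex" where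
  "twist k a w = sgn (of_int a + \<i>) powi k * exp (- w * of_real (ln (norm (of_int a + \<i>))))"

lemma norm_of_int_plus_ii: "norm (of_int a + \<i>) = sqrt (of_int (a\<^sup>2 + 1))"
  by (simp add: cmod_def)

lemma twist_altdef: "of_int (a\<^sup>2 + 1) * hecke k w (of_int a + \<i>) = twist k a w"
proof -
  define l where "l = ln (norm (of_int a + \<i>))"
  have "exp (2 * l) = (norm (of_int a + \<i>))\<^sup>2"
    unfolding l_def exp_double by (subst exp_ln) (auto simp: complex_eq_iff)
  also have "\<dots> = of_int (a\<^sup>2 + 1)"
    unfolding norm_of_int_plus_ii by simp
  finally have "complex_of_real (exp (2 * l)) = of_int (a\<^sup>2 + 1)"
    by (simp only: of_real_of_int_eq)
  then have e: "exp (2 * complex_of_real l) = of_int (a\<^sup>2 + 1)"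
    by (simp flip: exp_of_real)
  have "exp (- (2 + w) * of_real l) = exp (- w * of_real l) / exp (2 * complex_of_real l)"
    by (simp add: exp_diff[symmetric] algebra_simps)
  moreover have "(of_int (a\<^sup>2 + 1) :: complex) \<noteq> 0"
    unfolding of_int_eq_0_iff by (simp add: add_nonneg_eq_0_iff)
  ultimately show ?thesis
    unfolding twist_def hecke_def l_def[symmetric] e by simp
qed

lemma hecke_L_twist:
  obtains A where "A holomorphic_on {w. Re w > -1}"
    "\<And>w. Re w > 0 \<Longrightarrow> hecke_L k w * (1 - twist k a w) = A w"
  using hecke_L_twisted_continuation[of k a] unfolding twist_altdef by metis

lemma twist_holomorphic: "twist k a holomorphic_on A"
  unfolding twist_def by (intro holomorphic_intros)

lemma exp_ii_eq_1_real:
  assumes "exp (- (\<i> * of_real x)) = 1"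
  shows "\<exists>n::int. x = 2 * pi * n"
proof -
  obtain n :: int where "Im (- (\<i> * of_real x)) = of_int (2 * n) * pi"
    using assms unfolding exp_eq_1 by blast
  then have "- x = 2 * pi * of_int n"
    by (simp add: mult_ac)
  then have "x = 2 * pi * of_int (- n)"
    by (metis minus_minus mult_minus_right of_int_minus)
  then show ?thesis ..
qed

text \<open>For k = 0 the norms 2 and 5 of 1 + i and 2 + i are multiplicatively independent, so
  their t-factors cannot both be 1. For k \<noteq> 0 the elements 2 + i and -2 + i have equal norm,
  so the t-factor cancels and equal twists would make a power of 2 + i real.\<close>

lemma twist_neq_1:
  assumes k: "4 dvd k" and kt: "k \<noteq> 0 \<or> t \<noteq> 0"
  obtains a where "twist k a (\<i> * of_real t) \<noteq> 1"
proof (cases "k = 0")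
  case True
  then have t: "t \<noteq> 0"
    using kt by simp
  have "\<exists>a\<in>{1, 2}. twist k a (\<i> * of_real t) \<noteq> 1"
  proof (rule ccontr)
    assume "\<not> ?thesis"
    then have "twist k 1 (\<i> * of_real t) = 1" "twist k 2 (\<i> * of_real t) = 1"
      by auto
    then have "exp (- (\<i> * of_real (t * ln (sqrt 2)))) = 1" "exp (- (\<i> * of_real (t * ln (sqrt 5)))) = 1"
      unfolding twist_def norm_of_int_plus_ii using True by (simp_all add: mult.assoc)
    then obtain m n :: int where mn: "t * ln (sqrt 2) = 2 * pi * m" "t * ln (sqrt 5) = 2 * pi * n"
      using exp_ii_eq_1_real by metis
    have "m \<noteq> 0"
      using mn(1) t by auto
    have "t * (2 * pi) * (n * ln 2 - m * ln 5) = 0"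
    proof -
      have "t * ln 2 = 4 * pi * m" "t * ln 5 = 4 * pi * n"
        using mn by (simp_all add: ln_sqrt)
      then have "(t * ln 2) * n = (t * ln 5) * m"
        by simp
      then show ?thesis
        by (simp add: algebra_simps)
    qed
    then have "n * ln 2 = m * ln (5::real)"
      using t by simp
    then have "\<bar>real_of_int n\<bar> * ln 2 = \<bar>real_of_int m\<bar> * ln 5"
      by (metis abs_mult abs_of_pos ln_gt_zero one_less_numeral_iff semiring_norm(76) semiring_norm(77))
    then have "ln (2 ^ nat \<bar>n\<bar>) = ln (5 ^ nat \<bar>m\<bar> :: real)"
      by (simp add: ln_realpow)
    then have "(2::real) ^ nat \<bar>n\<bar> = 5 ^ nat \<bar>m\<bar>"
      by simp
    then have eq: "2 ^ nat \<bar>n\<bar> = (5 ^ nat \<bar>m\<bar> :: nat)"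
      by (metis (mono_tags, lifting) of_nat_eq_iff of_nat_numeral of_nat_power)
    then have "nat \<bar>n\<bar> = 0"
      by (rule power_eq_power_2_5)
    then have "5 ^ nat \<bar>m\<bar> = (1 :: nat)"
      using eq by simp
    then show False
      using \<open>m \<noteq> 0\<close> by simp
  qed
  then show ?thesis
    using that by blast
next
  case False
  have "\<exists>a\<in>{2, -2}. twist k a (\<i> * of_real t) \<noteq> 1"
  proof (rule ccontr)
    assume "\<not> ?thesis"
    then have "twist k 2 (\<i> * of_real t) = twist k (-2) (\<i> * of_real t)"
      by auto
    then have "sgn (2 + \<i>) powi k = sgn (-2 + \<i>) powi k"
      unfolding twist_def norm_of_int_plus_ii by simp
    moreover have "norm (2 + \<i>) = norm (-2 + \<i>)"
      by (simp add: cmod_def)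
    ultimately have "(2 + \<i>) powi k = (-2 + \<i>) powi k"
      by (simp add: sgn_eq power_int_divide_distrib)
    moreover define n where "n = nat \<bar>k\<bar>"
    ultimately have "(2 + \<i>) ^ n = (-2 + \<i>) ^ n"
      by (auto simp: power_int_def abs_if power_inverse split: if_splits)
    also have "-2 + \<i> = - cnj (2 + \<i>)"
      by (simp add: complex_eq_iff)
    \<comment> \<open>Divisibility of k by 4 makes n even, which removes the sign.\<close>
    also have "(- cnj (2 + \<i>)) ^ n = cnj (2 + \<i>) ^ n"
      using k by (intro power_minus_even) (auto simp: n_def even_nat_iff elim: dvd_trans[rotated])
    also have "\<dots> = cnj ((2 + \<i>) ^ n)"
      by simp
    finally have "Im ((2 + \<i>) ^ n) = 0"
      by (metis Reals_cnj_iff complex_is_Real_iff)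
    moreover have "n \<ge> 1"
      using False by (simp add: n_def)
    ultimately show False
      using Im_two_plus_ii_power_nonzero by blast
  qed
  then show ?thesis
    using that by blast
qed

section \<open>Local continuation across the line\<close>

text \<open>For a suitable \<open>a\<close> the factor 1 - twist is nonzero at the given point and
  hence near it, so the twisted continuation can be divided by it. The choice of \<open>a\<close>
  varies with the point.\<close>

lemma hecke_L_continuation_on_line:
  assumes k: "4 dvd k" and kt: "k \<noteq> 0 \<or> t \<noteq> 0"
  obtains r M where "r > 0" "M holomorphic_on ball (\<i> * of_real t) r"
    "\<And>w. w \<in> ball (\<i> * of_real t) r \<Longrightarrow> Re w > 0 \<Longrightarrow> hecke_L k w = M w"
proof -
  define z where "z = \<i> * of_real t"
  obtain a where a: "twist k a z \<noteq> 1"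
    unfolding z_def using twist_neq_1[OF assms] .
  obtain A where A: "A holomorphic_on {w. Re w > -1}"
    "\<And>w. Re w > 0 \<Longrightarrow> hecke_L k w * (1 - twist k a w) = A w"
    using hecke_L_twist[of k a] by blast
  define S where "S = {w. Re w > -1} \<inter> {w. twist k a w \<noteq> 1}"
  have "open {w. twist k a w \<noteq> 1}"
    using holomorphic_on_imp_continuous_on[OF twist_holomorphic[of k a UNIV]]
    by (intro open_Collect_neq continuous_on_const) auto
  then have "open S"
    unfolding S_def by (intro open_Int open_halfspace_Re_gt)
  moreover have "z \<in> S"
    using a by (simp add: S_def z_def)
  ultimately obtain r where r: "r > 0" "ball z r \<subseteq> S"
    using open_contains_ball by blast
  show ?thesis
  proof (rule that[of r "\<lambda>w. A w / (1 - twist k a w)"])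
    show "(\<lambda>w. A w / (1 - twist k a w)) holomorphic_on ball (\<i> * of_real t) r"
      unfolding z_def[symmetric] using r(2)
      by (intro holomorphic_intros twist_holomorphic holomorphic_on_subset[OF A(1)]) (auto simp: S_def)
    show "hecke_L k w = A w / (1 - twist k a w)" if "w \<in> ball (\<i> * of_real t) r" "Re w > 0" for w
      using A(2)[OF that(2)] r(2) that(1) unfolding z_def[symmetric] by (auto simp: S_def field_simps)
  qed (rule r(1))
qed

text \<open>With a = 1 the factor is 1 - 2^(-w/2), which has a simple zero at 0; dividing by it
  costs at most a simple pole.\<close>

lemma hecke_L_0_continuation:
  obtains r M where "r > 0" "M holomorphic_on ball 0 r"
    "\<And>w. w \<in> ball 0 r \<Longrightarrow> Re w > 0 \<Longrightarrow> hecke_L 0 w = M w / w"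
proof -
  obtain A where A: "A holomorphic_on {w. Re w > -1}"
    "\<And>w. Re w > 0 \<Longrightarrow> hecke_L 0 w * (1 - twist 0 1 w) = A w"
    using hecke_L_twist[of 0 1] by blast
  define b where "b = (\<lambda>w. 1 - twist 0 1 w)"
  define g where "g = (\<lambda>w. if w = 0 then deriv b 0 else (b w - b 0) / (w - 0))"
  have "b holomorphic_on UNIV"
    unfolding b_def by (intro holomorphic_intros twist_holomorphic)
  then have g: "g holomorphic_on UNIV"
    unfolding g_def by (rule pole_lemma_open) simp
  have b0: "b 0 = 0"
    by (simp add: b_def twist_def)
  have bg: "b w = w * g w" for w
    by (simp add: g_def b0)
  have "(b has_field_derivative of_real (ln (sqrt 2))) (at 0)"
    unfolding b_def twist_def norm_of_int_plus_ii by (auto intro!: derivative_eq_intros)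
  then have g0: "g 0 \<noteq> 0"
    by (simp add: g_def DERIV_imp_deriv)
  define S where "S = {w. Re w > -1} \<inter> {w. g w \<noteq> 0}"
  have "open {w. g w \<noteq> 0}"
    using holomorphic_on_imp_continuous_on[OF g] by (intro open_Collect_neq continuous_on_const) auto
  then have "open S"
    unfolding S_def by (intro open_Int open_halfspace_Re_gt)
  moreover have "0 \<in> S"
    using g0 by (simp add: S_def)
  ultimately obtain r where r: "r > 0" "ball 0 r \<subseteq> S"
    using open_contains_ball by blast
  show ?thesis
  proof (rule that[of r "\<lambda>w. A w / g w"])
    show "(\<lambda>w. A w / g w) holomorphic_on ball 0 r"
      using r(2) by (intro holomorphic_intros holomorphic_on_subset[OF A(1)] holomorphic_on_subset[OF g]) (auto simp: S_def)
    show "hecke_L 0 w = A w / g w / w" if "w \<in> ball 0 r" "Re w > 0" for w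
    proof -
      have "hecke_L 0 w * (w * g w) = A w"
        using A(2)[OF that(2)] by (simp add: bg[symmetric]) (simp add: b_def)
      moreover have "g w \<noteq> 0" "w \<noteq> 0"
        using r(2) that by (auto simp: S_def)
      ultimately show ?thesis
        by (simp add: field_simps)
    qed
  qed (rule r(1))
qed

text \<open>The Lipschitz bound comes from the difference quotient at \<open>z\<close>, whose
  singularity is removable, so it too is bounded on a smaller disc.\<close>

lemma holomorphic_bounded_near:
  assumes "f holomorphic_on ball z r" "r > 0"
  obtains e C where "e > 0" "e \<le> r" "C > 0" "\<And>w. w \<in> ball z e \<Longrightarrow> norm (f w) \<le> C"
    "\<And>w. w \<in> ball z e \<Longrightarrow> norm (f w - f z) \<le> C * norm (w - z)"
proof -
  define g where "g = (\<lambda>w. if w = z then deriv f z else (f w - f z) / (w - z))"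
  have g: "g holomorphic_on ball z r"
    unfolding g_def using assms(1) by (rule pole_lemma_open) simp
  have sub: "cball z (r / 2) \<subseteq> ball z r"
    using assms(2) by auto
  have "bounded (h ` cball z (r / 2))" if "h holomorphic_on ball z r" for h :: "complex \<Rightarrow> complex"
    using that sub by (intro compact_imp_bounded compact_continuous_image compact_cball)
      (meson continuous_on_subset holomorphic_on_imp_continuous_on)
  from this[OF assms(1)] this[OF g] obtain C1 C2 where
    C: "\<And>w. w \<in> cball z (r / 2) \<Longrightarrow> norm (f w) \<le> C1" "\<And>w. w \<in> cball z (r / 2) \<Longrightarrow> norm (g w) \<le> C2"
    unfolding bounded_iff ball_simps(9) by metis
  define C where "C = max 1 (max C1 C2)"
  show ?thesis
  proof (rule that[of "r / 2" C])
    show "norm (f w) \<le> C" if "w \<in> ball z (r / 2)" for w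
      using C(1)[of w] that by (auto simp: C_def)
    show "norm (f w - f z) \<le> C * norm (w - z)" if "w \<in> ball z (r / 2)" for w
    proof -
      have "norm (f w - f z) = norm (g w) * norm (w - z)"
        by (simp add: g_def norm_divide)
      also have "\<dots> \<le> C * norm (w - z)"
        using C(2)[of w] that by (intro mult_right_mono) (auto simp: C_def)
      finally show ?thesis .
    qed
  qed (use assms(2) in \<open>auto simp: C_def\<close>)
qed

lemma hecke_L_0_le:
  obtains e C where "e > 0" "C > 0" "\<And>s. 0 < s \<Longrightarrow> s < e \<Longrightarrow> norm (hecke_L 0 (of_real s)) \<le> C / s"
proof -
  obtain r M where r: "r > 0" "M holomorphic_on ball 0 r"
    "\<And>w. w \<in> ball 0 r \<Longrightarrow> Re w > 0 \<Longrightarrow> hecke_L 0 w = M w / w"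
    using hecke_L_0_continuation by blast
  obtain e C where e: "e > 0" "e \<le> r" "C > 0" "\<And>w. w \<in> ball 0 e \<Longrightarrow> norm (M w) \<le> C"
    using holomorphic_bounded_near[OF r(2,1)] by metis
  show ?thesis
  proof (rule that[of e C])
    fix s :: real assume s: "0 < s" "s < e"
    have "norm (hecke_L 0 (of_real s)) = norm (M (of_real s)) / s"
      using s e(2) r(3)[of "of_real s"] by (simp add: norm_divide)
    also have "\<dots> \<le> C / s"
      using s e(4)[of "of_real s"] by (intro divide_right_mono) auto
    finally show "norm (hecke_L 0 (of_real s)) \<le> C / s" .
  qed (use e in auto)
qed

section \<open>Nonvanishing on the line\<close>

text \<open>A zero would bound the 3-4-1 product by (C0/s)^6 (C1 s)^8 C2^2 = K s^2, below its
  positive lower bound for small s. The third factor stays bounded because (2k, 2t) is again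
  nontrivial.\<close>

lemma continuation_nonzero:
  assumes k: "4 dvd k" and kt: "k \<noteq> 0 \<or> t \<noteq> 0"
    and M: "r > 0" "M holomorphic_on ball (\<i> * of_real t) r"
    "\<And>w. w \<in> ball (\<i> * of_real t) r \<Longrightarrow> Re w > 0 \<Longrightarrow> hecke_L k w = M w"
  shows "M (\<i> * of_real t) \<noteq> 0"
proof
  assume M0: "M (\<i> * of_real t) = 0"
  obtain c S where cS: "c > 0" "S > 0"
    "\<And>s. 0 < s \<Longrightarrow> s \<le> S \<Longrightarrow> c \<le> (norm (hecke_L 0 s)) ^ 6 * (norm (hecke_L k (Complex s t))) ^ 8
      * (norm (hecke_L (2 * k) (Complex s (2 * t)))) ^ 2"
    using hecke_L_three_four_one_lower_bound[OF k] by metis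
  obtain e0 C0 where e0: "e0 > 0" "C0 > 0" "\<And>s. 0 < s \<Longrightarrow> s < e0 \<Longrightarrow> norm (hecke_L 0 (of_real s)) \<le> C0 / s"
    using hecke_L_0_le by blast
  obtain e1 C1 where e1: "e1 > 0" "e1 \<le> r" "C1 > 0"
    "\<And>w. w \<in> ball (\<i> * of_real t) e1 \<Longrightarrow> norm (M w - M (\<i> * of_real t)) \<le> C1 * norm (w - \<i> * of_real t)"
    using holomorphic_bounded_near[OF M(2,1)] by metis
  have "4 dvd 2 * k" "2 * k \<noteq> 0 \<or> 2 * t \<noteq> 0"
    using k kt by auto
  then obtain r2 M2 where M2: "r2 > 0" "M2 holomorphic_on ball (\<i> * of_real (2 * t)) r2"
    "\<And>w. w \<in> ball (\<i> * of_real (2 * t)) r2 \<Longrightarrow> Re w > 0 \<Longrightarrow> hecke_L (2 * k) w = M2 w"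
    using hecke_L_continuation_on_line by metis
  obtain e2 C2 where e2: "e2 > 0" "e2 \<le> r2" "C2 > 0"
    "\<And>w. w \<in> ball (\<i> * of_real (2 * t)) e2 \<Longrightarrow> norm (M2 w) \<le> C2"
    using holomorphic_bounded_near[OF M2(2,1)] by metis
  define K where "K = C0 ^ 6 * C1 ^ 8 * C2 ^ 2"
  have K: "K > 0"
    using e0 e1 e2 by (simp add: K_def)
  \<comment> \<open>The bounds s \<le> 1 and s \<le> c / (2 K) force K s^2 \<le> c / 2; the others
    keep s within the range of each local estimate.\<close>
  define s where "s = min (min (S / 2) (e0 / 2)) (min (min (e1 / 2) (e2 / 2)) (min 1 (c / (2 * K))))"
  have s: "0 < s" "s \<le> S" "s < e0" "s < e1" "s < e2" "s \<le> 1" "s \<le> c / (2 * K)"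
    using cS e0 e1 e2 K by (auto simp: s_def)
  have w1: "Complex s t - \<i> * of_real t = of_real s" "Complex s (2 * t) - \<i> * of_real (2 * t) = of_real s"
    by (simp_all add: complex_eq_iff)
  have b1: "Complex s t \<in> ball (\<i> * of_real t) e1" "Complex s (2 * t) \<in> ball (\<i> * of_real (2 * t)) e2"
    using s w1 by (simp_all add: dist_norm norm_minus_commute)
  have n0: "norm (hecke_L 0 s) \<le> C0 / s"
    using e0(3) s by blast
  have "hecke_L k (Complex s t) = M (Complex s t)"
    using M(3) b1(1) e1(2) s(1) by auto
  also have "norm \<dots> \<le> C1 * s"
    using e1(4)[OF b1(1)] M0 w1(1) s(1) by simp
  finally have n1: "norm (hecke_L k (Complex s t)) \<le> C1 * s" .
  have n2: "norm (hecke_L (2 * k) (Complex s (2 * t))) \<le> C2"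
    using M2(3) b1(2) e2(2,4) s(1) by auto
  have "c \<le> (norm (hecke_L 0 s)) ^ 6 * (norm (hecke_L k (Complex s t))) ^ 8
      * (norm (hecke_L (2 * k) (Complex s (2 * t)))) ^ 2"
    by (rule cS(3)[OF s(1,2)])
  also have "\<dots> \<le> (C0 / s) ^ 6 * (C1 * s) ^ 8 * C2 ^ 2"
    using n0 n1 n2 e0(2) e1(3) s(1) by (intro mult_mono power_mono mult_nonneg_nonneg zero_le_power) auto
  also have "\<dots> = K * s\<^sup>2"
    using s(1) by (simp add: K_def power_divide power_mult_distrib field_simps flip: power_add)
  also have "\<dots> \<le> K * s"
    using s K by (intro mult_left_mono) (auto simp: power2_eq_square mult_le_cancel_left1)
  also have "\<dots> \<le> K * (c / (2 * K))"
    using s(7) K by (intro mult_left_mono) auto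
  also have "\<dots> = c / 2"
    using K by simp
  finally show False
    using cS(1) by simp
qed

text \<open>In the wedge 0 \<le> b < a the column at a holds a terms, each at least 1/(2 a^2), hence
  contributes at least 1/(2a): the harmonic series.\<close>

lemma gaussian_inverse_sq_not_summable:
  "\<not> (\<lambda>z. norm z powr - 2) summable_on gaussian_nz"
proof
  assume s: "(\<lambda>z. norm z powr - 2) summable_on gaussian_nz"
  define T where "T = Sigma {1::nat..} (\<lambda>a. {0..<a})"
  define \<phi> where "\<phi> = (\<lambda>(a, b). Complex (real a) (real b))"
  have "\<phi> ` T \<subseteq> gaussian_nz"
    by (auto simp: \<phi>_def T_def gaussian_integers_iff complex_eq_iff)
  then have "(\<lambda>z. norm z powr - 2) summable_on \<phi> ` T"
    using s summable_on_subset_banach by blast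
  moreover have "inj_on \<phi> T"
    by (auto simp: \<phi>_def inj_on_def)
  ultimately have "(\<lambda>(a, b). norm (Complex (real a) (real b)) powr - 2) summable_on T"
    by (subst (asm) summable_on_reindex) (auto simp: \<phi>_def o_def case_prod_unfold)
  then have "(\<lambda>a. \<Sum>\<^sub>\<infinity>b\<in>{0..<a}. norm (Complex (real a) (real b)) powr - 2) summable_on {1..}"
    unfolding T_def by (rule summable_on_Sigma_banach)
  then have "(\<lambda>a. 1 / (2 * real a)) summable_on {1..}"
  proof (rule summable_on_comparison_test)
    fix a :: nat assume a: "a \<in> {1..}"
    have "1 / (2 * real a) = (\<Sum>b\<in>{0..<a}. 1 / (2 * (real a)\<^sup>2))"
      using a by (simp add: power2_eq_square)
    also have "\<dots> \<le> (\<Sum>b\<in>{0..<a}. norm (Complex (real a) (real b)) powr - 2)"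
    proof (rule sum_mono)
      fix b assume b: "b \<in> {0..<a}"
      define n where "n = norm (Complex (real a) (real b))"
      have n: "n > 0"
        using a by (simp add: n_def complex_eq_iff)
      have "(real b)\<^sup>2 \<le> (real a)\<^sup>2"
        using b by (intro power_mono) auto
      then have "n\<^sup>2 \<le> 2 * (real a)\<^sup>2"
        unfolding n_def by (simp add: cmod_power2)
      then have "1 / (2 * (real a)\<^sup>2) \<le> 1 / n\<^sup>2"
        using n a by (intro divide_left_mono) auto
      also have "\<dots> = n powr - 2"
        using n by (simp add: powr_minus powr_numeral field_simps)
      finally show "1 / (2 * (real a)\<^sup>2) \<le> norm (Complex (real a) (real b)) powr - 2"
        by (simp add: n_def)
    qed
    also have "\<dots> = (\<Sum>\<^sub>\<infinity>b\<in>{0..<a}. norm (Complex (real a) (real b)) powr - 2)"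
      by simp
    finally show "1 / (2 * real a) \<le> (\<Sum>\<^sub>\<infinity>b\<in>{0..<a}. norm (Complex (real a) (real b)) powr - 2)" .
  qed auto
  then have "(\<lambda>a. 2 * (1 / (2 * real a))) summable_on insert 0 {1..}"
    unfolding summable_on_insert_iff by (rule summable_on_cmult_right)
  moreover have "insert 0 {1..} = (UNIV :: nat set)"
    by auto
  ultimately have "summable (\<lambda>a. inverse (real a))"
    by (simp add: summable_on_imp_summable inverse_eq_divide)
  then show False
    using not_summable_harmonic[where 'a = real] by simp
qed

text \<open>If M vanished at 0, the L-series would stay bounded as s decreases to 0. Its terms are
  positive, so all finite sums of |z|^(-2) would obey the same bound, contradicting
  divergence.\<close>

lemma continuation_0_nonzero:
  assumes M: "r > 0" "M holomorphic_on ball 0 r"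
    "\<And>w. w \<in> ball 0 r \<Longrightarrow> Re w > 0 \<Longrightarrow> hecke_L 0 w = M w / w"
  shows "M 0 \<noteq> 0"
proof
  assume M0: "M 0 = 0"
  obtain e C where e: "e > 0" "e \<le> r" "C > 0" "\<And>w. w \<in> ball 0 e \<Longrightarrow> norm (M w - M 0) \<le> C * norm (w - 0)"
    using holomorphic_bounded_near[OF M(2,1)] by metis
  have fin: "(\<Sum>z\<in>X. norm z powr - 2) \<le> C" if X: "finite X" "X \<subseteq> gaussian_nz" for X
  proof -
    have le: "(\<Sum>z\<in>X. norm z powr - (2 + s)) \<le> C" if s: "0 < s" "s < e" for s
    proof -
      have hs: "((\<lambda>z. Re (hecke 0 s z)) has_sum Re (hecke_L 0 s)) gaussian_nz"
        unfolding hecke_L_def using s by (intro has_sum_Re has_sum_infsum hecke_summable) auto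
      have eq: "Re (hecke 0 s z) = norm z powr - (2 + s)" if "z \<noteq> 0" for z
      proof -
        have "hecke 0 s z = of_real (exp (- (2 + s) * ln (norm z)))"
          by (simp add: hecke_def exp_of_real[symmetric])
        then show ?thesis
          using that by (simp add: powr_def)
      qed
      have "(\<Sum>z\<in>X. norm z powr - (2 + s)) = (\<Sum>z\<in>X. Re (hecke 0 s z))"
        using X eq by (intro sum.cong refl) (metis DiffD2 insertI1 subsetD)
      also have "\<dots> \<le> Re (hecke_L 0 s)"
        by (rule finite_sum_le_has_sum[OF hs X]) (auto simp: eq)
      also have "\<dots> \<le> norm (hecke_L 0 s)"
        by (rule complex_Re_le_cmod)
      also have "\<dots> = norm (M s) / s"
        using M(3)[of "of_real s"] s e(2) by (simp add: norm_divide)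
      also have "\<dots> \<le> C * s / s"
        using e(4)[of "of_real s"] s M0 by (intro divide_right_mono) auto
      finally show ?thesis
        using s by simp
    qed
    have "((\<lambda>s. \<Sum>z\<in>X. norm z powr - (2 + s)) \<longlongrightarrow> (\<Sum>z\<in>X. norm z powr - (2 + 0))) (at_right 0)"
      using X by (intro tendsto_intros) auto
    moreover have "\<forall>\<^sub>F s in at_right 0. (\<Sum>z\<in>X. norm z powr - (2 + s)) \<le> C"
      using eventually_at_right_real[OF e(1)] by (rule eventually_mono) (intro le, auto)
    ultimately show ?thesis
      using tendsto_upperbound[of _ _ "at_right (0::real)" C] by fastforce
  qed
  have "(\<lambda>z. norm z powr - 2) summable_on gaussian_nz"
    by (rule nonneg_bdd_above_summable_on) (auto intro!: bdd_aboveI2[of _ _ C] fin)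
  then show False
    using gaussian_inverse_sq_not_summable by blast
qed

section \<open>Prime sums near the line\<close>

lemma log_deriv_bounded_near:
  assumes "r > 0" "M holomorphic_on ball z r" "M z \<noteq> 0"
  obtains e C where "e > 0" "e \<le> r" "\<And>w. w \<in> ball z e \<Longrightarrow> M w \<noteq> 0 \<and> norm (deriv M w / M w) \<le> C"
proof -
  have cont: "continuous_on (ball z r) M"
    using assms(2) by (rule holomorphic_on_imp_continuous_on)
  have "open (ball z r \<inter> M -` (- {0}))"
    by (rule continuous_open_preimage[OF cont]) auto
  moreover have "z \<in> ball z r \<inter> M -` (- {0})"
    using assms by simp
  ultimately obtain d where d: "d > 0" "ball z d \<subseteq> ball z r \<inter> M -` (- {0})"
    using open_contains_ball by blast
  have Mz: "M w \<noteq> 0" if "w \<in> ball z d" for w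
    using d(2) that by auto
  have Mh: "M holomorphic_on ball z d"
    using assms(2) by (rule holomorphic_on_subset) (use d in auto)
  have "(\<lambda>w. deriv M w / M w) holomorphic_on ball z d"
    using Mz by (intro holomorphic_intros holomorphic_deriv Mh) auto
  from holomorphic_bounded_near[OF this d(1)] obtain e C where
    e: "e > 0" "e \<le> d" "\<And>w. w \<in> ball z e \<Longrightarrow> norm (deriv M w / M w) \<le> C"
    by metis
  define e' where "e' = min e r"
  have "M w \<noteq> 0 \<and> norm (deriv M w / M w) \<le> C" if "w \<in> ball z e'" for w
    using e(2,3) Mz that by (auto simp: e'_def)
  then show ?thesis
    using that[of e' C] e assms(1) by (auto simp: e'_def)
qed

lemma hecke_Lambda_eq:
  assumes "Re w > 0" "open U" "w \<in> U" "M holomorphic_on U" "M w \<noteq> 0"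
    "\<And>x. x \<in> U \<Longrightarrow> Re x > 0 \<Longrightarrow> hecke_L k x = M x"
  shows "hecke_Lambda k w = - 4 * (deriv M w / M w)"
proof -
  define V where "V = U \<inter> {x. Re x > 0}"
  have V: "open V" "w \<in> V"
    unfolding V_def using assms by (auto intro: open_halfspace_Re_gt)
  have "(M has_field_derivative - (hecke_Lambda k w * hecke_L k w / 4)) (at w)"
    using hecke_L_has_field_derivative[OF assms(1)] V(1,2)
    by (rule has_field_derivative_transform_within_open) (use assms in \<open>auto simp: V_def\<close>)
  then have "deriv M w = - (hecke_Lambda k w * M w / 4)"
    using DERIV_imp_deriv assms by metis
  then show ?thesis
    using assms(5) by (simp add: field_simps)
qed

text \<open>If 4 divides k, the nonvanishing continuation has a bounded logarithmic derivative and
  prime powers change it boundedly; otherwise the sum is 0.\<close>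

lemma hecke_D_locally_bounded:
  assumes kt: "k \<noteq> 0 \<or> t \<noteq> 0"
  obtains e C where "e > 0" "\<And>w. w \<in> ball (\<i> * of_real t) e \<Longrightarrow> Re w > 0 \<Longrightarrow> norm (hecke_D k w) \<le> C"
proof (cases "4 dvd k")
  case False
  show ?thesis
    by (rule that[of 1 0]) (auto simp: hecke_D_eq_0[OF False])
next
  case True
  obtain C0 where C0: "\<And>k w. Re w > 0 \<Longrightarrow> norm (hecke_Lambda k w - hecke_D k w) \<le> C0"
    using hecke_Lambda_minus_D_bounded by blast
  obtain r M where M: "r > 0" "M holomorphic_on ball (\<i> * of_real t) r"
    "\<And>w. w \<in> ball (\<i> * of_real t) r \<Longrightarrow> Re w > 0 \<Longrightarrow> hecke_L k w = M w"
    using hecke_L_continuation_on_line[OF True kt] by metis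
  have "M (\<i> * of_real t) \<noteq> 0"
    by (rule continuation_nonzero[OF True kt M])
  then obtain e C where e: "e > 0" "e \<le> r"
    "\<And>w. w \<in> ball (\<i> * of_real t) e \<Longrightarrow> M w \<noteq> 0 \<and> norm (deriv M w / M w) \<le> C"
    using log_deriv_bounded_near[OF M(1,2)] by metis
  show ?thesis
  proof (rule that[OF e(1)])
    fix w assume w: "w \<in> ball (\<i> * of_real t) e" "Re w > 0"
    have "hecke_Lambda k w = - 4 * (deriv M w / M w)"
      by (rule hecke_Lambda_eq[of w "ball (\<i> * of_real t) r" M]) (use w e M in auto)
    then have "norm (hecke_Lambda k w) = 4 * norm (deriv M w / M w)"
      by (simp add: norm_mult norm_divide)
    then have "norm (hecke_Lambda k w) \<le> 4 * C"
      using e(3)[OF w(1)] by simp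
    then show "norm (hecke_D k w) \<le> 4 * C + C0"
      using C0[OF w(2), of k] norm_triangle_ineq2[of "hecke_D k w" "hecke_Lambda k w"]
      by (simp add: norm_minus_commute)
  qed
qed

text \<open>The logarithmic derivative of M w / w has residue -1 because M is nonzero at 0; the
  factor -4 turns this into 4.\<close>

lemma hecke_D_0_near_pole:
  obtains e C where "e > 0" "\<And>w. w \<in> ball 0 e \<Longrightarrow> Re w > 0 \<Longrightarrow> norm (hecke_D 0 w - 4 / w) \<le> C"
proof -
  obtain C0 where C0: "\<And>k w. Re w > 0 \<Longrightarrow> norm (hecke_Lambda k w - hecke_D k w) \<le> C0"
    using hecke_Lambda_minus_D_bounded by blast
  obtain r M where M: "r > 0" "M holomorphic_on ball 0 r"
    "\<And>w. w \<in> ball 0 r \<Longrightarrow> Re w > 0 \<Longrightarrow> hecke_L 0 w = M w / w"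
    using hecke_L_0_continuation by blast
  have "M 0 \<noteq> 0"
    by (rule continuation_0_nonzero[OF M])
  then obtain e C where e: "e > 0" "e \<le> r"
    "\<And>w. w \<in> ball 0 e \<Longrightarrow> M w \<noteq> 0 \<and> norm (deriv M w / M w) \<le> C"
    using log_deriv_bounded_near[OF M(1,2)] by metis
  show ?thesis
  proof (rule that[OF e(1)])
    fix w :: complex assume w: "w \<in> ball 0 e" "Re w > 0"
    then have w0: "w \<noteq> 0"
      by auto
    define U where "U = ball 0 r \<inter> {x. Re x > 0}"
    have U: "open U" "w \<in> U"
      unfolding U_def using w e by (auto intro: open_halfspace_Re_gt)
    have MU: "M holomorphic_on U" "0 \<notin> U"
      unfolding U_def using holomorphic_on_subset[OF M(2)] by auto
    have Mw: "M w \<noteq> 0"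
      using e(3)[OF w(1)] by blast
    have "(M has_field_derivative deriv M w) (at w)"
      using holomorphic_derivI[OF MU(1) U] .
    then have "((\<lambda>x. M x / x) has_field_derivative (deriv M w * w - M w) / (w * w)) (at w)"
      using w0 by (auto intro!: derivative_eq_intros)
    then have d: "deriv (\<lambda>x. M x / x) w = (deriv M w * w - M w) / (w * w)"
      by (rule DERIV_imp_deriv)
    have "hecke_Lambda 0 w = - 4 * (deriv (\<lambda>x. M x / x) w / (M w / w))"
      by (rule hecke_Lambda_eq[of w U])
        (use w U MU Mw w0 M(3) in \<open>auto intro!: holomorphic_intros simp: U_def\<close>)
    also have "\<dots> = 4 / w - 4 * (deriv M w / M w)"
      unfolding d using w0 Mw by (simp add: field_simps)
    finally have "norm (hecke_Lambda 0 w - 4 / w) = 4 * norm (deriv M w / M w)"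
      by (simp add: norm_mult norm_divide)
    then have "norm (hecke_Lambda 0 w - 4 / w) \<le> 4 * C"
      using e(3)[OF w(1)] by simp
    moreover have "hecke_D 0 w - 4 / w = (hecke_Lambda 0 w - 4 / w) - (hecke_Lambda 0 w - hecke_D 0 w)"
      by simp
    ultimately show "norm (hecke_D 0 w - 4 / w) \<le> 4 * C + C0"
      unfolding \<open>hecke_D 0 w - 4 / w = _\<close> using C0[OF w(2), of 0] norm_triangle_ineq4[of "hecke_Lambda 0 w - 4 / w" "hecke_Lambda 0 w - hecke_D 0 w"]
      by linarith
  qed
qed

section \<open>A mean square functional\<close>

text \<open>A finite subcover by half-radius intervals leaves the other half of the radius for s, so
  s + it lies in the full disc of some centre.\<close>

lemma hecke_D_bounded_on_compact:
  assumes T: "compact T" and kt: "\<And>t. t \<in> T \<Longrightarrow> k \<noteq> 0 \<or> t \<noteq> 0"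
  obtains s0 B where "s0 > 0" "B \<ge> 0"
    "\<And>s t. 0 < s \<Longrightarrow> s < s0 \<Longrightarrow> t \<in> T \<Longrightarrow> norm (hecke_D k (Complex s t)) \<le> B"
proof -
  have "\<forall>t\<in>T. \<exists>e>0. \<exists>C. \<forall>w. w \<in> ball (\<i> * of_real t) e \<longrightarrow> Re w > 0 \<longrightarrow> norm (hecke_D k w) \<le> C"
    using hecke_D_locally_bounded kt by metis
  then obtain e C where e: "\<And>t. t \<in> T \<Longrightarrow> e t > (0::real)"
    and C: "\<And>t w. t \<in> T \<Longrightarrow> w \<in> ball (\<i> * of_real t) (e t) \<Longrightarrow> Re w > 0 \<Longrightarrow> norm (hecke_D k w) \<le> C t"
    by metis
  have "T \<subseteq> (\<Union>t\<in>T. ball t (e t / 2))"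
    using e by force
  then obtain F where F: "F \<subseteq> T" "finite F" "T \<subseteq> (\<Union>t\<in>F. ball t (e t / 2))"
    using compactE_image[OF T, of T "\<lambda>t. ball t (e t / 2)"] by (metis open_ball)
  define s0 where "s0 = Min (insert 1 ((\<lambda>t. e t / 2) ` F))"
  define B where "B = Max (insert 0 (C ` F))"
  show ?thesis
  proof (rule that[of s0 B])
    show "s0 > 0"
      unfolding s0_def using F e by (subst Min_gr_iff) auto
    show "B \<ge> 0"
      unfolding B_def using F by (intro Max_ge) auto
    fix s t assume s: "0 < s" "s < s0" and t: "t \<in> T"
    obtain u where u: "u \<in> F" "dist u t < e u / 2"
      using F(3) t by auto
    have "s < e u / 2"
      using s(2) F(2) u(1) unfolding s0_def by auto
    moreover have "dist (\<i> * of_real u) (Complex s t) \<le> s + dist u t"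
    proof -
      have "\<i> * of_real u - Complex s t = Complex (- s) (u - t)"
        by (simp add: complex_eq_iff)
      then show ?thesis
        using cmod_le[of "Complex (- s) (u - t)"] s(1) by (simp add: dist_norm)
    qed
    ultimately have "Complex s t \<in> ball (\<i> * of_real u) (e u)"
      using u(2) by simp
    then have "norm (hecke_D k (Complex s t)) \<le> C u"
      using C[of u] u(1) F(1) s(1) by auto
    also have "\<dots> \<le> B"
      unfolding B_def using F(2) u(1) by (intro Max_ge) auto
    finally show "norm (hecke_D k (Complex s t)) \<le> B" .
  qed
qed

text \<open>Apart from a positive weight, the product depends only on the quotient p / q.\<close>

lemma hecke_mult_cnj_hecke:
  assumes "p \<noteq> 0" "q \<noteq> 0"
  shows "hecke k (Complex s t) p * cnj (hecke k (Complex s t) q) =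
    of_real (norm p powr - (2 + s) * norm q powr - (2 + s)) *
      (exp (- (\<i> * of_real (t * ln (norm (p / q))))) * sgn (p / q) powi k)"
proof -
  define a b where "a = ln (norm p)" and "b = ln (norm q)"
  have e: "exp (- (2 + Complex s t) * of_real x) = of_real (exp (- (2 + s) * x)) * exp (- (\<i> * of_real (t * x)))" for x
    by (simp add: exp_of_real[symmetric] mult_exp_exp Complex_eq algebra_simps)
  have "hecke k (Complex s t) p = sgn p powi k * (of_real (norm p powr - (2 + s)) * exp (- (\<i> * of_real (t * a))))"
    unfolding hecke_def e a_def using assms by (simp add: powr_def)
  moreover have "hecke k (Complex s t) q = sgn q powi k * (of_real (norm q powr - (2 + s)) * exp (- (\<i> * of_real (t * b))))"
    unfolding hecke_def e b_def using assms by (simp add: powr_def)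
  moreover have "cnj (sgn q powi k) = inverse (sgn q) powi k"
  proof -
    have "inverse (sgn q) = cnj (sgn q)"
      using assms by (intro inverse_unique) (simp add: complex_norm_square[symmetric] norm_sgn)
    then show ?thesis
      by (simp add: complex_cnj_power_int)
  qed
  moreover have "cnj (exp (- (\<i> * of_real (t * b)))) = exp (\<i> * of_real (t * b))"
    by (simp add: exp_cnj)
  moreover have "exp (- (\<i> * of_real (t * a))) * exp (\<i> * of_real (t * b)) = exp (- (\<i> * of_real (t * ln (norm (p / q)))))"
    using assms by (simp add: a_def b_def mult_exp_exp norm_divide ln_divide_pos algebra_simps)
  moreover have "sgn p powi k * inverse (sgn q) powi k = sgn (p / q) powi k"
    by (simp add: divide_inverse sgn_mult power_int_mult_distrib sgn_inverse)
  ultimately show ?thesis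
    by (simp add: mult_ac)
qed

text \<open>The modulus of each term depends neither on t nor on k, so the absolutely convergent
  series for k = 0, t = 0 is a majorant for all of them.\<close>

lemma continuous_on_hecke_D:
  assumes "s > 0"
  shows "continuous_on A (\<lambda>t. hecke_D k (Complex s t))"
    and "uniform_limit A (\<lambda>X t. \<Sum>p\<in>X. ln (norm p) * hecke k (Complex s t) p)
      (\<lambda>t. hecke_D k (Complex s t)) (finite_subsets_at_top {p. gaussian_prime p})"
    and "bounded ((\<lambda>t. hecke_D k (Complex s t)) ` A)"
proof -
  let ?h = "\<lambda>p. norm (ln (norm p) * hecke 0 (of_real s) p)"
  have h: "?h summable_on {p. gaussian_prime p}"
    using hecke_D_summable[of "of_real s" 0] assms
    by (simp only: Infinite_Sum.summable_on_iff_abs_summable_on_complex Re_complex_of_real)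
  have le: "norm (ln (norm p) * hecke k (Complex s t) p) \<le> ?h p" if "gaussian_prime p" for p t
    using that by (auto simp: norm_mult norm_hecke gaussian_prime_def)
  show ul: "uniform_limit A (\<lambda>X t. \<Sum>p\<in>X. ln (norm p) * hecke k (Complex s t) p)
      (\<lambda>t. hecke_D k (Complex s t)) (finite_subsets_at_top {p. gaussian_prime p})"
    unfolding hecke_D_def using h le by (intro Weierstrass_m_test_infsum) auto
  show "continuous_on A (\<lambda>t. hecke_D k (Complex s t))"
    by (rule uniform_limit_theorem[OF _ ul])
      (auto intro!: always_eventually continuous_intros simp: hecke_def Complex_eq)
  show "bounded ((\<lambda>t. hecke_D k (Complex s t)) ` A)"
    unfolding bounded_iff hecke_D_def
  proof (intro exI ballI)
    fix x assume "x \<in> (\<lambda>t. \<Sum>\<^sub>\<infinity>p\<in>{p. gaussian_prime p}. ln (norm p) * hecke k (Complex s t) p) ` A"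
    then obtain t where t: "x = (\<Sum>\<^sub>\<infinity>p\<in>{p. gaussian_prime p}. ln (norm p) * hecke k (Complex s t) p)"
      by blast
    have "(\<lambda>p. ln (norm p) * hecke k (Complex s t) p) summable_on {p. gaussian_prime p}"
      using assms by (intro hecke_D_summable) simp
    then show "norm x \<le> infsum ?h {p. gaussian_prime p}"
      unfolding t by (rule norm_infsum_le[OF has_sum_infsum has_sum_infsum[OF h]]) (use le in auto)
  qed
qed

text \<open>For a finite set \<open>X\<close> of primes the squared modulus expands over pairs, and
  each pair puts a nonnegative weight on a sum assumed nonpositive. For fixed s > 0 the partial sums
  converge uniformly in t, so the sign survives the limit.\<close>

lemma integral_weighted_hecke_D_nonpos:
  fixes g :: "int \<Rightarrow> real \<Rightarrow> complex"
  assumes S: "finite S" and cont: "\<And>k. k \<in> S \<Longrightarrow> continuous_on {-R..R} (g k)"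
    and neg: "\<And>p q. gaussian_prime p \<Longrightarrow> gaussian_prime q \<Longrightarrow>
      (\<Sum>k\<in>S. integral {-R..R} (\<lambda>t. Re (g k t * (exp (- (\<i> * of_real (t * ln (norm (p / q))))) * sgn (p / q) powi k)))) \<le> 0"
    and s: "s > 0"
  shows "(\<Sum>k\<in>S. integral {-R..R} (\<lambda>t. Re (g k t) * (norm (hecke_D k (Complex s t)))\<^sup>2)) \<le> 0"
proof -
  define P where "P = {p. gaussian_prime p}"
  define D where "D = (\<lambda>X k t. \<Sum>p\<in>X. ln (norm p) * hecke k (Complex s t) p)"
  define I where "I = (\<lambda>X k. integral {-R..R} (\<lambda>t. Re (g k t) * (norm (D X k t))\<^sup>2))"
  define \<omega> where "\<omega> = (\<lambda>p::complex. ln (norm p) * norm p powr - (2 + s))"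
  define \<kappa> where "\<kappa> = (\<lambda>p q k t. exp (- (\<i> * of_real (t * ln (norm (p / q :: complex))))) * sgn (p / q) powi k)"
  have contD: "continuous_on {-R..R} (D X k)" for X k
    unfolding D_def hecke_def Complex_eq by (intro continuous_intros)
  have cont\<kappa>: "continuous_on {-R..R} (\<kappa> p q k)" for p q k
    unfolding \<kappa>_def by (intro continuous_intros)
  have lim: "((\<lambda>X. I X k) \<longlongrightarrow> integral {-R..R} (\<lambda>t. Re (g k t) * (norm (hecke_D k (Complex s t)))\<^sup>2))
      (finite_subsets_at_top P)" if k: "k \<in> S" for k
  proof -
    have bd: "bounded ((\<lambda>t. norm (hecke_D k (Complex s t))) ` {-R..R})"
      using continuous_on_hecke_D(3)[OF s, of k "{-R..R}"] by (auto simp: bounded_iff)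
    have "bounded ((\<lambda>t. (norm (hecke_D k (Complex s t)))\<^sup>2) ` {-R..R})"
      using continuous_on_hecke_D(1)[OF s, of "{-R..R}" k]
      by (intro compact_imp_bounded compact_continuous_image continuous_intros) auto
    moreover have "bounded ((\<lambda>t. Re (g k t)) ` {-R..R})"
      using cont[OF k] by (intro compact_imp_bounded compact_continuous_image continuous_intros) auto
    moreover have "uniform_limit {-R..R} (\<lambda>X t. (norm (D X k t))\<^sup>2) (\<lambda>t. (norm (hecke_D k (Complex s t)))\<^sup>2) (finite_subsets_at_top P)"
      unfolding power2_eq_square D_def P_def
      by (intro uniform_lim_mult uniform_limit_norm continuous_on_hecke_D(2)[OF s] bd)
    ultimately have "uniform_limit {-R..R} (\<lambda>X t. Re (g k t) * (norm (D X k t))\<^sup>2)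
        (\<lambda>t. Re (g k t) * (norm (hecke_D k (Complex s t)))\<^sup>2) (finite_subsets_at_top P)"
      by (intro uniform_lim_mult uniform_limit_const)
    then obtain I' J where IJ: "\<And>X. ((\<lambda>t. Re (g k t) * (norm (D X k t))\<^sup>2) has_integral I' X) {-R..R}"
      "((\<lambda>t. Re (g k t) * (norm (hecke_D k (Complex s t)))\<^sup>2) has_integral J) {-R..R}"
      "(I' \<longlongrightarrow> J) (finite_subsets_at_top P)"
      by (rule uniform_limit_integral) (auto intro!: continuous_intros cont[OF k] contD)
    then show ?thesis
      unfolding I_def using integral_unique by (metis (no_types, lifting) ext)
  qed
  have nonpos: "(\<Sum>k\<in>S. I X k) \<le> 0" if X: "finite X" "X \<subseteq> P" for X
  proof -
    have Xnz: "p \<noteq> 0" "ln (norm p) \<ge> 0" if "p \<in> X" for p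
      using that X gaussian_prime_norm_gt_1[of p] by (auto simp: P_def gaussian_prime_def)
    have DX: "Re (g k t) * (norm (D X k t))\<^sup>2 = (\<Sum>p\<in>X. \<Sum>q\<in>X. \<omega> p * \<omega> q * Re (g k t * \<kappa> p q k t))" for k t
    proof -
      have "of_real ((norm (D X k t))\<^sup>2) = D X k t * cnj (D X k t)"
        by (rule complex_norm_square)
      also have "\<dots> = (\<Sum>p\<in>X. \<Sum>q\<in>X. (ln (norm p) * hecke k (Complex s t) p) * cnj (ln (norm q) * hecke k (Complex s t) q))"
        unfolding D_def cnj_sum sum_product ..
      also have "\<dots> = (\<Sum>p\<in>X. \<Sum>q\<in>X. of_real (\<omega> p * \<omega> q) * \<kappa> p q k t)"
      proof (intro sum.cong refl)
        fix p q assume "p \<in> X" "q \<in> X"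
        then have "hecke k (Complex s t) p * cnj (hecke k (Complex s t) q) =
            of_real (norm p powr - (2 + s) * norm q powr - (2 + s)) * \<kappa> p q k t"
          unfolding \<kappa>_def using Xnz by (intro hecke_mult_cnj_hecke) auto
        then show "(ln (norm p) * hecke k (Complex s t) p) * cnj (ln (norm q) * hecke k (Complex s t) q)
            = of_real (\<omega> p * \<omega> q) * \<kappa> p q k t"
          by (simp add: \<omega>_def mult_ac)
      qed
      finally have "of_real ((norm (D X k t))\<^sup>2) = (\<Sum>p\<in>X. \<Sum>q\<in>X. of_real (\<omega> p * \<omega> q) * \<kappa> p q k t)" .
      then have "Re (of_real ((norm (D X k t))\<^sup>2) * g k t) = Re ((\<Sum>p\<in>X. \<Sum>q\<in>X. of_real (\<omega> p * \<omega> q) * \<kappa> p q k t) * g k t)"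
        by (rule arg_cong)
      also have "\<dots> = (\<Sum>p\<in>X. \<Sum>q\<in>X. Re (of_real (\<omega> p * \<omega> q) * (\<kappa> p q k t * g k t)))"
        by (simp only: sum_distrib_right Re_sum mult.assoc)
      also have "\<dots> = (\<Sum>p\<in>X. \<Sum>q\<in>X. \<omega> p * \<omega> q * Re (g k t * \<kappa> p q k t))"
        by (simp only: Re_complex_of_real Im_complex_of_real times_complex.sel(1)[of "of_real _"]
            mult_zero_left diff_zero mult.commute[of "\<kappa> _ _ _ _"])
      finally show ?thesis
        by (simp add: mult.commute)
    qed
    have "I X k = (\<Sum>p\<in>X. \<Sum>q\<in>X. \<omega> p * \<omega> q * integral {-R..R} (\<lambda>t. Re (g k t * \<kappa> p q k t)))" if k: "k \<in> S" for k
    proof -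
      have int: "(\<lambda>t. \<omega> p * \<omega> q * Re (g k t * \<kappa> p q k t)) integrable_on {-R..R}" for p q
        by (intro integrable_continuous_interval continuous_intros cont[OF k] cont\<kappa>)
      show ?thesis
        unfolding I_def DX using X(1) int by (simp add: integral_sum integrable_sum)
    qed
    then have "(\<Sum>k\<in>S. I X k) = (\<Sum>k\<in>S. \<Sum>p\<in>X. \<Sum>q\<in>X. \<omega> p * \<omega> q * integral {-R..R} (\<lambda>t. Re (g k t * \<kappa> p q k t)))"
      by simp
    also have "\<dots> = (\<Sum>p\<in>X. \<Sum>k\<in>S. \<Sum>q\<in>X. \<omega> p * \<omega> q * integral {-R..R} (\<lambda>t. Re (g k t * \<kappa> p q k t)))"
      by (rule sum.swap)
    also have "\<dots> = (\<Sum>p\<in>X. \<Sum>q\<in>X. \<Sum>k\<in>S. \<omega> p * \<omega> q * integral {-R..R} (\<lambda>t. Re (g k t * \<kappa> p q k t)))"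
      by (intro sum.cong refl sum.swap)
    also have "\<dots> = (\<Sum>p\<in>X. \<Sum>q\<in>X. \<omega> p * \<omega> q * (\<Sum>k\<in>S. integral {-R..R} (\<lambda>t. Re (g k t * \<kappa> p q k t))))"
      by (simp add: sum_distrib_left)
    also have "\<dots> \<le> 0"
    proof (intro sum_nonpos)
      fix p q assume pq: "p \<in> X" "q \<in> X"
      then have "0 \<le> \<omega> p * \<omega> q"
        using Xnz by (simp add: \<omega>_def)
      moreover have "(\<Sum>k\<in>S. integral {-R..R} (\<lambda>t. Re (g k t * \<kappa> p q k t))) \<le> 0"
        unfolding \<kappa>_def using neg[of p q] pq X(2) by (auto simp: P_def)
      ultimately show "\<omega> p * \<omega> q * (\<Sum>k\<in>S. integral {-R..R} (\<lambda>t. Re (g k t * \<kappa> p q k t))) \<le> 0"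
        by (rule mult_nonneg_nonpos)
    qed
    finally show ?thesis .
  qed
  have "((\<lambda>X. \<Sum>k\<in>S. I X k) \<longlongrightarrow> (\<Sum>k\<in>S. integral {-R..R} (\<lambda>t. Re (g k t) * (norm (hecke_D k (Complex s t)))\<^sup>2)))
      (finite_subsets_at_top P)"
    by (intro tendsto_sum lim)
  moreover have "\<forall>\<^sub>F X in finite_subsets_at_top P. (\<Sum>k\<in>S. I X k) \<le> 0"
    by (rule eventually_finite_subsets_at_top_weakI) (rule nonpos)
  ultimately show ?thesis
    by (rule tendsto_upperbound) simp
qed

text \<open>As $s \to 0^+$ the integral of \<^term>\<open>g 0 t * (norm (hecke_D 0 (Complex s t)))\<^sup>2\<close> is dominated by
  the double pole at $t = 0$, of size $16 / (s^2 + t^2)$; everything else stays bounded.\<close>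

lemma hecke_D_mean_square_functional:
  fixes g :: "int \<Rightarrow> real \<Rightarrow> complex"
  assumes S: "finite S" "0 \<in> S" and R: "R > 0" and cont: "\<And>k. k \<in> S \<Longrightarrow> continuous_on {-R..R} (g k)"
    and neg: "\<And>p q. gaussian_prime p \<Longrightarrow> gaussian_prime q \<Longrightarrow>
      (\<Sum>k\<in>S. integral {-R..R} (\<lambda>t. Re (g k t * (exp (- (\<i> * of_real (t * ln (norm (p / q))))) * sgn (p / q) powi k)))) \<le> 0"
  shows "Re (g 0 0) \<le> 0"
proof (rule ccontr)
  assume "\<not> Re (g 0 0) \<le> 0"
  define m where "m = Re (g 0 0) / 2"
  have m: "m > 0" "m < Re (g 0 0)"
    using \<open>\<not> _\<close> by (auto simp: m_def)
  have "\<exists>\<eta>>0. \<eta> \<le> R \<and> (\<forall>t. \<bar>t\<bar> < \<eta> \<longrightarrow> m < Re (g 0 t))"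
  proof -
    have "continuous (at 0 within {-R..R}) (\<lambda>t. Re (g 0 t))"
      using continuous_on_Re[OF cont[OF S(2)]] R by (auto simp: continuous_on_eq_continuous_within)
    then have "((\<lambda>t. Re (g 0 t)) \<longlongrightarrow> Re (g 0 0)) (at 0 within {-R..R})"
      by (simp add: continuous_within)
    then have "\<forall>\<^sub>F t in at 0 within {-R..R}. m < Re (g 0 t)"
      using m(2) by (rule order_tendstoD)
    then obtain d where d: "d > 0" "\<And>t. t \<in> {-R..R} \<Longrightarrow> t \<noteq> 0 \<Longrightarrow> dist t 0 < d \<Longrightarrow> m < Re (g 0 t)"
      unfolding eventually_at by blast
    have "m < Re (g 0 t)" if "\<bar>t\<bar> < min d R" for t
      using d(2)[of t] m(2) that by (cases "t = 0") (auto simp: abs_less_iff)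
    then show ?thesis
      using d(1) R by (intro exI[of _ "min d R"]) auto
  qed
  then obtain \<eta> where \<eta>: "\<eta> > 0" "\<eta> \<le> R" "\<And>t. \<bar>t\<bar> < \<eta> \<Longrightarrow> m < Re (g 0 t)"
    by blast
  obtain e C where e: "e > 0" "\<And>w. w \<in> ball 0 e \<Longrightarrow> Re w > 0 \<Longrightarrow> norm (hecke_D 0 w - 4 / w) \<le> C"
    using hecke_D_0_near_pole by blast
  \<comment> \<open>For |w| < 2 \<delta> the error C is at most 2 / |w|, half of the polar term 4 /
    |w|, so |D_0| is still at least 2 / |w|.\<close>
  define \<delta> where "\<delta> = min \<eta> (min e (2 / (\<bar>C\<bar> + 1))) / 2"
  have \<delta>: "\<delta> > 0" "2 * \<delta> \<le> \<eta>" "2 * \<delta> \<le> e" "2 * \<delta> \<le> 2 / (\<bar>C\<bar> + 1)"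
    using \<eta> e by (auto simp: \<delta>_def)
  have lower: "norm (hecke_D 0 (Complex s t)) \<ge> 2 / norm (Complex s t)"
    if st: "0 < s" "s < \<delta>" "\<bar>t\<bar> < \<delta>" for s t
  proof -
    define w where "w = Complex s t"
    have nw: "norm w < 2 * \<delta>" "w \<noteq> 0"
      using cmod_le[of w] st by (auto simp: w_def complex_eq_iff)
    have C: "norm (hecke_D 0 w - 4 / w) \<le> C"
      using e(2)[of w] nw \<delta>(3) st by (auto simp: w_def)
    have "norm w * (\<bar>C\<bar> + 1) \<le> 2 * \<delta> * (\<bar>C\<bar> + 1)"
      using nw by (intro mult_right_mono) auto
    also have "\<dots> \<le> 2"
      using \<delta>(4) by (simp add: field_simps)
    finally have "\<bar>C\<bar> + 1 \<le> 2 / norm w"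
      using nw by (simp add: field_simps)
    then have "C \<le> 2 / norm w"
      by linarith
    moreover have "norm (4 / w) - norm (hecke_D 0 w) \<le> norm (hecke_D 0 w - 4 / w)"
      by (metis norm_minus_commute norm_triangle_ineq2)
    moreover have "norm (4 / w) = 2 / norm w + 2 / norm w"
      by (simp add: norm_divide)
    ultimately show ?thesis
      unfolding w_def[symmetric] using C by linarith
  qed
  \<comment> \<open>Only the trivial frequency has a pole, so only there is an interval around t = 0
    cut out.\<close>
  define T where "T = (\<lambda>k::int. if k = 0 then {-R..-\<delta>} \<union> {\<delta>..R} else {-R..R})"
  have "\<exists>s0 B. s0 > 0 \<and> B \<ge> 0 \<and> (\<forall>s t. 0 < s \<longrightarrow> s < s0 \<longrightarrow> t \<in> T k \<longrightarrow> norm (hecke_D k (Complex s t)) \<le> B)" for k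
  proof -
    have "compact (T k)"
      unfolding T_def by (auto intro: compact_Un)
    moreover have "k \<noteq> 0 \<or> t \<noteq> 0" if "t \<in> T k" for t
      using that \<delta>(1) by (auto simp: T_def split: if_splits)
    ultimately show ?thesis
      using hecke_D_bounded_on_compact[of "T k" k] by metis
  qed
  then obtain s0 B where s0: "\<And>k. s0 k > (0::real)" and B: "\<And>k. B k \<ge> (0::real)"
    "\<And>k s t. 0 < s \<Longrightarrow> s < s0 k \<Longrightarrow> t \<in> T k \<Longrightarrow> norm (hecke_D k (Complex s t)) \<le> B k"
    by metis
  have "\<exists>G. \<forall>t\<in>{-R..R}. \<bar>Re (g k t)\<bar> \<le> G" if "k \<in> S" for k
  proof -
    have "bounded ((\<lambda>t. Re (g k t)) ` {-R..R})"
      using cont[OF that] by (intro compact_imp_bounded compact_continuous_image continuous_intros) auto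
    then show ?thesis
      by (auto simp: bounded_iff)
  qed
  then obtain G where G: "\<And>k t. k \<in> S \<Longrightarrow> t \<in> {-R..R} \<Longrightarrow> \<bar>Re (g k t)\<bar> \<le> G k"
    by metis
  have G0: "G k \<ge> 0" if "k \<in> S" for k
    using G[OF that, of 0] R by (meson abs_ge_zero atLeastAtMost_iff less_imp_le neg_le_0_iff_le order_trans)
  define K where "K = (\<lambda>k. G k * (B k)\<^sup>2)"
  have K0: "K k \<ge> 0" if "k \<in> S" for k
    using G0[OF that] by (simp add: K_def)
  define K' where "K' = (\<Sum>k\<in>S. K k * (2 * R))"
  have K'0: "K' \<ge> 0"
    unfolding K'_def using K0 R by (intro sum_nonneg) auto
  \<comment> \<open>The thresholds for s: stay where the pole dominates, keep K' s \<le> m, and stay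
    inside the range of every bound B k.\<close>
  define W where "W = insert (\<delta> / 2) (insert (m / (K' + 1)) ((\<lambda>k. s0 k / 2) ` S))"
  have W: "finite W" "W \<noteq> {}"
    unfolding W_def using S(1) by auto
  define s where "s = Min W"
  have "\<forall>x\<in>W. x > 0"
    unfolding W_def using \<delta>(1) m(1) K'0 s0 by auto
  then have s: "s > 0"
    unfolding s_def using W by (subst Min_gr_iff) auto
  have sW: "s \<le> x" if "x \<in> W" for x
    unfolding s_def using W(1) that by (rule Min_le)
  have "s \<le> \<delta> / 2" "s \<le> m / (K' + 1)"
    by (rule sW, simp add: W_def)+
  moreover have "s < s0 k" if "k \<in> S" for k
    using s0[of k] sW[of "s0 k / 2"] that by (force simp: W_def)
  ultimately have s': "s < \<delta>" "s * (K' + 1) \<le> m" "\<And>k. k \<in> S \<Longrightarrow> s < s0 k"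
    using \<delta>(1) K'0 by (simp_all add: field_simps)
  have off: "- K k \<le> Re (g k t) * (norm (hecke_D k (Complex s t)))\<^sup>2" if "k \<in> S" "t \<in> {-R..R}" "t \<in> T k" for k t
  proof -
    have "\<bar>Re (g k t) * (norm (hecke_D k (Complex s t)))\<^sup>2\<bar> = \<bar>Re (g k t)\<bar> * (norm (hecke_D k (Complex s t)))\<^sup>2"
      by (simp add: abs_mult)
    also have "\<dots> \<le> K k"
      unfolding K_def using B(2)[OF s s'(3)] G G0 that by (intro mult_mono power_mono) auto
    finally show ?thesis
      by linarith
  qed
  \<comment> \<open>For |t| \<le> s one has |s + it|^2 \<le> 2 s^2, so m (2 / |s + it|)^2 is at
    least 2 m / s^2. This step function of integral 4 m / s avoids evaluating the integral of 1 /
    (s^2 + t^2).\<close>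
  define \<psi> where "\<psi> = (\<lambda>t. if t \<in> {-s..s} then 2 * m / s\<^sup>2 else 0)"
  have \<psi>: "(\<psi> has_integral 4 * m / s) {-R..R}"
  proof -
    have "((\<lambda>t. 2 * m / s\<^sup>2) has_integral (2 * m / s\<^sup>2) * (s - (- s))) {-s..s}"
      using has_integral_const_real[of "2 * m / s\<^sup>2" "-s" s] s by (simp add: mult.commute)
    then show ?thesis
      unfolding \<psi>_def using s s'(1) \<delta> \<eta>(2)
      by (subst has_integral_restrict) (auto simp: power2_eq_square field_simps)
  qed
  have main: "\<psi> t - K 0 \<le> Re (g 0 t) * (norm (hecke_D 0 (Complex s t)))\<^sup>2" if t: "t \<in> {-R..R}" for t
  proof (cases "\<bar>t\<bar> < \<delta>")
    case False
    then have "t \<in> T 0" "\<psi> t = 0"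
      using t s s'(1) by (auto simp: T_def \<psi>_def)
    then show ?thesis
      using off[OF S(2) t] by simp
  next
    case True
    have gm: "m < Re (g 0 t)"
      using \<eta>(3)[of t] True \<delta> by simp
    have "\<psi> t \<le> m * (2 / norm (Complex s t))\<^sup>2"
    proof (cases "t \<in> {-s..s}")
      case t: True
      then have "t\<^sup>2 \<le> s\<^sup>2"
        by (auto simp: abs_le_square_iff[symmetric] abs_le_iff)
      then have "(norm (Complex s t))\<^sup>2 \<le> 2 * s\<^sup>2"
        by (simp add: cmod_power2)
      moreover have "0 < (norm (Complex s t))\<^sup>2"
        using s by (simp add: complex_eq_iff)
      ultimately have "4 / (2 * s\<^sup>2) \<le> 4 / (norm (Complex s t))\<^sup>2"
        by (intro divide_left_mono) (use s in auto)
      then have "m * (4 / (2 * s\<^sup>2)) \<le> m * (4 / (norm (Complex s t))\<^sup>2)"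
        using m(1) by (intro mult_left_mono) auto
      then show ?thesis
        using t by (simp add: \<psi>_def power_divide mult.commute)
    next
      case False
      then have "\<psi> t = 0"
        by (auto simp: \<psi>_def)
      then show ?thesis
        using m(1) by simp
    qed
    also have "\<dots> \<le> Re (g 0 t) * (norm (hecke_D 0 (Complex s t)))\<^sup>2"
      using lower[OF s s'(1) True] gm m(1) by (intro mult_mono power_mono) auto
    finally show ?thesis
      using K0[OF S(2)] by linarith
  qed
  have int: "(\<lambda>t. Re (g k t) * (norm (hecke_D k (Complex s t)))\<^sup>2) integrable_on {-R..R}" if "k \<in> S" for k
    using continuous_on_hecke_D(1)[OF s] cont[OF that]
    by (intro integrable_continuous_interval continuous_intros) auto
  have Kint: "((\<lambda>t. K k) has_integral K k * (2 * R)) {-R..R}" for k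
    using has_integral_const_real[of "K k" "-R" R] R by (simp add: mult.commute)
  have I0: "4 * m / s - K 0 * (2 * R) \<le> integral {-R..R} (\<lambda>t. Re (g 0 t) * (norm (hecke_D 0 (Complex s t)))\<^sup>2)"
    using has_integral_le[OF has_integral_diff[OF \<psi> Kint] integrable_integral[OF int[OF S(2)]]] main by blast
  have Ik: "- (K k * (2 * R)) \<le> integral {-R..R} (\<lambda>t. Re (g k t) * (norm (hecke_D k (Complex s t)))\<^sup>2)"
    if k: "k \<in> S - {0}" for k
  proof -
    have "k \<in> S"
      using k by simp
    show ?thesis
      by (rule has_integral_le[OF has_integral_neg[OF Kint] integrable_integral[OF int[OF \<open>k \<in> S\<close>]]])
        (use off[OF \<open>k \<in> S\<close>] k in \<open>auto simp: T_def\<close>)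
  qed
  have "4 * m / s - K' = (4 * m / s - K 0 * (2 * R)) + (\<Sum>k\<in>S - {0}. - (K k * (2 * R)))"
    unfolding K'_def using S by (subst sum.remove[of S 0]) (auto simp: sum_negf)
  also have "\<dots> \<le> integral {-R..R} (\<lambda>t. Re (g 0 t) * (norm (hecke_D 0 (Complex s t)))\<^sup>2)
      + (\<Sum>k\<in>S - {0}. integral {-R..R} (\<lambda>t. Re (g k t) * (norm (hecke_D k (Complex s t)))\<^sup>2))"
    by (intro add_mono I0 sum_mono Ik)
  also have "\<dots> = (\<Sum>k\<in>S. integral {-R..R} (\<lambda>t. Re (g k t) * (norm (hecke_D k (Complex s t)))\<^sup>2))"
    using S by (subst sum.remove[of S 0]) auto
  also have "\<dots> \<le> 0"
    by (rule integral_weighted_hecke_D_nonpos[OF S(1) cont neg s])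
  finally have "4 * m \<le> K' * s"
    using s by (simp add: field_simps)
  moreover have "K' * s \<le> m"
    using s'(2) s by (simp add: algebra_simps)
  ultimately show False
    using m(1) by linarith
qed

section \<open>A band-limited minorant\<close>

lemma has_integral_even_extension:
  fixes f :: "real \<Rightarrow> real"
  assumes "(f has_integral I) {0..R}" "R \<ge> 0"
  shows "((\<lambda>t. f \<bar>t\<bar>) has_integral 2 * I) {-R..R}"
proof -
  have "((\<lambda>t. f (- t)) has_integral I) {-R..0}"
    using assms(1) has_integral_reflect_real[of f I R 0] by simp
  then have "((\<lambda>t. f \<bar>t\<bar>) has_integral I) {-R..0}"
    by (rule has_integral_eq[rotated]) auto
  moreover have "((\<lambda>t. f \<bar>t\<bar>) has_integral I) {0..R}"
    using assms(1) by (rule has_integral_eq[rotated]) auto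
  ultimately have "((\<lambda>t. f \<bar>t\<bar>) has_integral (I + I)) {-R..R}"
    using assms(2) by (intro has_integral_combine) auto
  then show ?thesis
    by simp
qed

text \<open>For R = pi / a and 0 \<le> t \<le> R this is the autocorrelation of the arch cos (a u)
  on |u| \<le> R / 2, normalised to 1 at t = 0. Autocorrelations have nonnegative
  transforms.\<close>

definition kernel :: "real \<Rightarrow> real \<Rightarrow> real \<Rightarrow> real" where
  "kernel a R t = (1 - t / R) * cos (a * t) + sin (a * t) / pi"

definition kernel_transform :: "real \<Rightarrow> real \<Rightarrow> real \<Rightarrow> real" where
  "kernel_transform a R x = integral {0..R} (\<lambda>t. kernel a R t * cos (t * x))"

text \<open>For $R = \pi / a$ the even extension $c$ of \<^term>\<open>kernel a R\<close> to $[-R, R]$ is $C^2$, vanishes together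
  with $c'$ at the endpoints, has a nonnegative cosine transform, and satisfies
  $c'' + a^2 c = (2a/R) \sin (a |t|)$. Hence the transform of $c'' + \eta c$ changes sign exactly at $x^2 = \eta$.\<close>

context
  fixes a R :: real
  assumes a: "a > 0" and R: "R = pi / a"
begin

lemma kernel_radius_pos: "R > 0"
  using a R by simp

lemma kernel_transform_has_integral: "((\<lambda>t. kernel a R t * cos (t * x)) has_integral kernel_transform a R x) {0..R}"
  unfolding kernel_transform_def kernel_def
  by (intro integrable_integral integrable_continuous_interval continuous_intros) (use kernel_radius_pos in auto)

text \<open>Two integrations by parts replace c'' by -x^2 c under the transform. The boundary terms
  vanish because c' is 0 at both ends, c is 0 at R, and sin (t x) is 0 at t = 0.\<close>

lemma sin_cos_has_integral:
  "((\<lambda>t. 2 * a / R * sin (a * t) * cos (t * x)) has_integral (a\<^sup>2 - x\<^sup>2) * kernel_transform a R x) {0..R}"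
proof -
  have aR: "a * R = pi" "1 / R = a / pi"
    using a R by simp_all
  define c' where "c' = (\<lambda>t. - (1 - t / R) * a * sin (a * t))"
  \<comment> \<open>An antiderivative of (c'' + x^2 c) cos (t x), with c'' rewritten by the
    differential equation.\<close>
  define F where "F = (\<lambda>t. c' t * cos (t * x) + x * (kernel a R t * sin (t * x)))"
  have dc: "(kernel a R has_real_derivative c' t) (at t)" for t
    unfolding kernel_def c'_def using a aR(2) by (auto intro!: derivative_eq_intros simp: field_simps)
  have dc': "(c' has_real_derivative 2 * a / R * sin (a * t) - a\<^sup>2 * kernel a R t) (at t)" for t
  proof -
    have "a\<^sup>2 * (sin (a * t) / pi) = a / R * sin (a * t)"
      using a by (simp add: R field_simps power2_eq_square)
    moreover have "(c' has_real_derivative a / R * sin (a * t) - (1 - t / R) * a\<^sup>2 * cos (a * t)) (at t)"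
      unfolding c'_def using kernel_radius_pos by (auto intro!: derivative_eq_intros simp: field_simps power2_eq_square)
    ultimately show ?thesis
      unfolding kernel_def by (simp add: algebra_simps)
  qed
  have dF: "(F has_real_derivative (2 * a / R * sin (a * t) - (a\<^sup>2 - x\<^sup>2) * kernel a R t) * cos (t * x)) (at t)" for t
    unfolding F_def
    by (rule derivative_eq_intros dc dc' refl)+ (simp add: algebra_simps power2_eq_square)
  have "((\<lambda>t. (2 * a / R * sin (a * t) - (a\<^sup>2 - x\<^sup>2) * kernel a R t) * cos (t * x)) has_integral (F R - F 0)) {0..R}"
    using kernel_radius_pos dF
    by (intro fundamental_theorem_of_calculus)
      (auto simp: has_real_derivative_iff_has_vector_derivative[symmetric] intro: DERIV_subset)
  moreover have "F R - F 0 = 0"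
    using kernel_radius_pos aR(1) by (simp add: F_def c'_def kernel_def)
  ultimately have "((\<lambda>t. (2 * a / R * sin (a * t) - (a\<^sup>2 - x\<^sup>2) * kernel a R t) * cos (t * x)) has_integral 0) {0..R}"
    by simp
  from has_integral_add[OF this has_integral_mult_right[OF kernel_transform_has_integral[of x], of "a\<^sup>2 - x\<^sup>2"]]
  show ?thesis
    by (rule has_integral_eq[rotated, OF has_integral_eq_rhs]) (simp_all add: algebra_simps)
qed

text \<open>Integrating sin (a t) cos (t x) explicitly gives (a^2 - x^2)^2 times the transform as a
  positive multiple of 1 + cos (R x). At x^2 = a^2 this says nothing; there the sine part of the
  kernel integrates to 0 and (1 - t / R) cos^2 (a t) remains.\<close>

lemma kernel_transform_nonneg: "kernel_transform a R x \<ge> 0"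
proof (cases "x\<^sup>2 = a\<^sup>2")
  case False
  have aR: "a * R = pi"
    using a R by simp
  define b where "b = 2 * a / R"
  define H where "H = (\<lambda>t. - b * (a * (cos (a * t) * cos (t * x)) + x * (sin (a * t) * sin (t * x))))"
  have dH: "(H has_real_derivative (a\<^sup>2 - x\<^sup>2) * (b * sin (a * t) * cos (t * x))) (at t)" for t
    unfolding H_def by (rule derivative_eq_intros refl)+ (simp add: algebra_simps power2_eq_square)
  have i1: "((\<lambda>t. (a\<^sup>2 - x\<^sup>2) * (b * sin (a * t) * cos (t * x))) has_integral (H R - H 0)) {0..R}"
    using kernel_radius_pos dH
    by (intro fundamental_theorem_of_calculus)
      (auto simp: has_real_derivative_iff_has_vector_derivative[symmetric] intro: DERIV_subset)
  have Hb: "H R - H 0 = b * (a * (1 + cos (R * x)))"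
    unfolding H_def aR by (simp add: algebra_simps)
  have i2: "((\<lambda>t. (a\<^sup>2 - x\<^sup>2) * (b * sin (a * t) * cos (t * x))) has_integral
      (a\<^sup>2 - x\<^sup>2) * ((a\<^sup>2 - x\<^sup>2) * kernel_transform a R x)) {0..R}"
    unfolding b_def by (intro has_integral_mult_right sin_cos_has_integral)
  have "(a\<^sup>2 - x\<^sup>2) * ((a\<^sup>2 - x\<^sup>2) * kernel_transform a R x) = b * (a * (1 + cos (R * x)))"
    using has_integral_unique[OF i2 i1] by (simp only: Hb)
  then have eq: "(a\<^sup>2 - x\<^sup>2)\<^sup>2 * kernel_transform a R x = b * (a * (1 + cos (R * x)))"
    by (simp add: power2_eq_square mult.assoc)
  have "1 + cos (R * x) \<ge> 0"
    using cos_ge_minus_one[of "R * x"] by linarith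
  then have "(a\<^sup>2 - x\<^sup>2)\<^sup>2 * kernel_transform a R x \<ge> 0"
    unfolding eq b_def using a kernel_radius_pos by (intro mult_nonneg_nonneg) auto
  then show ?thesis
    using False by (simp add: zero_le_mult_iff)
next
  case True
  then have "x = a \<or> x = - a"
    by (simp add: power2_eq_iff)
  then have cx: "cos (t * x) = cos (a * t)" for t
    by (auto simp: mult.commute)
  have aR: "a * R = pi"
    using a R by simp
  define H where "H = (\<lambda>t. (sin (a * t))\<^sup>2 / (2 * a * pi))"
  have dH: "(H has_real_derivative sin (a * t) * cos (a * t) / pi) (at t)" for t
    unfolding H_def using a by (auto intro!: derivative_eq_intros simp: field_simps)
  have "((\<lambda>t. sin (a * t) * cos (a * t) / pi) has_integral (H R - H 0)) {0..R}"
    using kernel_radius_pos dH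
    by (intro fundamental_theorem_of_calculus)
      (auto simp: has_real_derivative_iff_has_vector_derivative[symmetric] intro: DERIV_subset)
  moreover have "H R - H 0 = 0"
    by (simp add: H_def aR)
  ultimately have h0: "((\<lambda>t. sin (a * t) * cos (a * t) / pi) has_integral 0) {0..R}"
    by simp
  have "((\<lambda>t. kernel a R t * cos (t * x) - sin (a * t) * cos (a * t) / pi) has_integral (kernel_transform a R x - 0)) {0..R}"
    by (intro has_integral_diff kernel_transform_has_integral h0)
  then have "((\<lambda>t. (1 - t / R) * (cos (a * t))\<^sup>2) has_integral kernel_transform a R x) {0..R}"
    unfolding cx kernel_def by (rule has_integral_eq[rotated, OF has_integral_eq_rhs])
      (simp_all add: algebra_simps power2_eq_square)
  then show ?thesis
    by (rule has_integral_nonneg) (use kernel_radius_pos in \<open>auto intro!: mult_nonneg_nonneg\<close>)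
qed

end

section \<open>The angular factor\<close>

text \<open>These are the Fourier coefficients of (2 + 2 Re \<zeta>)^N = |1 + \<zeta>|^(2N) on the
  unit circle, a nonnegative trigonometric polynomial peaking at \<zeta> = 1.\<close>

definition trig_coeff :: "nat \<Rightarrow> int \<Rightarrow> real" where
  "trig_coeff N k = (if \<bar>k\<bar> \<le> int N then real ((2 * N) choose nat (int N + k)) else 0)"

text \<open>On the unit circle (1 + \<zeta>)^2 = \<zeta> (2 + 2 Re \<zeta>), so the sum is the
  binomial expansion of (1 + \<zeta>)^(2N) divided by \<zeta>^N. The larger range \<open>M\<close>
  lets the degrees N and N + 1 share one index set.\<close>

lemma trig_coeff_sum:
  fixes \<zeta> :: complex
  assumes \<zeta>: "norm \<zeta> = 1" and "N \<le> M"
  shows "(\<Sum>k\<in>{- int M..int M}. of_real (trig_coeff N k) * \<zeta> powi k) = of_real ((2 + 2 * Re \<zeta>) ^ N)"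
proof -
  have \<zeta>0: "\<zeta> \<noteq> 0"
    using \<zeta> by auto
  have "(\<Sum>k\<in>{- int M..int M}. of_real (trig_coeff N k) * \<zeta> powi k)
      = (\<Sum>k\<in>{- int N..int N}. of_real (trig_coeff N k) * \<zeta> powi k)"
    by (rule sum.mono_neutral_right) (use assms(2) in \<open>auto simp: trig_coeff_def\<close>)
  also have "\<dots> = (\<Sum>j\<le>2 * N. of_nat ((2 * N) choose j) * \<zeta> powi (int j - int N))"
    by (rule sum.reindex_bij_witness[of _ "\<lambda>j. int j - int N" "\<lambda>k. nat (int N + k)"])
      (auto simp: trig_coeff_def)
  also have "\<dots> = (\<Sum>j\<le>2 * N. of_nat ((2 * N) choose j) * \<zeta> ^ j) / \<zeta> ^ N"
    using \<zeta>0 by (simp add: power_int_diff sum_divide_distrib)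
  also have "(\<Sum>j\<le>2 * N. of_nat ((2 * N) choose j) * \<zeta> ^ j) = (\<zeta> + 1) ^ (2 * N)"
    by (simp add: binomial_ring)
  also have "\<dots> = ((\<zeta> + 1)\<^sup>2) ^ N"
    by (rule power_mult)
  also have "(\<zeta> + 1)\<^sup>2 = \<zeta> * of_real (2 + 2 * Re \<zeta>)"
  proof -
    have "\<zeta> * cnj \<zeta> = 1"
      using \<zeta> by (simp add: complex_norm_square[symmetric])
    moreover have "\<zeta> * of_real (2 + 2 * Re \<zeta>) = 2 * \<zeta> + \<zeta> * (\<zeta> + cnj \<zeta>)"
      by (simp add: complex_add_cnj algebra_simps)
    ultimately show ?thesis
      by (simp add: power2_eq_square algebra_simps)
  qed
  also have "(\<zeta> * of_real (2 + 2 * Re \<zeta>)) ^ N / \<zeta> ^ N = of_real ((2 + 2 * Re \<zeta>) ^ N)"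
    using \<zeta>0 by (simp add: power_mult_distrib)
  finally show ?thesis .
qed

text \<open>The left-hand side is the mean over the circle of $(1 - \mathrm{Re}\,\zeta)(2 + 2\,\mathrm{Re}\,\zeta)^N$.\<close>

lemma trig_coeff_0_Suc:
  "2 * trig_coeff N 0 - trig_coeff (Suc N) 0 / 2 = trig_coeff N 0 / (real N + 1)"
proof -
  have "Suc N * (2 * Suc N choose Suc N) = (2 * Suc N) * (2 * N + 1 choose N)"
    using Suc_times_binomial_eq[of "2 * N + 1" N] by (simp del: binomial_Suc_Suc)
  then have "Suc N * (2 * Suc N choose Suc N) = Suc N * (2 * (2 * N + 1 choose N))"
    by (simp only: mult_ac)
  then have 1: "(2 * Suc N choose Suc N) = 2 * (2 * N + 1 choose N)"
    by (simp only: Suc_mult_cancel1)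
  have "Suc N * (2 * N + 1 choose Suc N) = (2 * N + 1) * (2 * N choose N)"
    using Suc_times_binomial_eq[of "2 * N" N] by (simp del: binomial_Suc_Suc)
  moreover have "(2 * N + 1 choose Suc N) = (2 * N + 1 choose N)"
    using binomial_symmetric[of N "2 * N + 1"] by (simp del: binomial_Suc_Suc)
  ultimately have "Suc N * (2 * N + 1 choose N) = (2 * N + 1) * (2 * N choose N)"
    by simp
  then have "(real N + 1) * real (2 * N + 1 choose N) = (2 * real N + 1) * real (2 * N choose N)"
    by (metis (no_types, lifting) Suc_eq_plus1 of_nat_Suc of_nat_add of_nat_mult of_nat_numeral of_nat_1)
  then have "(real N + 1) * (2 * trig_coeff N 0 - trig_coeff (Suc N) 0 / 2) = trig_coeff N 0"
    using 1 by (simp add: trig_coeff_def algebra_simps nat_add_distrib)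
  then show ?thesis
    by (simp add: field_simps)
qed

lemma trig_coeff_0_pos: "trig_coeff N 0 > 0"
  by (simp add: trig_coeff_def zero_less_binomial)

section \<open>Density\<close>

lemma norm_sgn_divide_sgn:
  fixes y z :: complex
  assumes "y \<noteq> 0" "z \<noteq> 0"
  shows "norm (sgn y / sgn z) = 1"
  using assms by (simp add: norm_divide norm_sgn)

text \<open>The test function is the minorant
  $(\eta - x^2 - (1 - \mathrm{Re}\,\zeta))\, K(x)\, (2 + 2\,\mathrm{Re}\,\zeta)^N$ with $K \ge 0$ the transform of
  \<^const>\<open>kernel\<close>: it is positive only near $(x, \zeta) = (0, 1)$, yet its Fourier coefficient at the
  trivial character is positive once $N + 1 > 2 / \eta$.\<close>

lemma gaussian_prime_quotient_approx:
  assumes z: "z \<noteq> 0" and \<eta>: "\<eta> > 0"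
  obtains p q where "gaussian_prime p" "gaussian_prime q"
    "(ln (norm (p / q)) - ln (norm z))\<^sup>2 < \<eta>" "1 - Re (sgn (p / q) / sgn z) < \<eta>"
proof -
  define x0 where "x0 = ln (norm z)"
  \<comment> \<open>A choice with a^2 < \<eta> leaves the positive value \<eta> - a^2 of c'' +
    \<eta> c at t = 0; taking it to be \<eta> / 2 gives the threshold 2 / \<eta> for N.\<close>
  define a where "a = sqrt (\<eta> / 2)"
  define R where "R = pi / a"
  have a: "a > 0" "a\<^sup>2 = \<eta> / 2"
    using \<eta> by (simp_all add: a_def)
  have R: "R > 0"
    using a by (simp add: R_def)
  obtain N :: nat where N: "2 / \<eta> < real N"
    using reals_Archimedean2 by blast
  define S where "S = {- int (Suc N)..int (Suc N)}"
  \<comment> \<open>The first summand is c'' + \<eta> c times the coefficients of (2 + 2 Re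
    \<zeta>)^N. The second uses 1 - Re \<zeta> = 2 - (2 + 2 Re \<zeta>) / 2 to express the factor 1
    - Re \<zeta> through degrees N and N + 1.\<close>
  define G where "G = (\<lambda>k t. (2 * a / R * sin (a * t) + (\<eta> - a\<^sup>2) * kernel a R t) * trig_coeff N k
    - kernel a R t * (2 * trig_coeff N k - trig_coeff (Suc N) k / 2))"
  \<comment> \<open>The extra phases translate the test function from the identity to
    \<open>z\<close>.\<close>
  define g where "g = (\<lambda>k t. of_real (G k \<bar>t\<bar>) * (exp (\<i> * of_real (t * x0)) * inverse (sgn z powi k)))"
  have S: "finite S" "0 \<in> S"
    by (auto simp: S_def)
  have contG: "continuous_on A (\<lambda>t. G k \<bar>t\<bar>)" for k A
    unfolding G_def kernel_def by (intro continuous_intros) (use R in auto)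
  have cont: "continuous_on {-R..R} (g k)" for k
    unfolding g_def by (intro continuous_intros contG)
  have g0: "Re (g 0 0) > 0"
  proof -
    have "Re (g 0 0) = (\<eta> / 2) * trig_coeff N 0 - trig_coeff N 0 / (real N + 1)"
      unfolding g_def G_def trig_coeff_0_Suc a(2) by (simp add: kernel_def)
    also have "\<dots> = trig_coeff N 0 * (\<eta> / 2 - 1 / (real N + 1))"
      by (simp add: algebra_simps)
    also have "\<dots> > 0"
    proof (rule mult_pos_pos[OF trig_coeff_0_pos])
      have "2 < \<eta> * (real N + 1)"
        using N \<eta> by (simp add: field_simps)
      then show "0 < \<eta> / 2 - 1 / (real N + 1)"
        by (simp add: field_simps)
    qed
    finally show ?thesis .
  qed
  have "\<exists>p q. gaussian_prime p \<and> gaussian_prime q \<and>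
    (ln (norm (p / q)) - ln (norm z))\<^sup>2 < \<eta> \<and> 1 - Re (sgn (p / q) / sgn z) < \<eta>"
  proof (rule ccontr)
    assume none: "\<not> ?thesis"
    have "Re (g 0 0) \<le> 0"
    proof (rule hecke_D_mean_square_functional[OF S R cont])
      fix p q assume pq: "gaussian_prime p" "gaussian_prime q"
      then have "p / q \<noteq> 0"
        by (auto simp: gaussian_prime_def)
      define x where "x = ln (norm (p / q)) - x0"
      define \<zeta> where "\<zeta> = sgn (p / q) / sgn z"
      have \<zeta>: "norm \<zeta> = 1"
        unfolding \<zeta>_def by (rule norm_sgn_divide_sgn[OF \<open>p / q \<noteq> 0\<close> z])
      have far: "\<eta> \<le> x\<^sup>2 \<or> \<eta> \<le> 1 - Re \<zeta>"
        using none pq unfolding x_def \<zeta>_def x0_def by (meson not_le)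
      define T where "T = (2 + 2 * Re \<zeta>) ^ N"
      have Re\<zeta>: "\<bar>Re \<zeta>\<bar> \<le> 1"
        using abs_Re_le_cmod[of \<zeta>] \<zeta> by simp
      have T: "T \<ge> 0"
        unfolding T_def using Re\<zeta> by (intro zero_le_power) linarith
      define Q where "Q = (\<lambda>t. T * (2 * a / R * sin (a * t) + (\<eta> - a\<^sup>2 - (1 - Re \<zeta>)) * kernel a R t))"
      have gG: "g k t * (exp (- (\<i> * of_real (t * ln (norm (p / q))))) * sgn (p / q) powi k)
          = exp (- (\<i> * of_real (t * x))) * (of_real (G k \<bar>t\<bar>) * \<zeta> powi k)" for k t
      proof -
        have e1: "exp (\<i> * of_real (t * x0)) * exp (- (\<i> * of_real (t * ln (norm (p / q))))) = exp (- (\<i> * of_real (t * x)))"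
          by (simp add: mult_exp_exp x_def algebra_simps)
        have e2: "inverse (sgn z powi k) * sgn (p / q) powi k = \<zeta> powi k"
          unfolding \<zeta>_def power_int_divide_distrib[of "sgn _"] by (simp only: divide_inverse mult.commute)
        have "g k t * (exp (- (\<i> * of_real (t * ln (norm (p / q))))) * sgn (p / q) powi k)
            = (exp (\<i> * of_real (t * x0)) * exp (- (\<i> * of_real (t * ln (norm (p / q))))))
              * (of_real (G k \<bar>t\<bar>) * (inverse (sgn z powi k) * sgn (p / q) powi k))"
          unfolding g_def by (simp only: mult_ac)
        then show ?thesis
          by (simp only: e1 e2)
      qed
      have GQ: "(\<Sum>k\<in>S. of_real (G k t) * \<zeta> powi k) = of_real (Q t)" for t
      proof -
        define u v where "u = 2 * a / R * sin (a * t) + (\<eta> - a\<^sup>2) * kernel a R t" and "v = kernel a R t"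
        have "(\<Sum>k\<in>S. of_real (G k t) * \<zeta> powi k) =
            (\<Sum>k\<in>S. of_real (u - 2 * v) * (of_real (trig_coeff N k) * \<zeta> powi k)
              + of_real (v / 2) * (of_real (trig_coeff (Suc N) k) * \<zeta> powi k))"
          by (rule sum.cong) (simp_all add: G_def u_def v_def algebra_simps)
        also have "\<dots> = of_real (u - 2 * v) * (\<Sum>k\<in>S. of_real (trig_coeff N k) * \<zeta> powi k)
              + of_real (v / 2) * (\<Sum>k\<in>S. of_real (trig_coeff (Suc N) k) * \<zeta> powi k)"
          by (simp only: sum.distrib sum_distrib_left)
        also have "\<dots> = of_real (u - 2 * v) * of_real T + of_real (v / 2) * of_real ((2 + 2 * Re \<zeta>) ^ Suc N)"
          unfolding S_def T_def using trig_coeff_sum[OF \<zeta>, of N "Suc N"] trig_coeff_sum[OF \<zeta>, of "Suc N" "Suc N"] by simp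
        also have "\<dots> = of_real ((u - 2 * v) * T + v / 2 * (2 + 2 * Re \<zeta>) ^ Suc N)"
          by (simp only: of_real_add of_real_mult)
        also have "(u - 2 * v) * T + v / 2 * (2 + 2 * Re \<zeta>) ^ Suc N = Q t"
          by (simp add: Q_def T_def u_def v_def algebra_simps)
        finally show ?thesis .
      qed
      have "(\<Sum>k\<in>S. integral {-R..R} (\<lambda>t. Re (g k t * (exp (- (\<i> * of_real (t * ln (norm (p / q))))) * sgn (p / q) powi k))))
          = integral {-R..R} (\<lambda>t. \<Sum>k\<in>S. Re (exp (- (\<i> * of_real (t * x))) * (of_real (G k \<bar>t\<bar>) * \<zeta> powi k)))"
        unfolding gG using S(1)
        by (intro integral_sum[symmetric] integrable_continuous_interval continuous_intros contG)
      also have "\<dots> = integral {-R..R} (\<lambda>t. Q \<bar>t\<bar> * cos (\<bar>t\<bar> * x))"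
      proof (rule integral_cong)
        fix t
        have "(\<Sum>k\<in>S. Re (exp (- (\<i> * of_real (t * x))) * (of_real (G k \<bar>t\<bar>) * \<zeta> powi k)))
            = Re (exp (- (\<i> * of_real (t * x))) * of_real (Q \<bar>t\<bar>))"
          unfolding GQ[symmetric] sum_distrib_left Re_sum ..
        also have "\<dots> = Q \<bar>t\<bar> * cos (t * x)"
          by (simp add: Re_exp)
        also have "cos (t * x) = cos (\<bar>t\<bar> * x)"
          by (simp add: abs_if)
        finally show "(\<Sum>k\<in>S. Re (exp (- (\<i> * of_real (t * x))) * (of_real (G k \<bar>t\<bar>) * \<zeta> powi k))) = Q \<bar>t\<bar> * cos (\<bar>t\<bar> * x)" .
      qed
      also have "\<dots> = 2 * (T * ((\<eta> - x\<^sup>2 - (1 - Re \<zeta>)) * kernel_transform a R x))"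
      proof (rule integral_unique, rule has_integral_even_extension)
        have "((\<lambda>t. T * (2 * a / R * sin (a * t) * cos (t * x) + (\<eta> - a\<^sup>2 - (1 - Re \<zeta>)) * (kernel a R t * cos (t * x))))
            has_integral T * ((a\<^sup>2 - x\<^sup>2) * kernel_transform a R x + (\<eta> - a\<^sup>2 - (1 - Re \<zeta>)) * kernel_transform a R x)) {0..R}"
          by (intro has_integral_mult_right has_integral_add sin_cos_has_integral kernel_transform_has_integral a(1) R_def)
        then show "((\<lambda>t. Q t * cos (t * x)) has_integral T * ((\<eta> - x\<^sup>2 - (1 - Re \<zeta>)) * kernel_transform a R x)) {0..R}"
          by (rule has_integral_eq[rotated, OF has_integral_eq_rhs]) (simp_all add: Q_def algebra_simps)
      qed (use R in simp)
      also have "\<dots> \<le> 0"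
      proof -
        have "\<eta> - x\<^sup>2 - (1 - Re \<zeta>) \<le> 0"
          using far Re\<zeta> zero_le_power2[of x] by linarith
        then have "(\<eta> - x\<^sup>2 - (1 - Re \<zeta>)) * kernel_transform a R x \<le> 0"
          using kernel_transform_nonneg[OF a(1) R_def] by (rule mult_nonpos_nonneg)
        then show ?thesis
          using T by (simp add: mult_nonneg_nonpos)
      qed
      finally show "(\<Sum>k\<in>S. integral {-R..R} (\<lambda>t. Re (g k t * (exp (- (\<i> * of_real (t * ln (norm (p / q))))) * sgn (p / q) powi k)))) \<le> 0" .
    qed
    then show False
      using g0 by simp
  qed
  then show ?thesis
    using that by blast
qed

text \<open>In polar form p / q = z e^x \<zeta>, and each of e^x and \<zeta> is brought within
  \<epsilon> / 2 of 1.\<close>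

lemma gaussian_prime_quotient_near:
  assumes z: "z \<noteq> 0" and e: "e > 0"
  obtains p q where "gaussian_prime p" "gaussian_prime q" "dist (p / q) z < e"
proof -
  define \<epsilon> where "\<epsilon> = e / norm z"
  have \<epsilon>: "\<epsilon> > 0"
    using z e by (simp add: \<epsilon>_def)
  have "(exp \<longlongrightarrow> exp 0) (at (0::real))"
    by (intro tendsto_intros)
  then obtain d where d: "d > 0" "\<And>x. \<bar>x\<bar> < d \<Longrightarrow> \<bar>exp x - 1\<bar> < \<epsilon> / (2::real)"
    using \<epsilon> unfolding LIM_eq by (metis diff_0_right exp_zero abs_zero diff_self half_gt_zero real_norm_def)
  \<comment> \<open>The second bound comes from |\<zeta> - 1|^2 = 2 (1 - Re \<zeta>) on the unit
    circle.\<close>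
  define \<eta> where "\<eta> = min (d\<^sup>2) ((\<epsilon> / 2)\<^sup>2 / 2)"
  have "\<eta> > 0"
    using d(1) \<epsilon> by (simp add: \<eta>_def)
  then obtain p q where pq: "gaussian_prime p" "gaussian_prime q"
    "(ln (norm (p / q)) - ln (norm z))\<^sup>2 < \<eta>" "1 - Re (sgn (p / q) / sgn z) < \<eta>"
    using gaussian_prime_quotient_approx[OF z] by blast
  have nz: "p / q \<noteq> 0"
    using pq(1,2) by (auto simp: gaussian_prime_def)
  define x where "x = ln (norm (p / q)) - ln (norm z)"
  define \<zeta> where "\<zeta> = sgn (p / q) / sgn z"
  have \<zeta>: "norm \<zeta> = 1"
    unfolding \<zeta>_def by (rule norm_sgn_divide_sgn[OF nz z])
  have "x\<^sup>2 < d\<^sup>2"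
    using pq(3) by (simp add: x_def \<eta>_def)
  then have "\<bar>x\<bar> < d"
    using d(1) power2_less_imp_less[of "\<bar>x\<bar>" d] by simp
  then have ex: "\<bar>exp x - 1\<bar> < \<epsilon> / 2"
    by (rule d(2))
  have "(norm (\<zeta> - 1))\<^sup>2 = (norm \<zeta>)\<^sup>2 - 2 * Re \<zeta> + 1"
    unfolding cmod_power2 by (simp add: power2_eq_square algebra_simps)
  also have "\<dots> < (\<epsilon> / 2)\<^sup>2"
    using pq(4)[folded \<zeta>_def] \<zeta> by (simp add: \<eta>_def)
  finally have "norm (\<zeta> - 1) < \<epsilon> / 2"
    by (rule power2_less_imp_less) (use \<epsilon> in simp)
  have "exp x = norm (p / q) / norm z"
    unfolding x_def using nz z by (simp add: exp_diff)
  then have "of_real (exp x) * \<zeta> * z = of_real (norm (p / q)) * sgn (p / q) * (z / (of_real (norm z) * sgn z))"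
    by (simp add: \<zeta>_def)
  also have "\<dots> = p / q"
    using z nz by (simp add: sgn_eq)
  finally have "p / q - z = z * ((of_real (exp x) - 1) * \<zeta> + (\<zeta> - 1))"
    by (simp add: algebra_simps)
  then have "dist (p / q) z = norm z * norm ((of_real (exp x) - 1) * \<zeta> + (\<zeta> - 1))"
    by (simp add: dist_norm norm_mult)
  also have "norm ((of_real (exp x) - 1) * \<zeta> + (\<zeta> - 1)) \<le> \<bar>exp x - 1\<bar> + norm (\<zeta> - 1)"
  proof -
    have "norm (of_real (exp x - 1) * \<zeta>) = \<bar>exp x - 1\<bar>"
      unfolding norm_mult \<zeta> norm_of_real by simp
    then show ?thesis
      using norm_triangle_ineq[of "of_real (exp x - 1) * \<zeta>" "\<zeta> - 1"] by simp
  qed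
  also have "\<dots> < \<epsilon>"
    using ex \<open>norm (\<zeta> - 1) < \<epsilon> / 2\<close> by linarith
  finally have "dist (p / q) z < norm z * \<epsilon>"
    using z by (simp add: mult_left_mono)
  then have "dist (p / q) z < e"
    using z by (simp add: \<epsilon>_def)
  then show ?thesis
    using that pq(1,2) by blast
qed

theorem theorem2p2:
  "closure {\<pi>\<^sub>1 / \<pi>\<^sub>2 | \<pi>\<^sub>1 \<pi>\<^sub>2. gaussian_prime \<pi>\<^sub>1 \<and> gaussian_prime \<pi>\<^sub>2} = (UNIV :: complex set)"
proof -
  let ?Q = "{\<pi>\<^sub>1 / \<pi>\<^sub>2 | \<pi>\<^sub>1 \<pi>\<^sub>2. gaussian_prime \<pi>\<^sub>1 \<and> gaussian_prime \<pi>\<^sub>2}"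
  have "z \<in> closure ?Q" if "z \<noteq> 0" for z
    unfolding closure_approachable using gaussian_prime_quotient_near[OF that] by (metis (mono_tags, lifting) mem_Collect_eq)
  \<comment> \<open>Logarithmic coordinates exclude 0, which is recovered as a limit of nonzero
    points.\<close>
  then have "- {0} \<subseteq> closure ?Q"
    by auto
  then have "closure (- {0}) \<subseteq> closure ?Q"
    by (rule closure_minimal) simp
  moreover have "closure (- {0 :: complex}) = UNIV"
    by (simp add: closure_complement)
  ultimately show ?thesis
    by auto
qed

end
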